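(* Let $\iota\in\mathbb Z/2$, and let $M$ be a $\check{\mathcal A}^{\tau,\iota}_{\vec\ell}$-module generated by a subspace $M_0$ such that $\check{\mathcal A}^{\tau,\iota}_{\vec\ell,m}(M_0)=\{0\}$ for some $m\in\mathbb N$ with $m>\tilde\ell$. Then the following defines a representation $\sigma_M$ of the Lie algebra $\hat{\mathcal A}^\tau_{\vec\ell}$ on $M$: $\sigma_M(\kappa)=\kappa_0$ and $$\sigma_M(a^\tau_{\vec\ell}(r,z))=\sum_{l_1,l_2\in\mathcal Z}\langle-l_2-\iota-1/2\rangle_r\,a^{\tau,\iota}_{\vec\ell}(l_1,l_2)z^{-l_1-l_2-2\iota-r-1}+(r+\ell_j)!\,\Im_{0,r+\ell_j}(\mathrm{tr}\,a)\kappa_0z^{-r-\ell_j-1}-(-1)^\epsilon r!\,\ell_i!\,\Im_{r,\ell_i}(\mathrm{tr}\,a)\kappa_0z^{-r-\ell_i-1}$$ for $i,j\in\overline{1,n}$, $a\in\mathcal B_{i,j}$ and $r\in\mathbb N$.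
   Context: All spaces are over $\mathbb C$; $\mathbb N$ = nonnegative integers; $\overline{1,n}=\{1,\dots,n\}$; $\mathcal Z=\mathbb Z+1/2$; $\mathbb Z/2=\{k/2:k\in\mathbb Z\}$; $\langle\mu\rangle_0=1$, $\langle\mu\rangle_m=\mu(\mu-1)\cdots(\mu-m+1)$. $\mathbb A=\sum_{i\ge0}\mathbb C[t,t^{-1}]\partial_t^i$, $\partial_t=d/dt$. $\mathcal A$ is an associative algebra with identity $1_{\mathcal A}$ and a linear map $\mathrm{tr}:\mathcal A\to\mathbb C$ with $\mathrm{tr}\,1_{\mathcal A}\ne0$, $\mathrm{tr}\,ab=\mathrm{tr}\,ba$. It has left ideals $\mathcal B_1,\dots,\mathcal B_n$ with $\mathcal A=\bigoplus_i\mathcal B_i$, and subspace decompositions $\mathcal B_j=\bigoplus_{i=1}^n\mathcal B_{i,j}$ with $\mathcal B_{i,j}\mathcal B_{l,k}=\{0\}$ if $j\ne l$. $\tau$ is a linear transformation of $\mathcal A$ with $\tau^2=\mathrm{Id}$, $\tau(1_{\mathcal A})=1_{\mathcal A}$, $\tau(ab)=\tau(b)\tau(a)$, $\mathrm{tr}\circ\tau=\mathrm{tr}$ and $\tau(\mathcal B_{i,j})\subset\mathcal B_{\pi(j),\pi(i)}$ for a permutation $\pi$ of $\overline{1,n}$. Fix $\epsilon\in\{0,1\}$ and $\vec\ell=(\ell_1,\dots,\ell_n)\in\mathbb N^n$ with $\ell_i\in2\mathbb Z+\epsilon$ and $\ell_i=\ell_{\pi(i)}$ for all $i$. $\hat{\mathcal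 A}=\mathcal A\otimes\mathbb A\oplus\mathbb C\kappa$ is the Lie algebra with $\kappa$ central and $$[a\otimes t^{i_1}\partial_t^{j_1},b\otimes t^{i_2}\partial_t^{j_2}]=ab\otimes t^{i_1}\partial_t^{j_1}\cdot t^{i_2}\partial_t^{j_2}-ba\otimes t^{i_2}\partial_t^{j_2}\cdot t^{i_1}\partial_t^{j_1}+(-1)^{j_1}\delta_{i_1+i_2,j_1+j_2}j_1!j_2!\binom{i_1}{j_1+j_2+1}(\mathrm{tr}\,ab)\kappa.$$ $\hat{\mathcal A}^\tau_{\vec\ell}$ is the Lie subalgebra spanned by $\kappa$ and all $a\otimes t^m\partial_t^{r+\ell_j}-(-1)^\epsilon\tau(a)\otimes(-\partial_t)^rt^m\partial_t^{\ell_i}$ with $i,j\in\overline{1,n}$, $a\in\mathcal B_{i,j}$, $r\in\mathbb N$, $m\in\mathbb Z$. For such $a,r$, $$a^\tau_{\vec\ell}(r,z)=\sum_{m\in\mathbb Z}\bigl(a\otimes t^m\partial_t^{r+\ell_j}-(-1)^\epsilon\tau(a)\otimes(-\partial_t)^rt^m\partial_t^{\ell_i}\bigr)z^{-m-1}.$$ $\check{\mathcal A}=\bigoplus_{i,j\in\mathcal Z}\mathcal At_1^it_2^j\oplus\mathbb C\kappa_0$, $a(i,j)=at_1^it_2^j$, is the Lie algebra with $\kappa_0$ central and $$[a(l_1,l_2),b(k_1,k_2)]=\delta_{l_2+k_1,0}ab(l_1,k_2)-\delta_{l_1+k_2,0}ba(k_1,l_2)+\delta_{l_1+k_2,0}\delta_{l_2+k_1,0}[H(l_1)H(l_2)-H(k_1)H(k_2)](\mathrm{tr}\,ab)\kappa_0,$$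 $H(l)=1$ for $l>0$, $0$ for $l<0$. For $a\in\mathcal B_{i,j}$ and $l_1,l_2\in\mathcal Z$, $$a^{\tau,\iota}_{\vec\ell}(l_1,l_2)=(-1)^\epsilon\langle l_2+\iota-1/2\rangle_{\ell_j}a(l_1,l_2+2\iota-\ell_j)-\langle l_1+\iota-1/2\rangle_{\ell_i}\tau(a)(l_2,l_1+2\iota-\ell_i).$$ $\check{\mathcal A}^{\tau,\iota}_{\vec\ell}$ is the Lie subalgebra of $\check{\mathcal A}$ spanned by $\kappa_0$ and all $a^{\tau,\iota}_{\vec\ell}(l_1,l_2)$ ($i,j\in\overline{1,n}$, $a\in\mathcal B_{i,j}$, $l_1,l_2\in\mathcal Z$). $\tilde\ell=|2\iota|+\max\{\ell_1,\dots,\ell_n\}$, and for $m>\tilde\ell$, $\check{\mathcal A}^{\tau,\iota}_{\vec\ell,m}$ is the span of all $a^{\tau,\iota}_{\vec\ell}(l_1,-l_2)$ with $i,j\in\overline{1,n}$, $a\in\mathcal B_{i,j}$, $l_1,l_2\in\mathcal Z$, $l_1,l_2>m$. The constants $\Im_{r_1,r_2}$ are defined by $\sum_{r_1,r_2\ge0}\Im_{r_1,r_2}x^{r_1}y^{r_2}z^{-r_1-r_2-1}=\frac1{x-y}\bigl((\frac{z+y}{z+x})^\iota-1\bigr)$, expanded in nonnegative powers of $x,y$. *)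

theory Defs
  imports
    Complex_Main
    "HOL-Library.Poly_Mapping"
    "HOL-Library.Product_Plus"
    "HOL-Computational_Algebra.Formal_Power_Series"
begin

section \<open>Falling factorials and differential operators\<close>

definition falling :: "complex \<Rightarrow> nat \<Rightarrow> complex" where
  "falling \<mu> m = (\<Prod>i<m. \<mu> - of_nat i)"

text \<open>The algebra of differential operators on Laurent polynomials, in its basis
  \<open>t^i \<partial>^j\<close> (\<open>i\<close> an integer, \<open>j\<close> a natural number), which is indexed by the pair \<open>(i, j)\<close>.\<close>

type_synonym dop = "(int \<times> nat) \<Rightarrow>\<^sub>0 complex"

definition dop_mon :: "int \<Rightarrow> nat \<Rightarrow> dop" where
  "dop_mon i j = Poly_Mapping.single (i, j) 1"

text \<open>Leibniz rule: \<open>t^i\<^sub>1 \<partial>^j\<^sub>1 \<cdot> t^i\<^sub>2 \<partial>^j\<^sub>2\<close> is the sum over \<open>s\<close> of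
  \<open>(j\<^sub>1 choose s) i\<^sub>2 (i\<^sub>2 - 1) \<dots> (i\<^sub>2 - s + 1) t^(i\<^sub>1 + i\<^sub>2 - s) \<partial>^(j\<^sub>1 + j\<^sub>2 - s)\<close>.
  Lemma \<open>falling_leibniz\<close> below says that both sides act in the same way on \<open>t^k\<close>.\<close>

definition dop_mon_mult :: "int \<times> nat \<Rightarrow> int \<times> nat \<Rightarrow> dop" where
  "dop_mon_mult p q = (case (p, q) of ((i1, j1), (i2, j2)) \<Rightarrow>
     (\<Sum>s\<le>j1. Poly_Mapping.single (i1 + i2 - int s, j1 + j2 - s)
        (of_nat (j1 choose s) * falling (of_int i2) s)))"

definition dop_mult :: "dop \<Rightarrow> dop \<Rightarrow> dop" where
  "dop_mult D E = (\<Sum>p\<in>Poly_Mapping.keys D. \<Sum>q\<in>Poly_Mapping.keys E.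
     Poly_Mapping.map ((*) (Poly_Mapping.lookup D p * Poly_Mapping.lookup E q)) (dop_mon_mult p q))"

text \<open>\<open>(-\<partial>)^r\<close>\<close>

definition neg_ddt_pow :: "nat \<Rightarrow> dop" where
  "neg_ddt_pow r = Poly_Mapping.single (0, r) ((-1) ^ r)"

lemma falling_gbinomial: "falling \<mu> m = fact m * (\<mu> gchoose m)"
  by (simp add: falling_def gbinomial_prod_rev atLeast0LessThan)

lemma falling_add: "falling \<mu> (m + n) = falling \<mu> m * falling (\<mu> - of_nat m) n"
  by (induction n) (auto simp: falling_def algebra_simps)

lemma falling_leibniz:
  "falling k j2 * falling (k - of_nat j2 + of_int i2) j1
     = (\<Sum>s\<le>j1. of_nat (j1 choose s) * falling (of_int i2) s * falling k (j1 + j2 - s))"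
proof -
  have "falling (k - of_nat j2 + of_int i2) j1
      = (\<Sum>s\<le>j1. of_nat (j1 choose s) * falling (of_int i2) s * falling (k - of_nat j2) (j1 - s))"
  proof -
    have "of_int i2 + (k - of_nat j2) gchoose j1
        = (\<Sum>s\<le>j1. (of_int i2 gchoose s) * (k - of_nat j2 gchoose (j1 - s)))"
      by (simp add: gbinomial_Vandermonde[symmetric] atLeast0AtMost)
    then have "falling (k - of_nat j2 + of_int i2) j1
        = (\<Sum>s\<le>j1. fact j1 * ((of_int i2 gchoose s) * (k - of_nat j2 gchoose (j1 - s))))"
      by (simp add: falling_gbinomial sum_distrib_left add.commute)
    also have "\<dots> = (\<Sum>s\<le>j1. of_nat (j1 choose s) * falling (of_int i2) s
        * falling (k - of_nat j2) (j1 - s))"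
      by (rule sum.cong) (auto simp: falling_gbinomial binomial_fact)
    finally show ?thesis .
  qed
  then have "falling k j2 * falling (k - of_nat j2 + of_int i2) j1
      = (\<Sum>s\<le>j1. of_nat (j1 choose s) * falling (of_int i2) s
          * (falling k j2 * falling (k - of_nat j2) (j1 - s)))"
    by (simp add: sum_distrib_left mult_ac)
  also have "\<dots> = (\<Sum>s\<le>j1. of_nat (j1 choose s) * falling (of_int i2) s * falling k (j1 + j2 - s))"
    by (rule sum.cong) (auto simp: falling_add[symmetric] add.commute)
  finally show ?thesis .
qed


section \<open>Direct sums and the algebra with its trace, ideals and anti-involution\<close>

definition direct_sum_decomp ::
    "(complex \<Rightarrow> 'a::ab_group_add \<Rightarrow> 'a) \<Rightarrow> 'i set \<Rightarrow> ('i \<Rightarrow> 'a set) \<Rightarrow> 'a set \<Rightarrow> bool" where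
  "direct_sum_decomp s I S V \<longleftrightarrow>
     (\<forall>i\<in>I. module.subspace s (S i)) \<and>
     V = {(\<Sum>i\<in>I. f i) | f. \<forall>i\<in>I. f i \<in> S i} \<and>
     (\<forall>f. (\<forall>i\<in>I. f i \<in> S i) \<longrightarrow> (\<Sum>i\<in>I. f i) = 0 \<longrightarrow> (\<forall>i\<in>I. f i = 0))"

text \<open>\<open>L j\<close> are the left ideals and \<open>B i j\<close> the pieces of \<open>L j\<close>.\<close>

locale twisted_trace_algebra = vector_space sA
  for sA :: "complex \<Rightarrow> 'a::ring_1 \<Rightarrow> 'a" +
  fixes tr :: "'a \<Rightarrow> complex"
    and n :: nat
    and L :: "nat \<Rightarrow> 'a set"
    and B :: "nat \<Rightarrow> nat \<Rightarrow> 'a set"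
    and \<tau> :: "'a \<Rightarrow> 'a"
    and \<pi> :: "nat \<Rightarrow> nat"
    and \<epsilon> :: nat
    and \<l> :: "nat \<Rightarrow> nat"
  assumes scale_mult_left: "sA c a * b = sA c (a * b)"
    and scale_mult_right: "a * sA c b = sA c (a * b)"
    and tr_linear: "Vector_Spaces.linear sA (*) tr"
    and tr_one: "tr 1 \<noteq> 0"
    and tr_comm: "tr (a * b) = tr (b * a)"
    and left_ideal: "j \<in> {1..n} \<Longrightarrow> b \<in> L j \<Longrightarrow> a * b \<in> L j"
    and decomp_ideals: "direct_sum_decomp sA {1..n} L UNIV"
    and decomp_pieces: "j \<in> {1..n} \<Longrightarrow> direct_sum_decomp sA {1..n} (\<lambda>i. B i j) (L j)"
    and pieces_mult: "\<lbrakk>i \<in> {1..n}; j \<in> {1..n}; l \<in> {1..n}; k \<in> {1..n}; j \<noteq> l;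
                       a \<in> B i j; b \<in> B l k\<rbrakk> \<Longrightarrow> a * b = 0"
    and tau_linear: "Vector_Spaces.linear sA sA \<tau>"
    and tau_tau: "\<tau> (\<tau> a) = a"
    and tau_one: "\<tau> 1 = 1"
    and tau_mult: "\<tau> (a * b) = \<tau> b * \<tau> a"
    and tr_tau: "tr (\<tau> a) = tr a"
    and perm: "bij_betw \<pi> {1..n} {1..n}"
    and tau_pieces: "i \<in> {1..n} \<Longrightarrow> j \<in> {1..n} \<Longrightarrow> \<tau> ` B i j \<subseteq> B (\<pi> j) (\<pi> i)"
    and eps: "\<epsilon> \<in> {0, 1}"
    and l_parity: "i \<in> {1..n} \<Longrightarrow> \<exists>k::int. int (\<l> i) = 2 * k + int \<epsilon>"
    and l_perm: "i \<in> {1..n} \<Longrightarrow> \<l> (\<pi> i) = \<l> i"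


section \<open>The centrally extended Lie algebras\<close>

text \<open>Both Lie algebras are direct sums of a space of finitely supported families of elements of
  the algebra and of a one-dimensional centre: the pair \<open>(X, c)\<close> is \<open>X + c \<kappa>\<close>.\<close>

definition ext_scale ::
    "(complex \<Rightarrow> 'a::ring_1 \<Rightarrow> 'a) \<Rightarrow> complex \<Rightarrow> ('k \<Rightarrow>\<^sub>0 'a) \<times> complex \<Rightarrow> ('k \<Rightarrow>\<^sub>0 'a) \<times> complex" where
  "ext_scale sA c X = (Poly_Mapping.map (sA c) (fst X), c * snd X)"

abbreviation central :: "('k \<Rightarrow>\<^sub>0 'a::ring_1) \<times> complex" where
  "central \<equiv> (0, 1)"

type_synonym 'a hatA = "((int \<times> nat) \<Rightarrow>\<^sub>0 'a) \<times> complex"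

definition tens :: "(complex \<Rightarrow> 'a::ring_1 \<Rightarrow> 'a) \<Rightarrow> 'a \<Rightarrow> dop \<Rightarrow> 'a hatA" where
  "tens sA a D = (Poly_Mapping.map (\<lambda>c. sA c a) D, 0)"

definition hat_bracket_mon ::
    "(complex \<Rightarrow> 'a::ring_1 \<Rightarrow> 'a) \<Rightarrow> ('a \<Rightarrow> complex) \<Rightarrow>
     'a \<Rightarrow> int \<times> nat \<Rightarrow> 'a \<Rightarrow> int \<times> nat \<Rightarrow> 'a hatA" where
  "hat_bracket_mon sA tr a p b q = (case (p, q) of ((i1, j1), (i2, j2)) \<Rightarrow>
     tens sA (a * b) (dop_mult (dop_mon i1 j1) (dop_mon i2 j2))
     - tens sA (b * a) (dop_mult (dop_mon i2 j2) (dop_mon i1 j1))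
     + (0, (-1) ^ j1 * (if i1 + i2 = int j1 + int j2 then 1 else 0) * fact j1 * fact j2
           * (of_int i1 gchoose (j1 + j2 + 1)) * tr (a * b)))"

definition hat_bracket ::
    "(complex \<Rightarrow> 'a::ring_1 \<Rightarrow> 'a) \<Rightarrow> ('a \<Rightarrow> complex) \<Rightarrow> 'a hatA \<Rightarrow> 'a hatA \<Rightarrow> 'a hatA" where
  "hat_bracket sA tr X Y = (\<Sum>p\<in>Poly_Mapping.keys (fst X). \<Sum>q\<in>Poly_Mapping.keys (fst Y).
     hat_bracket_mon sA tr (Poly_Mapping.lookup (fst X) p) p (Poly_Mapping.lookup (fst Y) q) q)"

text \<open>The second Lie algebra is indexed by pairs of half-odd integers.  The index type here is the
  rationals; everything below only involves elements supported on \<open>half_odd \<times> half_odd\<close>, which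
  form a Lie algebra under \<open>check_bracket\<close>.\<close>

definition half_odd :: "rat set" where
  "half_odd = {of_int k + 1/2 | k. True}"

type_synonym 'a checkA = "((rat \<times> rat) \<Rightarrow>\<^sub>0 'a) \<times> complex"

definition mat_unit :: "'a::ring_1 \<Rightarrow> rat \<Rightarrow> rat \<Rightarrow> 'a checkA" where
  "mat_unit a l1 l2 = (Poly_Mapping.single (l1, l2) a, 0)"

definition heaviside :: "rat \<Rightarrow> complex" where
  "heaviside l = (if l > 0 then 1 else 0)"

definition check_bracket_mon ::
    "('a::ring_1 \<Rightarrow> complex) \<Rightarrow> 'a \<Rightarrow> rat \<times> rat \<Rightarrow> 'a \<Rightarrow> rat \<times> rat \<Rightarrow> 'a checkA" where
  "check_bracket_mon tr a p b q = (case (p, q) of ((l1, l2), (k1, k2)) \<Rightarrow>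
     (if l2 + k1 = 0 then mat_unit (a * b) l1 k2 else 0)
     - (if l1 + k2 = 0 then mat_unit (b * a) k1 l2 else 0)
     + (0, if l1 + k2 = 0 \<and> l2 + k1 = 0
           then (heaviside l1 * heaviside l2 - heaviside k1 * heaviside k2) * tr (a * b) else 0))"

definition check_bracket ::
    "('a::ring_1 \<Rightarrow> complex) \<Rightarrow> 'a checkA \<Rightarrow> 'a checkA \<Rightarrow> 'a checkA" where
  "check_bracket tr X Y = (\<Sum>p\<in>Poly_Mapping.keys (fst X). \<Sum>q\<in>Poly_Mapping.keys (fst Y).
     check_bracket_mon tr (Poly_Mapping.lookup (fst X) p) p (Poly_Mapping.lookup (fst Y) q) q)"


lemma vector_space_ext_scale:
  assumes "vector_space sA"
  shows "vector_space (ext_scale sA)"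
proof -
  interpret vector_space sA by fact
  have [simp]: "Poly_Mapping.lookup (Poly_Mapping.map (sA c) X) k = sA c (Poly_Mapping.lookup X k)"
    for c X and k :: 'k
    by (simp add: Poly_Mapping.map.rep_eq when_def)
  show ?thesis
    by unfold_locales
      (auto simp: ext_scale_def lookup_add scale_right_distrib scale_left_distrib
         intro!: prod_eqI poly_mapping_eqI simp: algebra_simps)
qed

text \<open>The brackets on the spanning elements.\<close>

lemma (in twisted_trace_algebra) hat_bracket_mon_eq:
  "hat_bracket sA tr (tens sA a (dop_mon i1 j1)) (tens sA b (dop_mon i2 j2)) =
     tens sA (a * b) (dop_mult (dop_mon i1 j1) (dop_mon i2 j2))
     - tens sA (b * a) (dop_mult (dop_mon i2 j2) (dop_mon i1 j1))
     + (0, (-1) ^ j1 * (if i1 + i2 = int j1 + int j2 then 1 else 0) * fact j1 * fact j2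
           * (of_int i1 gchoose (j1 + j2 + 1)) * tr (a * b))"
proof -
  interpret T: Vector_Spaces.linear sA "(*)" tr by (rule tr_linear)
  have tens_mon: "fst (tens sA c (dop_mon i j)) = Poly_Mapping.single (i, j) c" for c i j
    by (auto simp: tens_def dop_mon_def Poly_Mapping.map.rep_eq lookup_single when_def
        intro!: poly_mapping_eqI)
  have tens_0: "tens sA 0 D = 0" for D
    by (auto simp: tens_def zero_prod_def Poly_Mapping.map.rep_eq when_def intro!: poly_mapping_eqI)
  show ?thesis
    by (cases "a = 0"; cases "b = 0")
      (simp_all add: hat_bracket_def tens_mon hat_bracket_mon_def tens_0 T.zero
         flip: zero_prod_def)
qed

lemma (in twisted_trace_algebra) check_bracket_mon_eq:
  "check_bracket tr (mat_unit a l1 l2) (mat_unit b k1 k2) =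
     (if l2 + k1 = 0 then mat_unit (a * b) l1 k2 else 0)
     - (if l1 + k2 = 0 then mat_unit (b * a) k1 l2 else 0)
     + (0, if l1 + k2 = 0 \<and> l2 + k1 = 0
           then (heaviside l1 * heaviside l2 - heaviside k1 * heaviside k2) * tr (a * b) else 0)"
proof -
  interpret T: Vector_Spaces.linear sA "(*)" tr by (rule tr_linear)
  have mat_0: "mat_unit 0 p q = (0 :: 'a checkA)" for p q
    by (simp add: mat_unit_def zero_prod_def)
  show ?thesis
    by (cases "a = 0"; cases "b = 0")
      (simp_all add: check_bracket_def check_bracket_mon_def mat_0 T.zero
         flip: zero_prod_def, simp_all add: mat_unit_def zero_prod_def)
qed


section \<open>The twisted subalgebras\<close>

text \<open>\<open>hat_gen sA \<tau> \<epsilon> \<l> i j a r m\<close> is the coefficient of \<open>z^(-m-1)\<close> in \<open>a(r, z)\<close>, where \<open>a \<in> B i j\<close>.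
  The pair \<open>(i, j)\<close> has to be supplied since \<open>a = 0\<close> does not determine it.\<close>

definition hat_gen ::
    "(complex \<Rightarrow> 'a::ring_1 \<Rightarrow> 'a) \<Rightarrow> ('a \<Rightarrow> 'a) \<Rightarrow> nat \<Rightarrow> (nat \<Rightarrow> nat) \<Rightarrow>
     nat \<Rightarrow> nat \<Rightarrow> 'a \<Rightarrow> nat \<Rightarrow> int \<Rightarrow> 'a hatA" where
  "hat_gen sA \<tau> \<epsilon> \<l> i j a r m =
     tens sA a (dop_mon m (r + \<l> j))
     - ext_scale sA ((-1) ^ \<epsilon>) (tens sA (\<tau> a) (dop_mult (neg_ddt_pow r) (dop_mon m (\<l> i))))"

definition hat_sub ::
    "(complex \<Rightarrow> 'a::ring_1 \<Rightarrow> 'a) \<Rightarrow> nat \<Rightarrow> (nat \<Rightarrow> nat \<Rightarrow> 'a set) \<Rightarrow> ('a \<Rightarrow> 'a) \<Rightarrow>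
     nat \<Rightarrow> (nat \<Rightarrow> nat) \<Rightarrow> 'a hatA set" where
  "hat_sub sA n B \<tau> \<epsilon> \<l> = module.span (ext_scale sA)
     (insert central
       {hat_gen sA \<tau> \<epsilon> \<l> i j a r m | i j a r m. i \<in> {1..n} \<and> j \<in> {1..n} \<and> a \<in> B i j})"

text \<open>Formal distributions are families of coefficients, the index \<open>k\<close> standing for \<open>z^k\<close>.\<close>

definition hat_field ::
    "(complex \<Rightarrow> 'a::ring_1 \<Rightarrow> 'a) \<Rightarrow> ('a \<Rightarrow> 'a) \<Rightarrow> nat \<Rightarrow> (nat \<Rightarrow> nat) \<Rightarrow>
     nat \<Rightarrow> nat \<Rightarrow> 'a \<Rightarrow> nat \<Rightarrow> int \<Rightarrow> 'a hatA" where
  "hat_field sA \<tau> \<epsilon> \<l> i j a r k = hat_gen sA \<tau> \<epsilon> \<l> i j a r (- k - 1)"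

definition check_gen ::
    "(complex \<Rightarrow> 'a::ring_1 \<Rightarrow> 'a) \<Rightarrow> ('a \<Rightarrow> 'a) \<Rightarrow> nat \<Rightarrow> (nat \<Rightarrow> nat) \<Rightarrow> rat \<Rightarrow>
     nat \<Rightarrow> nat \<Rightarrow> 'a \<Rightarrow> rat \<Rightarrow> rat \<Rightarrow> 'a checkA" where
  "check_gen sA \<tau> \<epsilon> \<l> \<iota> i j a l1 l2 =
     ext_scale sA ((-1) ^ \<epsilon> * falling (of_rat (l2 + \<iota> - 1/2)) (\<l> j))
       (mat_unit a l1 (l2 + 2 * \<iota> - of_nat (\<l> j)))
     - ext_scale sA (falling (of_rat (l1 + \<iota> - 1/2)) (\<l> i))
       (mat_unit (\<tau> a) l2 (l1 + 2 * \<iota> - of_nat (\<l> i)))"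

definition check_sub ::
    "(complex \<Rightarrow> 'a::ring_1 \<Rightarrow> 'a) \<Rightarrow> nat \<Rightarrow> (nat \<Rightarrow> nat \<Rightarrow> 'a set) \<Rightarrow> ('a \<Rightarrow> 'a) \<Rightarrow>
     nat \<Rightarrow> (nat \<Rightarrow> nat) \<Rightarrow> rat \<Rightarrow> 'a checkA set" where
  "check_sub sA n B \<tau> \<epsilon> \<l> \<iota> = module.span (ext_scale sA)
     (insert central
       {check_gen sA \<tau> \<epsilon> \<l> \<iota> i j a l1 l2 | i j a l1 l2.
          i \<in> {1..n} \<and> j \<in> {1..n} \<and> a \<in> B i j \<and> l1 \<in> half_odd \<and> l2 \<in> half_odd})"

definition l_bound :: "nat \<Rightarrow> (nat \<Rightarrow> nat) \<Rightarrow> rat \<Rightarrow> rat" where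
  "l_bound n \<l> \<iota> = \<bar>2 * \<iota>\<bar> + of_nat (Max (\<l> ` {1..n}))"

definition check_sub_ge ::
    "(complex \<Rightarrow> 'a::ring_1 \<Rightarrow> 'a) \<Rightarrow> nat \<Rightarrow> (nat \<Rightarrow> nat \<Rightarrow> 'a set) \<Rightarrow> ('a \<Rightarrow> 'a) \<Rightarrow>
     nat \<Rightarrow> (nat \<Rightarrow> nat) \<Rightarrow> rat \<Rightarrow> nat \<Rightarrow> 'a checkA set" where
  "check_sub_ge sA n B \<tau> \<epsilon> \<l> \<iota> m = module.span (ext_scale sA)
     {check_gen sA \<tau> \<epsilon> \<l> \<iota> i j a l1 (- l2) | i j a l1 l2.
        i \<in> {1..n} \<and> j \<in> {1..n} \<and> a \<in> B i j \<and> l1 \<in> half_odd \<and> l2 \<in> half_odd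
        \<and> l1 > of_nat m \<and> l2 > of_nat m}"


section \<open>Representations\<close>

text \<open>\<open>\<rho>\<close> is a representation, on the vector space \<open>('m, sM)\<close>, of the Lie algebra with carrier
  \<open>G\<close>, scalar multiplication \<open>sG\<close> and bracket \<open>br\<close>; the values of \<open>\<rho>\<close> outside \<open>G\<close> do not matter.\<close>

definition lie_representation ::
    "'g set \<Rightarrow> (complex \<Rightarrow> 'g::ab_group_add \<Rightarrow> 'g) \<Rightarrow> ('g \<Rightarrow> 'g \<Rightarrow> 'g) \<Rightarrow>
     (complex \<Rightarrow> 'm::ab_group_add \<Rightarrow> 'm) \<Rightarrow> ('g \<Rightarrow> 'm \<Rightarrow> 'm) \<Rightarrow> bool" where
  "lie_representation G sG br sM \<rho> \<longleftrightarrow>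
     vector_space sM \<and>
     (\<forall>x\<in>G. Vector_Spaces.linear sM sM (\<rho> x)) \<and>
     (\<forall>x\<in>G. \<forall>y\<in>G. \<forall>v. \<rho> (x + y) v = \<rho> x v + \<rho> y v) \<and>
     (\<forall>c. \<forall>x\<in>G. \<forall>v. \<rho> (sG c x) v = sM c (\<rho> x v)) \<and>
     (\<forall>x\<in>G. \<forall>y\<in>G. \<forall>v. \<rho> (br x y) v = \<rho> x (\<rho> y v) - \<rho> y (\<rho> x v))"

definition generated_by ::
    "'g set \<Rightarrow> (complex \<Rightarrow> 'm::ab_group_add \<Rightarrow> 'm) \<Rightarrow> ('g \<Rightarrow> 'm \<Rightarrow> 'm) \<Rightarrow> 'm set \<Rightarrow> bool" where
  "generated_by G sM \<rho> M0 \<longleftrightarrow>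
     (\<forall>N. module.subspace sM N \<and> M0 \<subseteq> N \<and> (\<forall>x\<in>G. \<forall>v\<in>N. \<rho> x v \<in> N) \<longrightarrow> N = UNIV)"


section \<open>The constants in the central correction\<close>

text \<open>The series \<open>\<Sum> c\<^sub>p\<^sub>q x^p y^q z^(-p-q-1) = (((z + y) / (z + x))^\<iota> - 1) / (x - y)\<close> is homogeneous of
  degree \<open>-1\<close>, so its coefficients are those at \<open>z = 1\<close>.  It is a formal power series in \<open>y\<close>
  (outer variable \<open>fps_X\<close>) over formal power series in \<open>x\<close> (inner variable \<open>fps_const fps_X\<close>), and
  \<open>((1 + y) / (1 + x))^\<iota>\<close> is the product of the binomial series of \<open>(1 + x)^(-\<iota>)\<close> and
  \<open>(1 + y)^\<iota>\<close>.\<close>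

definition im_rhs :: "rat \<Rightarrow> complex fps fps" where
  "im_rhs \<iota> = fps_const (fps_binomial (of_rat (- \<iota>)))
                 * Abs_fps (\<lambda>q. fps_const (of_rat \<iota> gchoose q)) - 1"

definition im_series :: "rat \<Rightarrow> complex fps fps" where
  "im_series \<iota> = (THE F. (fps_const fps_X - fps_X) * F = im_rhs \<iota>)"

definition im_coeff :: "rat \<Rightarrow> nat \<Rightarrow> nat \<Rightarrow> complex" where
  "im_coeff \<iota> r1 r2 = fps_nth (fps_nth (im_series \<iota>) r2) r1"

lemma im_rhs_nth:
  "fps_nth (fps_nth (im_rhs \<iota>) q) p =
     (of_rat (- \<iota>) gchoose p) * (of_rat \<iota> gchoose q) - (if p = 0 \<and> q = 0 then 1 else 0)"
  by (auto simp: im_rhs_def)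

lemma im_series_ex1: "\<exists>!F. (fps_const fps_X - fps_X) * F = im_rhs \<iota>"
proof (rule ex_ex1I)
  define g where "g p q = fps_nth (fps_nth (im_rhs \<iota>) q) p" for p q
  have diag: "(\<Sum>i\<le>k. g i (k - i)) = 0" for k
  proof -
    have "(\<Sum>i\<le>k. (of_rat (- \<iota>) gchoose i) * (of_rat \<iota> gchoose (k - i)))
        = (of_rat (- \<iota>) + of_rat \<iota> :: complex) gchoose k"
      by (simp add: gbinomial_Vandermonde[symmetric] atLeast0AtMost)
    also have "\<dots> = (if k = 0 then 1 else 0)"
      by (cases k) (simp_all add: of_rat_minus)
    finally show ?thesis
      by (cases "k = 0") (auto simp: g_def im_rhs_nth sum_subtractf intro!: sum.neutral)
  qed
  define F :: "complex fps fps" where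
    "F = Abs_fps (\<lambda>q. Abs_fps (\<lambda>p. - (\<Sum>i\<le>p. g i (p + q + 1 - i))))"
  have F: "fps_nth (fps_nth F q) p = - (\<Sum>i\<le>p. g i (p + q + 1 - i))" for p q
    by (simp add: F_def)
  have "fps_nth (fps_nth ((fps_const fps_X - fps_X) * F) q) p = g p q" for p q
  proof (cases p; cases q)
    assume "p = 0" "q = 0"
    then show ?thesis using diag[of 0] by (simp add: left_diff_distrib)
  next
    fix q' assume "p = 0" "q = Suc q'"
    then show ?thesis by (simp add: left_diff_distrib F)
  next
    fix p' assume "p = Suc p'" "q = 0"
    then show ?thesis using diag[of p] by (simp add: left_diff_distrib F add_eq_0_iff)
  next
    fix p' q' assume "p = Suc p'" "q = Suc q'"
    then show ?thesis by (simp add: left_diff_distrib F)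
  qed
  then show "\<exists>F. (fps_const fps_X - fps_X) * F = im_rhs \<iota>"
    by (intro exI[of _ F]) (auto simp: fps_eq_iff g_def)
next
  fix F G :: "complex fps fps"
  assume "(fps_const fps_X - fps_X) * F = im_rhs \<iota>" "(fps_const fps_X - fps_X) * G = im_rhs \<iota>"
  moreover have "fps_const fps_X - fps_X \<noteq> (0 :: complex fps fps)"
  proof
    assume "fps_const fps_X - fps_X = (0 :: complex fps fps)"
    then have "fps_nth (fps_const fps_X - fps_X :: complex fps fps) 1 = 0" by simp
    then show False by simp
  qed
  ultimately show "F = G" by (metis mult_left_cancel)
qed


section \<open>The formal distribution defining the representation\<close>

text \<open>One term of the double sum over \<open>l\<^sub>1, l\<^sub>2\<close>, applied to \<open>v\<close>; it is counted in the coefficient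
  of \<open>z^k\<close> only if its exponent \<open>-l\<^sub>1 - l\<^sub>2 - 2 \<iota> - r - 1\<close> of \<open>z\<close> is \<open>k\<close>.\<close>

definition sigma_term ::
    "(complex \<Rightarrow> 'a::ring_1 \<Rightarrow> 'a) \<Rightarrow> ('a \<Rightarrow> 'a) \<Rightarrow> nat \<Rightarrow> (nat \<Rightarrow> nat) \<Rightarrow> rat \<Rightarrow>
     (complex \<Rightarrow> 'm::ab_group_add \<Rightarrow> 'm) \<Rightarrow> ('a checkA \<Rightarrow> 'm \<Rightarrow> 'm) \<Rightarrow>
     nat \<Rightarrow> nat \<Rightarrow> 'a \<Rightarrow> nat \<Rightarrow> int \<Rightarrow> 'm \<Rightarrow> rat \<times> rat \<Rightarrow> 'm" where
  "sigma_term sA \<tau> \<epsilon> \<l> \<iota> sM \<rho> i j a r k v = (\<lambda>(l1, l2).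
     if l1 \<in> half_odd \<and> l2 \<in> half_odd \<and> - l1 - l2 - 2 * \<iota> - of_nat r - 1 = of_int k
     then sM (falling (of_rat (- l2 - \<iota> - 1/2)) r) (\<rho> (check_gen sA \<tau> \<epsilon> \<l> \<iota> i j a l1 l2) v)
     else 0)"

text \<open>The coefficient of \<open>z^k\<close> of the whole right-hand side, applied to \<open>v\<close>.  \<open>Sum_any\<close> is
  the sum of the nonzero terms, meaningful when these are finite in number.\<close>

definition sigma_coeff ::
    "(complex \<Rightarrow> 'a::ring_1 \<Rightarrow> 'a) \<Rightarrow> ('a \<Rightarrow> complex) \<Rightarrow> ('a \<Rightarrow> 'a) \<Rightarrow> nat \<Rightarrow> (nat \<Rightarrow> nat) \<Rightarrow> rat \<Rightarrow>
     (complex \<Rightarrow> 'm::ab_group_add \<Rightarrow> 'm) \<Rightarrow> ('a checkA \<Rightarrow> 'm \<Rightarrow> 'm) \<Rightarrow>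
     nat \<Rightarrow> nat \<Rightarrow> 'a \<Rightarrow> nat \<Rightarrow> int \<Rightarrow> 'm \<Rightarrow> 'm" where
  "sigma_coeff sA tr \<tau> \<epsilon> \<l> \<iota> sM \<rho> i j a r k v =
     Sum_any (sigma_term sA \<tau> \<epsilon> \<l> \<iota> sM \<rho> i j a r k v)
     + (if k = - int r - int (\<l> j) - 1
        then sM (fact (r + \<l> j) * im_coeff \<iota> 0 (r + \<l> j) * tr a) (\<rho> central v) else 0)
     - (if k = - int r - int (\<l> i) - 1
        then sM ((-1) ^ \<epsilon> * fact r * fact (\<l> i) * im_coeff \<iota> r (\<l> i) * tr a) (\<rho> central v) else 0)"

text \<open>\<open>\<sigma>\<close> is given on the spanning set by the stated formulas.\<close>

definition sigma_formula ::
    "(complex \<Rightarrow> 'a::ring_1 \<Rightarrow> 'a) \<Rightarrow> ('a \<Rightarrow> complex) \<Rightarrow> nat \<Rightarrow> (nat \<Rightarrow> nat \<Rightarrow> 'a set) \<Rightarrow>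
     ('a \<Rightarrow> 'a) \<Rightarrow> nat \<Rightarrow> (nat \<Rightarrow> nat) \<Rightarrow> rat \<Rightarrow>
     (complex \<Rightarrow> 'm::ab_group_add \<Rightarrow> 'm) \<Rightarrow> ('a checkA \<Rightarrow> 'm \<Rightarrow> 'm) \<Rightarrow> ('a hatA \<Rightarrow> 'm \<Rightarrow> 'm) \<Rightarrow> bool" where
  "sigma_formula sA tr n B \<tau> \<epsilon> \<l> \<iota> sM \<rho> \<sigma> \<longleftrightarrow>
     (\<forall>v. \<sigma> central v = \<rho> central v) \<and>
     (\<forall>i\<in>{1..n}. \<forall>j\<in>{1..n}. \<forall>a\<in>B i j. \<forall>r k v.
        \<sigma> (hat_field sA \<tau> \<epsilon> \<l> i j a r k) v = sigma_coeff sA tr \<tau> \<epsilon> \<l> \<iota> sM \<rho> i j a r k v)"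

end

theory Submission
  imports Defs "HOL-Computational_Algebra.Polynomial"
begin

text \<open>
  Both Lie algebras act by matrices on the space with basis \<open>t^(q + \<iota>)\<close>, \<open>q\<close> an integer, and
  coefficients in the algebra.  The element \<open>a(l\<^sub>1, l\<^sub>2)\<close> is a matrix unit in row \<open>l\<^sub>1 - 1/2\<close> and
  column \<open>-l\<^sub>2 - 1/2\<close>, and \<open>a \<otimes> t^i \<partial>^j\<close> sends \<open>t^u\<close> to \<open>u (u - 1) \<dots> (u - j + 1) a t^(u + i - j)\<close>,
  so it is a band matrix.  Once the factors with falling factorials are put together, the double sum
  in the definition of \<open>\<sigma>\<close> is the band matrix of the differential operator itself.  The statement
  therefore says that this infinite sum of elements of the twisted matrix algebra acts on \<open>M\<close>, and
  that the central term of the commutators is the prescribed one.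

  The twisting becomes transparent in terms of the idempotents \<open>e j\<close> of the decomposition into left
  ideals, for which \<open>B i j = e i A e j\<close>.  Put \<open>\<Lambda> = \<Sum> e j \<partial>^(\<l> j)\<close>, and combine \<open>\<tau>\<close> with the adjoint for
  the residue pairing into an anti-involution \<open>\<theta>\<close> of band matrices.  Then \<open>\<theta> \<Lambda> = (-1)^\<epsilon> \<Lambda>\<close>
  (\<open>adj_Lam\<close>), and up to the centre both twisted algebras consist of matrices \<open>X \<Lambda>\<close> with \<open>\<theta> X = -(-1)^\<epsilon> X\<close>
  (\<open>gen_at_eq\<close>, \<open>emb_skew_span\<close>, \<open>hat_sub_skew\<close>).  Such matrices are closed under commutators, because
  \<open>[X \<Lambda>, Y \<Lambda>] = (X \<Lambda> Y - Y \<Lambda> X) \<Lambda>\<close> and the factor in front of \<open>\<Lambda>\<close> is again skew.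

  The generators of the matrix algebra whose row and column are both large and positive, or both large
  and negative, kill a given vector of \<open>M\<close>: on \<open>M\<^sub>0\<close> one half of this is the hypothesis and the other half
  follows by applying \<open>\<theta>\<close>, and the property propagates to \<open>M\<close> since a far generator has bracket
  zero with any fixed generator (\<open>all_tame\<close>).  Hence the truncations of \<open>X \<Lambda>\<close> to growing windows
  eventually act on a vector in the same way, which defines the action of \<open>X \<Lambda>\<close>.  The commutator of two
  truncations differs from the truncation of the commutator only near the two ends of the window, so
  that the action is a projective representation with the cocycle of the matrix algebra
  (\<open>act_bracket\<close>).

  It remains to compare cocycles.  On \<open>a t^i\<^sub>1 \<partial>^j\<^sub>1\<close> and \<open>b t^i\<^sub>2 \<partial>^j\<^sub>2\<close> with \<open>i\<^sub>1 + i\<^sub>2 = j\<^sub>1 + j\<^sub>2\<close> and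
  \<open>s = i\<^sub>1 - j\<^sub>1\<close>, the matrix cocycle is \<open>S (\<iota> + s) - S \<iota>\<close> times \<open>tr (a b)\<close>, where \<open>S\<close> is the polynomial
  antidifference, vanishing at 0, of the symbol of the product.  The cocycle of the algebra of
  differential operators is \<open>S s\<close> times \<open>tr (a b)\<close> (\<open>prod_antidiff_at\<close>), and the difference of the
  two is the coboundary of the functional \<open>a t^k \<partial>^k \<mapsto> - (tr a) \<iota> (\<iota> - 1) \<dots> (\<iota> - k) / (k + 1)\<close> (\<open>bracket_mon_central\<close>).  A closed form
  of the constants (\<open>im_coeff_closed\<close>) shows that the values of this functional on the generators are the
  central terms in the definition of \<open>\<sigma>\<close> (\<open>central_part_hat_gen\<close>).
\<close>

section \<open>Band matrices\<close>

text \<open>The width of a band is arbitrary but finite.  This is the common home of finite matrices and of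
  differential operators; rows and columns are finitely supported, so these matrices form a ring.\<close>

typedef (overloaded) 'a band =
  "{F :: int \<Rightarrow> int \<Rightarrow> 'a::ring_1. \<exists>w. \<forall>p q. F p q \<noteq> 0 \<longrightarrow> \<bar>p - q\<bar> \<le> w}"
  morphisms entry Band
  by (rule exI[of _ "\<lambda>p q. 0"]) simp

lemma entry_Band:
  assumes "\<And>p q. F p q \<noteq> 0 \<Longrightarrow> \<bar>p - q\<bar> \<le> w"
  shows "entry (Band F) = F"
  using assms by (intro Band_inverse) blast

lemma band_width:
  obtains w where "\<And>p q. entry F p q \<noteq> 0 \<Longrightarrow> \<bar>p - q\<bar> \<le> w"
  using entry[of F] by blast

lemma band_eqI: "(\<And>p q. entry F p q = entry G p q) \<Longrightarrow> F = G"
  by (metis entry_inject ext)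

lemma finite_row: "finite {r. entry F p r \<noteq> 0}"
proof -
  obtain w where "\<And>p q. entry F p q \<noteq> 0 \<Longrightarrow> \<bar>p - q\<bar> \<le> w" using band_width[of F] by blast
  then have "{r. entry F p r \<noteq> 0} \<subseteq> {p - w..p + w}" by fastforce
  then show ?thesis by (rule finite_subset) simp
qed

instantiation band :: (ring_1) ring_1
begin

definition zero_band :: "'a band" where "0 = Band (\<lambda>p q. 0)"
definition one_band :: "'a band" where "1 = Band (\<lambda>p q. if p = q then 1 else 0)"
definition plus_band :: "'a band \<Rightarrow> 'a band \<Rightarrow> 'a band" where
  "F + G = Band (\<lambda>p q. entry F p q + entry G p q)"
definition minus_band :: "'a band \<Rightarrow> 'a band \<Rightarrow> 'a band" where
  "F - G = Band (\<lambda>p q. entry F p q - entry G p q)"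
definition uminus_band :: "'a band \<Rightarrow> 'a band" where
  "- F = Band (\<lambda>p q. - entry F p q)"
definition times_band :: "'a band \<Rightarrow> 'a band \<Rightarrow> 'a band" where
  "F * G = Band (\<lambda>p q. \<Sum>r | entry F p r \<noteq> 0. entry F p r * entry G r q)"

lemma entry_0 [simp]: "entry 0 p q = (0::'a)"
  unfolding zero_band_def by (subst entry_Band[where w = 0]) auto

lemma entry_1: "entry 1 p q = (if p = q then 1 else (0::'a))"
  unfolding one_band_def by (subst entry_Band[where w = 0]) (auto split: if_splits)

lemma entry_add [simp]: "entry (F + G) p q = entry F p q + (entry G p q :: 'a)"
proof -
  obtain w where w: "\<And>p q. entry F p q \<noteq> 0 \<Longrightarrow> \<bar>p - q\<bar> \<le> w" using band_width[of F] by blast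
  obtain w' where w': "\<And>p q. entry G p q \<noteq> 0 \<Longrightarrow> \<bar>p - q\<bar> \<le> w'" using band_width[of G] by blast
  have "\<bar>p - q\<bar> \<le> max w w'" if "entry F p q + entry G p q \<noteq> 0" for p q
    using w[of p q] w'[of p q] that by (cases "entry F p q = 0") auto
  then show ?thesis unfolding plus_band_def by (subst entry_Band[where w = "max w w'"]) auto
qed

lemma entry_uminus [simp]: "entry (- F) p q = - (entry F p q :: 'a)"
proof -
  obtain w where w: "\<And>p q. entry F p q \<noteq> 0 \<Longrightarrow> \<bar>p - q\<bar> \<le> w" using band_width[of F] by blast
  then show ?thesis unfolding uminus_band_def by (subst entry_Band[where w = w]) auto
qed

lemma entry_minus [simp]: "entry (F - G) p q = entry F p q - (entry G p q :: 'a)"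
proof -
  have "F - G = F + - G"
    unfolding minus_band_def plus_band_def[of F "- G"] by simp
  then show ?thesis by simp
qed

lemma entry_times_row:
  "entry (F * G) p q = (\<Sum>r | entry F p r \<noteq> 0. entry F p r * (entry G r q :: 'a))"
proof -
  obtain w where w: "\<And>p q. entry F p q \<noteq> 0 \<Longrightarrow> \<bar>p - q\<bar> \<le> w" using band_width[of F] by blast
  obtain w' where w': "\<And>p q. entry G p q \<noteq> 0 \<Longrightarrow> \<bar>p - q\<bar> \<le> w'" using band_width[of G] by blast
  have "\<bar>p - q\<bar> \<le> w + w'" if nz: "(\<Sum>r | entry F p r \<noteq> 0. entry F p r * entry G r q) \<noteq> 0" for p q
  proof -
    obtain r where "entry F p r * entry G r q \<noteq> 0"
      using nz by (meson sum.not_neutral_contains_not_neutral)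
    then have "entry F p r \<noteq> 0" "entry G r q \<noteq> 0" by auto
    then show ?thesis using w[of p r] w'[of r q] by linarith
  qed
  then show ?thesis unfolding times_band_def by (subst entry_Band[where w = "w + w'"]) auto
qed

lemma entry_times:
  assumes "finite S" "\<And>r. entry F p r \<noteq> 0 \<Longrightarrow> entry G r q \<noteq> 0 \<Longrightarrow> r \<in> S"
  shows "entry (F * G) p q = (\<Sum>r\<in>S. entry F p r * (entry G r q :: 'a))"
proof -
  have "entry F p r * entry G r q = 0" if "r \<in> {r. entry F p r \<noteq> 0} - {r. entry F p r \<noteq> 0} \<inter> S" for r
    using assms(2)[of r] that by (cases "entry G r q = 0") auto
  then have "entry (F * G) p q = (\<Sum>r\<in>{r. entry F p r \<noteq> 0} \<inter> S. entry F p r * entry G r q)"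
    unfolding entry_times_row
    by (intro sum.mono_neutral_right) (use finite_row in blast)+
  also have "\<dots> = (\<Sum>r\<in>S. entry F p r * entry G r q)"
    by (rule sum.mono_neutral_left) (use assms in auto)
  finally show ?thesis .
qed

instance
proof
  fix F G H :: "'a band"
  show "F * G * H = F * (G * H)"
  proof (rule band_eqI)
    fix p q
    obtain w where w: "\<And>p q. entry F p q \<noteq> 0 \<Longrightarrow> \<bar>p - q\<bar> \<le> w" using band_width[of F] by blast
    obtain w' where w': "\<And>p q. entry H p q \<noteq> 0 \<Longrightarrow> \<bar>p - q\<bar> \<le> w'" using band_width[of H] by blast
    define S where "S = {p - w..p + w}"
    define T where "T = {q - w'..q + w'}"
    have S: "finite S" "\<And>r. entry F p r \<noteq> 0 \<Longrightarrow> r \<in> S" using w unfolding S_def by fastforce+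
    have T: "finite T" "\<And>r. entry H r q \<noteq> 0 \<Longrightarrow> r \<in> T" using w' unfolding T_def by fastforce+
    have "entry (F * G * H) p q = (\<Sum>t\<in>T. entry (F * G) p t * entry H t q)"
      by (rule entry_times) (use T in auto)
    also have "\<dots> = (\<Sum>t\<in>T. (\<Sum>s\<in>S. entry F p s * entry G s t) * entry H t q)"
      by (intro sum.cong refl arg_cong2[where f = "(*)"] entry_times) (use S in auto)
    also have "\<dots> = (\<Sum>s\<in>S. entry F p s * (\<Sum>t\<in>T. entry G s t * entry H t q))"
      unfolding sum_distrib_left sum_distrib_right by (subst sum.swap) (simp add: mult.assoc)
    also have "\<dots> = (\<Sum>s\<in>S. entry F p s * entry (G * H) s q)"
      by (intro sum.cong refl arg_cong2[where f = "(*)"] entry_times[symmetric]) (use T in auto)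
    also have "\<dots> = entry (F * (G * H)) p q"
      by (rule entry_times[symmetric]) (use S in auto)
    finally show "entry (F * G * H) p q = entry (F * (G * H)) p q" .
  qed
  have fin: "finite ({r. entry F p r \<noteq> 0} \<union> {r. entry G p r \<noteq> 0})" for p
    by (simp add: finite_row)
  show "(F + G) * H = F * H + G * H"
  proof (rule band_eqI)
    fix p q
    show "entry ((F + G) * H) p q = entry (F * H + G * H) p q"
      unfolding entry_add
      by (subst (1 2 3) entry_times[OF fin[of p]]) (auto simp: sum.distrib distrib_right)
  qed
  show "H * (F + G) = H * F + H * G"
    by (rule band_eqI) (simp add: entry_times_row sum.distrib distrib_left)
  show "1 * F = F"
    by (rule band_eqI, subst entry_times_row) (simp add: entry_1 sum.delta)
  show "F * 1 = F"
  proof (rule band_eqI)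
    fix p q
    show "entry (F * 1) p q = entry F p q"
      by (subst entry_times[of "{q}"]) (auto simp: entry_1 split: if_splits)
  qed
  show "(0::'a band) \<noteq> 1"
  proof
    assume "(0::'a band) = 1"
    then have "entry 0 0 0 = entry (1::'a band) 0 0" by simp
    then show False by (simp add: entry_1)
  qed
qed (auto intro!: band_eqI simp: algebra_simps)

end

lemma entry_sum [simp]: "entry (\<Sum>x\<in>S. f x) p q = (\<Sum>x\<in>S. entry (f x) p q)"
  by (induction S rule: infinite_finite_induct) auto

lemma entry_times_nonzero:
  assumes "entry (F * G) p q \<noteq> 0"
  obtains r where "entry F p r \<noteq> 0" "entry G r q \<noteq> 0"
proof -
  obtain r where "entry F p r * entry G r q \<noteq> 0"
    using assms unfolding entry_times_row by (meson sum.not_neutral_contains_not_neutral)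
  then show ?thesis by (intro that[of r]) auto
qed

text \<open>Weighted shifts: \<open>t^q \<mapsto> f q t^(q + d)\<close>.  Differential operators, projections to windows and
  matrix units are all of this form, and products of weighted shifts are explicit.\<close>

definition wshift :: "int \<Rightarrow> (int \<Rightarrow> 'a::ring_1) \<Rightarrow> 'a band" where
  "wshift d f = Band (\<lambda>p q. if p = q + d then f q else 0)"

lemma entry_wshift: "entry (wshift d f) p q = (if p = q + d then f q else 0)"
  unfolding wshift_def by (subst entry_Band[where w = "\<bar>d\<bar>"]) (auto split: if_splits)

lemma wshift_add: "wshift d f + wshift d g = wshift d (\<lambda>q. f q + g q)"
  by (rule band_eqI) (simp add: entry_wshift)

lemma wshift_sum: "(\<Sum>x\<in>S. wshift d (f x)) = wshift d (\<lambda>q. \<Sum>x\<in>S. f x q)"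
  by (rule band_eqI) (simp add: entry_wshift)

lemma wshift_zero [simp]: "wshift d (\<lambda>q. 0) = 0"
  by (rule band_eqI) (simp add: entry_wshift)

lemma wshift_times: "wshift d f * wshift d' g = wshift (d + d') (\<lambda>q. f (q + d') * g q)"
proof (rule band_eqI)
  fix p q
  show "entry (wshift d f * wshift d' g) p q = entry (wshift (d + d') (\<lambda>q. f (q + d') * g q)) p q"
    by (subst entry_times[of "{q + d'}"]) (auto simp: entry_wshift split: if_splits)
qed

lemma entry_times_wshift: "entry (F * wshift d f) p q = entry F p (q + d) * f q"
  by (subst entry_times[of "{q + d}"]) (auto simp: entry_wshift split: if_splits)

lemma entry_wshift_times: "entry (wshift d f * F) p q = f (p - d) * entry F (p - d) q"
  by (subst entry_times[of "{p - d}"]) (auto simp: entry_wshift split: if_splits)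

definition finite_band :: "'a::ring_1 band \<Rightarrow> bool" where
  "finite_band F \<longleftrightarrow> finite {(p, q). entry F p q \<noteq> 0}"

lemma finite_band_0: "finite_band 0"
  by (simp add: finite_band_def)

lemma finite_band_add: "finite_band F \<Longrightarrow> finite_band G \<Longrightarrow> finite_band (F + G)"
  unfolding finite_band_def
  by (rule finite_subset[of _ "{(p, q). entry F p q \<noteq> 0} \<union> {(p, q). entry G p q \<noteq> 0}"]) auto

lemma finite_band_diff: "finite_band F \<Longrightarrow> finite_band G \<Longrightarrow> finite_band (F - G)"
  unfolding finite_band_def
  by (rule finite_subset[of _ "{(p, q). entry F p q \<noteq> 0} \<union> {(p, q). entry G p q \<noteq> 0}"]) auto

lemma finite_bandI:
  assumes "\<And>p q. entry F p q \<noteq> 0 \<Longrightarrow> p \<in> S" "finite S"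
  shows "finite_band F"
proof -
  obtain w where w: "\<And>p q. entry F p q \<noteq> 0 \<Longrightarrow> \<bar>p - q\<bar> \<le> w" using band_width[of F] by blast
  have "{(p, q). entry F p q \<noteq> 0} \<subseteq> (\<Union>p\<in>S. {p} \<times> {p - w..p + w})"
    using w assms(1) by fastforce
  then show ?thesis unfolding finite_band_def by (rule finite_subset) (use assms(2) in auto)
qed

lemma finite_bandE:
  assumes "finite_band F"
  obtains R where "\<And>p q. entry F p q \<noteq> 0 \<Longrightarrow> \<bar>p\<bar> \<le> R \<and> \<bar>q\<bar> \<le> R"
proof -
  let ?S = "{(p, q). entry F p q \<noteq> 0}"
  have fin: "finite ((\<lambda>(p, q). max \<bar>p\<bar> \<bar>q\<bar>) ` ?S)" using assms unfolding finite_band_def by simp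
  define R where "R = Max (insert 0 ((\<lambda>(p, q). max \<bar>p\<bar> \<bar>q\<bar>) ` ?S))"
  have "max \<bar>p\<bar> \<bar>q\<bar> \<le> R" if "entry F p q \<noteq> 0" for p q
    unfolding R_def using fin that by (intro Max_ge) force+
  then show ?thesis by (intro that[of R]) fastforce
qed

lemma finite_band_times_right:
  assumes "finite_band F" shows "finite_band (F * G)"
proof -
  obtain R where R: "\<And>p q. entry F p q \<noteq> 0 \<Longrightarrow> \<bar>p\<bar> \<le> R \<and> \<bar>q\<bar> \<le> R"
    using finite_bandE[OF assms] by blast
  show ?thesis
    by (rule finite_bandI[where S = "{-R..R}"]) (use R in \<open>fastforce elim!: entry_times_nonzero\<close>)+
qed

lemma finite_band_times_left:
  assumes "finite_band G" shows "finite_band (F * G)"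
proof -
  obtain R where R: "\<And>p q. entry G p q \<noteq> 0 \<Longrightarrow> \<bar>p\<bar> \<le> R \<and> \<bar>q\<bar> \<le> R"
    using finite_bandE[OF assms] by blast
  obtain w where w: "\<And>p q. entry F p q \<noteq> 0 \<Longrightarrow> \<bar>p - q\<bar> \<le> w" using band_width[of F] by blast
  show ?thesis
  proof (rule finite_bandI[where S = "{- R - w..R + w}"])
    fix p q assume "entry (F * G) p q \<noteq> 0"
    then obtain r where "entry F p r \<noteq> 0" "entry G r q \<noteq> 0" by (rule entry_times_nonzero)
    with w[of p r] R[of r q] show "p \<in> {- R - w..R + w}" by auto
  qed simp
qed

definition munit :: "'a::ring_1 \<Rightarrow> int \<Rightarrow> int \<Rightarrow> 'a band" where
  "munit a p q = wshift (p - q) (\<lambda>r. if r = q then a else 0)"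

lemma entry_munit: "entry (munit a p q) p' q' = (if p' = p \<and> q' = q then a else 0)"
  by (auto simp: munit_def entry_wshift)

lemma finite_band_munit: "finite_band (munit a p q)"
  by (rule finite_bandI[where S = "{p}"]) (auto simp: entry_munit split: if_splits)

lemma band_sum_munit:
  assumes "finite S" "\<And>p q. entry F p q \<noteq> 0 \<Longrightarrow> (p, q) \<in> S"
  shows "F = (\<Sum>(p, q)\<in>S. munit (entry F p q) p q)"
proof (rule band_eqI)
  fix p q
  have "(\<Sum>x\<in>S. entry (case x of (p, q) \<Rightarrow> munit (entry F p q) p q) p q)
      = (\<Sum>x\<in>S. if x = (p, q) then entry F p q else 0)"
    by (rule sum.cong) (auto simp: entry_munit split: if_splits)
  then show "entry F p q = entry (\<Sum>(p, q)\<in>S. munit (entry F p q) p q) p q"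
    using assms by auto
qed



text \<open>The behaviour of falling factorials under the reflection of exponents \<open>u \<mapsto> -1 - u\<close>, which comes
  with the adjoint.\<close>

lemma falling_reflect: "falling (of_nat m - 1 - x) m = (-1) ^ m * falling x m"
proof -
  have "falling (of_nat m - 1 - x) m = (\<Prod>i<m. of_nat m - 1 - x - of_nat (m - Suc i))"
    unfolding falling_def by (rule prod.nat_diff_reindex[symmetric])
  also have "\<dots> = (\<Prod>i<m. (-1) * (x - of_nat i))"
    by (rule prod.cong) (auto simp: of_nat_diff)
  also have "\<dots> = (-1) ^ m * falling x m"
    unfolding falling_def prod.distrib by simp
  finally show ?thesis .
qed

text \<open>The brackets sum over the supports of their arguments, which are not additive in the arguments.
  For an additive summand the support may be replaced by any larger finite set.\<close>

lemma sum_keys_superset: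
  assumes "\<And>p. g 0 p = 0" "finite S" "Poly_Mapping.keys X \<subseteq> S"
  shows "(\<Sum>p\<in>Poly_Mapping.keys X. g (Poly_Mapping.lookup X p) p)
       = (\<Sum>p\<in>S. g (Poly_Mapping.lookup X p) p :: 'c::comm_monoid_add)"
  by (rule sum.mono_neutral_left) (use assms in \<open>auto simp: in_keys_iff\<close>)

lemma sum_keys_add:
  fixes g :: "'a::ab_group_add \<Rightarrow> 'k \<Rightarrow> 'c::comm_monoid_add"
  assumes "\<And>p. g 0 p = 0" "\<And>a b p. g (a + b) p = g a p + g b p"
  shows "(\<Sum>p\<in>Poly_Mapping.keys (X + Y). g (Poly_Mapping.lookup (X + Y) p) p)
       = (\<Sum>p\<in>Poly_Mapping.keys X. g (Poly_Mapping.lookup X p) p)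
         + (\<Sum>p\<in>Poly_Mapping.keys Y. g (Poly_Mapping.lookup Y p) p)"
proof -
  let ?S = "Poly_Mapping.keys X \<union> Poly_Mapping.keys Y"
  have "Poly_Mapping.keys (X + Y) \<subseteq> ?S" by (rule Poly_Mapping.keys_add)
  then show ?thesis
    by (subst (1 2 3) sum_keys_superset[where S = ?S])
       (auto simp: assms lookup_add sum.distrib)
qed

section \<open>Peirce decomposition of the coefficient algebra\<close>

text \<open>\<open>\<nu> = 2 \<iota>\<close> is an integer; the reflection of exponents \<open>u \<mapsto> -1 - u\<close> reads \<open>q \<mapsto> -1 - \<nu> - q\<close> on the
  index \<open>q\<close> of \<open>t^(q + \<iota>)\<close>.\<close>

locale twisted_bands = twisted_trace_algebra sA tr n L B \<tau> \<pi> \<epsilon> \<l>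
  for sA :: "complex \<Rightarrow> 'a::ring_1 \<Rightarrow> 'a" and tr n L B \<tau> \<pi> \<epsilon> \<l> +
  fixes \<iota> :: rat and \<nu> :: int
  assumes iota: "2 * \<iota> = of_int \<nu>"
begin

sublocale trl: Vector_Spaces.linear sA "(*)" tr by (rule tr_linear)
sublocale taul: Vector_Spaces.linear sA sA \<tau> by (rule tau_linear)
sublocale ext: vector_space "ext_scale sA :: complex \<Rightarrow> ('k \<Rightarrow>\<^sub>0 'a) \<times> complex \<Rightarrow> ('k \<Rightarrow>\<^sub>0 'a) \<times> complex"
  by (rule vector_space_ext_scale) (rule vector_space_axioms)

lemma scale_sign: "sA ((-1) ^ m) a = (-1) ^ m * a"
  by (cases "even m") auto

lemma scale_mult: "sA c a * sA d b = sA (c * d) (a * b)"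
  by (simp add: scale_mult_left scale_mult_right)

text \<open>The components of 1 in the left ideals.\<close>

definition e :: "nat \<Rightarrow> 'a" where
  "e = (SOME f. (\<forall>j\<in>{1..n}. f j \<in> L j) \<and> (\<Sum>j\<in>{1..n}. f j) = 1)"

lemma e_props: "(\<forall>j\<in>{1..n}. e j \<in> L j) \<and> (\<Sum>j\<in>{1..n}. e j) = 1"
proof -
  have "(1::'a) \<in> {(\<Sum>i\<in>{1..n}. f i) | f. \<forall>i\<in>{1..n}. f i \<in> L i}"
    using decomp_ideals unfolding direct_sum_decomp_def by auto
  then have "\<exists>f. (\<forall>j\<in>{1..n}. f j \<in> L j) \<and> (\<Sum>j\<in>{1..n}. f j) = (1::'a)" by auto
  then show ?thesis unfolding e_def by (rule someI_ex)
qed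

lemma e_L: "j \<in> {1..n} \<Longrightarrow> e j \<in> L j" and e_sum: "(\<Sum>j\<in>{1..n}. e j) = 1"
  using e_props by auto

lemma L_subspace: "j \<in> {1..n} \<Longrightarrow> subspace (L j)"
  using decomp_ideals unfolding direct_sum_decomp_def by auto

lemma B_subspace: "i \<in> {1..n} \<Longrightarrow> j \<in> {1..n} \<Longrightarrow> subspace (B i j)"
  using decomp_pieces unfolding direct_sum_decomp_def by auto

text \<open>Right multiplication by \<open>e k\<close> is the projection to the ideal \<open>L k\<close>: the decompositions
  \<open>a = \<Sum> a e k\<close> and \<open>a = a\<close> agree by directness.\<close>

lemma L_times_e:
  assumes j: "j \<in> {1..n}" and k: "k \<in> {1..n}" and a: "a \<in> L j"
  shows "a * e k = (if k = j then a else 0)"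
proof -
  define f where "f k = a * e k - (if k = j then a else 0)" for k
  have "f i \<in> L i" if i: "i \<in> {1..n}" for i
    unfolding f_def using left_ideal[OF i e_L[OF i], of a] L_subspace[OF i] a
    by (auto intro: subspace_diff)
  moreover have "(\<Sum>i\<in>{1..n}. f i) = 0"
    using j unfolding f_def sum_subtractf sum_distrib_left[symmetric] e_sum by simp
  ultimately have "\<forall>i\<in>{1..n}. f i = 0"
    using decomp_ideals unfolding direct_sum_decomp_def by blast
  with k show ?thesis by (auto simp: f_def split: if_splits)
qed

lemma L_eq: "j \<in> {1..n} \<Longrightarrow> L j = {(\<Sum>i\<in>{1..n}. f i) | f. \<forall>i\<in>{1..n}. f i \<in> B i j}"
  using decomp_pieces unfolding direct_sum_decomp_def by blast

lemma L_decomp: "j \<in> {1..n} \<Longrightarrow> a \<in> L j \<Longrightarrow> \<exists>f. (\<forall>i\<in>{1..n}. f i \<in> B i j) \<and> a = (\<Sum>i\<in>{1..n}. f i)"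
  using L_eq[of j] by blast

lemma B_L:
  assumes "i \<in> {1..n}" "j \<in> {1..n}" "a \<in> B i j"
  shows "a \<in> L j"
proof -
  have "a = (\<Sum>k\<in>{1..n}. if k = i then a else 0)" using assms by simp
  moreover have "\<forall>k\<in>{1..n}. (if k = i then a else 0) \<in> B k j"
    using assms B_subspace[THEN subspace_0] by simp
  ultimately show ?thesis
    unfolding L_eq[OF assms(2)] by blast
qed

text \<open>The components of \<open>e i\<close> lie in the pieces \<open>B s i\<close>, so they annihilate \<open>B l k\<close> for \<open>l \<noteq> i\<close>;
  what remains of \<open>b = \<Sum> e i b\<close> is the term \<open>i = l\<close>.\<close>

lemma e_times_B:
  assumes i: "i \<in> {1..n}" and l: "l \<in> {1..n}" and k: "k \<in> {1..n}" and b: "b \<in> B l k"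
  shows "e i * b = (if i = l then b else 0)"
proof -
  have zero: "e i * b = 0" if i': "i \<in> {1..n}" "i \<noteq> l" for i
  proof -
    obtain f where f: "\<forall>s\<in>{1..n}. f s \<in> B s i" "e i = (\<Sum>s\<in>{1..n}. f s)"
      using L_decomp[OF i'(1) e_L[OF i'(1)]] by blast
    have "e i * b = (\<Sum>s\<in>{1..n}. f s * b)" by (simp add: f(2) sum_distrib_right)
    also have "\<dots> = 0"
      by (intro sum.neutral ballI pieces_mult[of _ i l k]) (use i' l k b f(1) in auto)
    finally show ?thesis .
  qed
  have "b = (\<Sum>i\<in>{1..n}. e i) * b" unfolding e_sum by simp
  also have "\<dots> = (\<Sum>i\<in>{1..n}. if i = l then e l * b else 0)"
    unfolding sum_distrib_right using zero by (intro sum.cong) auto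
  also have "\<dots> = e l * b" using l by simp
  finally show ?thesis using zero i by auto
qed

lemma e_times_e: "i \<in> {1..n} \<Longrightarrow> j \<in> {1..n} \<Longrightarrow> e i * e j = (if i = j then e i else 0)"
  using L_times_e[of i j "e i"] e_L by auto

text \<open>With the two preceding results this identifies \<open>B i j\<close> with the Peirce component \<open>e i A e j\<close>, so
  every element is a sum of elements of the pieces in a bilinear way.\<close>

lemma peirce:
  assumes i: "i \<in> {1..n}" and j: "j \<in> {1..n}"
  shows "e i * a * e j \<in> B i j"
proof -
  have "a * e j \<in> L j" using left_ideal j e_L by blast
  then obtain f where f: "\<forall>s\<in>{1..n}. f s \<in> B s j" "a * e j = (\<Sum>s\<in>{1..n}. f s)"
    using L_decomp[OF j] by blast
  have "e i * (a * e j) = (\<Sum>s\<in>{1..n}. e i * f s)" by (simp add: f(2) sum_distrib_left)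
  also have "\<dots> = (\<Sum>s\<in>{1..n}. if s = i then f i else 0)"
    using f(1) i j by (intro sum.cong) (auto simp: e_times_B)
  also have "\<dots> = f i" using i by simp
  finally show ?thesis using f(1) i by (simp add: mult.assoc)
qed

lemma pi_in: "i \<in> {1..n} \<Longrightarrow> \<pi> i \<in> {1..n}"
  using perm by (auto simp: bij_betw_def)

text \<open>Applying \<open>\<tau>\<close> to \<open>1 = \<Sum> e l\<close> gives a second decomposition of 1 along the ideals, with the
  indices permuted by \<open>\<pi>\<close>.\<close>

lemma tau_e:
  assumes i: "i \<in> {1..n}" shows "\<tau> (e i) = e (\<pi> i)"
proof -
  have mem: "\<tau> (e l) \<in> L (\<pi> l)" if "l \<in> {1..n}" for l
  proof -
    have "e l \<in> B l l" using peirce[OF that that, of 1] that by (simp add: e_times_e)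
    then have "\<tau> (e l) \<in> B (\<pi> l) (\<pi> l)" using tau_pieces[OF that that] by auto
    then show ?thesis using B_L pi_in that by blast
  qed
  have inj: "\<pi> l = \<pi> i \<longleftrightarrow> l = i" if "l \<in> {1..n}" for l
    using perm that i by (meson bij_betw_def inj_on_eq_iff)
  have "e (\<pi> i) = \<tau> (\<Sum>l\<in>{1..n}. e l) * e (\<pi> i)" unfolding e_sum tau_one by simp
  also have "\<dots> = (\<Sum>l\<in>{1..n}. \<tau> (e l) * e (\<pi> i))"
    by (simp add: taul.sum sum_distrib_right)
  also have "\<dots> = (\<Sum>l\<in>{1..n}. if l = i then \<tau> (e i) else 0)"
  proof (intro sum.cong refl)
    fix l assume l: "l \<in> {1..n}"
    show "\<tau> (e l) * e (\<pi> i) = (if l = i then \<tau> (e i) else 0)"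
      using L_times_e[OF pi_in[OF l] pi_in[OF i] mem[OF l]] inj[OF l] by auto
  qed
  also have "\<dots> = \<tau> (e i)" using i by simp
  finally show ?thesis by simp
qed

lemma sign_l: "i \<in> {1..n} \<Longrightarrow> (-1) ^ \<l> i = ((-1) ^ \<epsilon> :: 'b::ring_1)"
proof -
  assume "i \<in> {1..n}"
  then obtain k where k: "int (\<l> i) = 2 * k + int \<epsilon>" using l_parity by blast
  have "even (\<l> i) \<longleftrightarrow> even \<epsilon>"
    using arg_cong[OF k, of even] by simp
  then show ?thesis by (cases "even \<epsilon>") auto
qed

section \<open>The adjoint and skew bands\<close>

text \<open>The adjoint for the pairing of \<open>t^u\<close> with \<open>t^(-1-u)\<close> (the residue of the product), combined
  with \<open>\<tau>\<close>.\<close>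

definition adj :: "'a band \<Rightarrow> 'a band" where
  "adj F = Band (\<lambda>p q. \<tau> (entry F (- 1 - \<nu> - q) (- 1 - \<nu> - p)))"

lemma entry_adj: "entry (adj F) p q = \<tau> (entry F (- 1 - \<nu> - q) (- 1 - \<nu> - p))"
proof -
  obtain w where w: "\<And>p q. entry F p q \<noteq> 0 \<Longrightarrow> \<bar>p - q\<bar> \<le> w" using band_width[of F] by blast
  have "\<bar>p - q\<bar> \<le> w" if "\<tau> (entry F (- 1 - \<nu> - q) (- 1 - \<nu> - p)) \<noteq> 0" for p q
  proof -
    have "entry F (- 1 - \<nu> - q) (- 1 - \<nu> - p) \<noteq> 0" using that taul.zero by auto
    from w[OF this] show ?thesis by simp
  qed
  then show ?thesis unfolding adj_def by (subst entry_Band[where w = w]) auto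
qed

lemma adj_add: "adj (F + G) = adj F + adj G"
  by (rule band_eqI) (simp add: entry_adj taul.add)

lemma adj_uminus: "adj (- F) = - adj F"
  by (rule band_eqI) (simp add: entry_adj taul.neg)

lemma adj_diff: "adj (F - G) = adj F - adj G"
  by (rule band_eqI) (simp add: entry_adj taul.diff)

lemma adj_adj: "adj (adj F) = F"
  by (rule band_eqI) (simp add: entry_adj tau_tau)

lemma adj_sum: "adj (\<Sum>x\<in>S. f x) = (\<Sum>x\<in>S. adj (f x))"
  by (rule band_eqI) (simp add: entry_adj taul.sum)

lemma adj_sign: "adj ((-1) ^ m * F) = (-1) ^ m * adj F"
  by (cases "even m") (auto simp: adj_uminus)

lemma adj_times: "adj (F * G) = adj G * adj F"
proof (rule band_eqI)
  fix p q
  let ?c = "\<lambda>r. - 1 - \<nu> - r"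
  let ?S = "{r. entry F (?c q) r \<noteq> 0}"
  have "entry (adj F) s q = 0" if "s \<notin> ?c ` ?S" for s
  proof (rule ccontr)
    assume "entry (adj F) s q \<noteq> 0"
    then have "?c s \<in> ?S" using taul.zero by (auto simp: entry_adj)
    then have "?c (?c s) \<in> ?c ` ?S" by (rule imageI)
    with that show False by simp
  qed
  then have "entry (adj G * adj F) p q = (\<Sum>s\<in>?c ` ?S. entry (adj G) p s * entry (adj F) s q)"
    by (intro entry_times) (auto simp: finite_row)
  also have "\<dots> = (\<Sum>r\<in>?S. \<tau> (entry G r (?c p)) * \<tau> (entry F (?c q) r))"
    by (subst sum.reindex) (auto simp: inj_on_def entry_adj)
  also have "\<dots> = entry (adj (F * G)) p q"
    by (simp add: entry_adj entry_times_row taul.sum tau_mult)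
  finally show "entry (adj (F * G)) p q = entry (adj G * adj F) p q" by simp
qed

lemma adj_wshift: "adj (wshift d f) = wshift d (\<lambda>q. \<tau> (f (- 1 - \<nu> - q - d)))"
  by (rule band_eqI) (auto simp: entry_adj entry_wshift taul.zero algebra_simps)

lemma finite_band_adj:
  assumes "finite_band F" shows "finite_band (adj F)"
proof -
  obtain R where R: "\<And>p q. entry F p q \<noteq> 0 \<Longrightarrow> \<bar>p\<bar> \<le> R \<and> \<bar>q\<bar> \<le> R"
    using finite_bandE[OF assms] by blast
  show ?thesis
  proof (rule finite_bandI[where S = "{- 1 - \<nu> - R..- 1 - \<nu> + R}"])
    fix p q assume "entry (adj F) p q \<noteq> 0"
    then have "entry F (- 1 - \<nu> - q) (- 1 - \<nu> - p) \<noteq> 0" using taul.zero by (auto simp: entry_adj)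
    from R[OF this] show "p \<in> {- 1 - \<nu> - R..- 1 - \<nu> + R}" by auto
  qed simp
qed

abbreviation expo :: "int \<Rightarrow> complex" where
  "expo q \<equiv> of_int q + of_rat \<iota>"

lemma of_rat_nu: "2 * of_rat \<iota> = (of_int \<nu> :: complex)"
proof -
  have "of_rat (2 * \<iota>) = (of_rat (of_int \<nu>) :: complex)" by (simp only: iota)
  then show ?thesis by (simp add: of_rat_mult)
qed

text \<open>The matrix of \<open>\<Sum> e j \<partial>^(\<l> j)\<close>.\<close>

definition Lam :: "'a band" where
  "Lam = (\<Sum>j\<in>{1..n}. wshift (- int (\<l> j)) (\<lambda>q. sA (falling (expo q) (\<l> j)) (e j)))"

text \<open>The adjoint of \<open>\<partial>\<close> is \<open>-\<partial>\<close>, the exponents \<open>\<l> j\<close> all have the parity of \<open>\<epsilon>\<close>, and \<open>\<tau>\<close> permutes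
  the idempotents by \<open>\<pi>\<close>, under which \<open>\<l>\<close> is invariant.\<close>

lemma adj_Lam: "adj Lam = (-1) ^ \<epsilon> * Lam"
proof -
  let ?f = "\<lambda>j. wshift (- int (\<l> j)) (\<lambda>q. sA (falling (expo q) (\<l> j)) (e j))"
  have "adj (?f j) = (-1) ^ \<epsilon> * ?f (\<pi> j)" if j: "j \<in> {1..n}" for j
  proof (rule band_eqI)
    fix p q
    have "falling (expo (- 1 - \<nu> - q - - int (\<l> j))) (\<l> j)
        = falling (of_nat (\<l> j) - 1 - expo q) (\<l> j)"
      by (rule arg_cong[where f = "\<lambda>x. falling x (\<l> j)"]) (simp add: algebra_simps flip: of_rat_nu)
    also have "\<dots> = (-1) ^ \<epsilon> * falling (expo q) (\<l> j)"
      by (simp add: falling_reflect sign_l[OF j])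
    finally have *: "falling (expo (- 1 - \<nu> - q - - int (\<l> j))) (\<l> j) = (-1) ^ \<epsilon> * falling (expo q) (\<l> j)" .
    have sgn: "entry ((-1) ^ \<epsilon> * F) p q = (-1) ^ \<epsilon> * entry F p q" for F :: "'a band" and p q
      by (cases "even \<epsilon>") auto
    show "entry (adj (?f j)) p q = entry ((-1) ^ \<epsilon> * ?f (\<pi> j)) p q"
      unfolding adj_wshift sgn entry_wshift
      unfolding taul.scale * l_perm[OF j] tau_e[OF j]
      by (simp only: scale_sign[symmetric] scale_scale if_distrib[of "sA _"] scale_zero_right)
  qed
  then have "adj Lam = (-1) ^ \<epsilon> * (\<Sum>j\<in>{1..n}. ?f (\<pi> j))"
    unfolding Lam_def adj_sum sum_distrib_left by (intro sum.cong) auto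
  also have "(\<Sum>j\<in>{1..n}. ?f (\<pi> j)) = Lam"
    unfolding Lam_def by (rule sum.reindex_bij_betw[OF perm])
  finally show ?thesis .
qed

definition skew :: "'a band \<Rightarrow> bool" where
  "skew X \<longleftrightarrow> adj X = - ((-1) ^ \<epsilon> * X)"

lemma adj_skew_product:
  assumes "skew X" "skew Y"
  shows "adj (X * Lam * Y) = (-1) ^ \<epsilon> * (Y * Lam * X)"
proof -
  have "adj (X * Lam * Y) = adj Y * (adj Lam * adj X)"
    by (simp only: adj_times mult.assoc)
  also have "\<dots> = (-1) ^ \<epsilon> * (Y * Lam * X)"
    unfolding adj_Lam assms[unfolded skew_def] by (cases "even \<epsilon>") (simp_all add: mult.assoc)
  finally show ?thesis .
qed

text \<open>This is why the twisted spans are closed under commutators: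
  \<open>[X \<Lambda>, Y \<Lambda>] = (X \<Lambda> Y - Y \<Lambda> X) \<Lambda>\<close>.\<close>

lemma skew_bracket:
  assumes "skew X" "skew Y"
  shows "skew (X * Lam * Y - Y * Lam * X)"
  unfolding skew_def adj_diff adj_skew_product[OF assms] adj_skew_product[OF assms(2,1)]
  by (simp only: right_diff_distrib minus_diff_eq)

lemma skew_add: "skew X \<Longrightarrow> skew Y \<Longrightarrow> skew (X + Y)"
  unfolding skew_def adj_add by (simp only: distrib_left minus_add_distrib)

lemma skew_diff: "skew X \<Longrightarrow> skew Y \<Longrightarrow> skew (X - Y)"
  unfolding skew_def adj_diff by (simp only: right_diff_distrib minus_diff_minus)

lemma skew_0: "skew 0"
proof -
  have "adj 0 = 0" using adj_diff[of 0 0] by simp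
  then show ?thesis by (simp add: skew_def)
qed

lemma sign_sign: "(-1) ^ m * ((-1) ^ m * (x::'b::ring_1)) = x"
  by (cases "even m") simp_all

lemma skew_skewing: "skew (Y - (-1) ^ \<epsilon> * adj Y)"
  unfolding skew_def adj_diff adj_sign adj_adj right_diff_distrib sign_sign minus_diff_eq ..

lemma skewing_skew:
  assumes "skew X" shows "X - (-1) ^ \<epsilon> * adj X = X + X"
  unfolding assms[unfolded skew_def] mult_minus_right sign_sign by simp

end



section \<open>The cocycle, and the matrix Lie algebra as finite bands\<close>

text \<open>The sign with which a pair of entries contributes to the cocycle: it is nonzero only if the row
  and the column lie on different sides of 0.\<close>

definition jump :: "int \<Rightarrow> int \<Rightarrow> complex" where
  "jump p q = (if 0 \<le> p \<and> q < 0 then 1 else if p < 0 \<and> 0 \<le> q then - 1 else 0)"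

lemma finite_jump: "finite {(p, q). jump p q \<noteq> 0 \<and> entry F p q \<noteq> 0}"
proof -
  obtain w where w: "\<And>p q. entry F p q \<noteq> 0 \<Longrightarrow> \<bar>p - q\<bar> \<le> w" using band_width[of F] by blast
  have "{(p, q). jump p q \<noteq> 0 \<and> entry F p q \<noteq> 0} \<subseteq> {- w - 1..w + 1} \<times> {- w - 1..w + 1}"
    using w by (fastforce simp: jump_def split: if_splits)
  then show ?thesis by (rule finite_subset) simp
qed

lemma mat_unit_add: "mat_unit (a + b) x y = mat_unit a x y + mat_unit b x y"
  by (simp add: mat_unit_def single_add)

lemma mat_unit_0 [simp]: "mat_unit 0 x y = 0"
  by (simp add: mat_unit_def zero_prod_def)

definition eunit :: "'a::ring_1 \<Rightarrow> int \<Rightarrow> int \<Rightarrow> 'a checkA" where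
  "eunit a p q = mat_unit a (of_int p + 1/2) (- of_int q - 1/2)"

lemma eunit_0 [simp]: "eunit 0 p q = 0"
  by (simp add: eunit_def)

lemma eunit_add: "eunit (a + b) p q = eunit a p q + eunit b p q"
  by (simp add: eunit_def mat_unit_add)

lemma eunit_sum: "eunit (\<Sum>x\<in>S. f x) p q = (\<Sum>x\<in>S. eunit (f x) p q)"
  by (induction S rule: infinite_finite_induct) (simp_all add: eunit_add)

text \<open>A finite band as an element of the matrix Lie algebra, without central component.\<close>

definition emb :: "'a::ring_1 band \<Rightarrow> 'a checkA" where
  "emb F = (\<Sum>(p, q) | entry F p q \<noteq> 0. eunit (entry F p q) p q)"

lemma emb_eq:
  assumes "finite S" "\<And>p q. entry F p q \<noteq> 0 \<Longrightarrow> (p, q) \<in> S"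
  shows "emb F = (\<Sum>(p, q)\<in>S. eunit (entry F p q) p q)"
  unfolding emb_def by (rule sum.mono_neutral_left) (use assms in auto)

lemma emb_eq_box:
  assumes "finite S" "finite T" "\<And>p q. entry F p q \<noteq> 0 \<Longrightarrow> p \<in> S \<and> q \<in> T"
  shows "emb F = (\<Sum>p\<in>S. \<Sum>q\<in>T. eunit (entry F p q) p q)"
  unfolding sum.cartesian_product by (rule emb_eq) (use assms in auto)

lemma emb_add:
  assumes "finite_band F" "finite_band G"
  shows "emb (F + G) = emb F + emb G"
proof -
  let ?S = "{(p, q). entry F p q \<noteq> 0} \<union> {(p, q). entry G p q \<noteq> 0}"
  have S: "finite ?S" using assms by (simp add: finite_band_def)
  have "emb (F + G) = (\<Sum>(p, q)\<in>?S. eunit (entry (F + G) p q) p q)"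
    by (rule emb_eq[OF S]) auto
  also have "\<dots> = (\<Sum>(p, q)\<in>?S. eunit (entry F p q) p q) + (\<Sum>(p, q)\<in>?S. eunit (entry G p q) p q)"
    by (simp add: eunit_add sum.distrib case_prod_unfold)
  also have "\<dots> = emb F + emb G"
    by (intro arg_cong2[where f = "(+)"] emb_eq[OF S, symmetric]) auto
  finally show ?thesis .
qed

lemma emb_0 [simp]: "emb 0 = 0"
  by (simp add: emb_def)

lemma emb_diff:
  assumes "finite_band F" "finite_band G"
  shows "emb (F - G) = emb F - emb G"
  using emb_add[OF finite_band_diff[OF assms] assms(2)] by simp

lemma finite_band_sum: "(\<And>x. x \<in> S \<Longrightarrow> finite_band (f x)) \<Longrightarrow> finite_band (\<Sum>x\<in>S. f x)"
  by (induction S rule: infinite_finite_induct) (auto simp: finite_band_0 intro: finite_band_add)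

lemma emb_sum: "(\<And>x. x \<in> S \<Longrightarrow> finite_band (f x)) \<Longrightarrow> emb (\<Sum>x\<in>S. f x) = (\<Sum>x\<in>S. emb (f x))"
  by (induction S rule: infinite_finite_induct) (auto simp: finite_band_sum emb_add)

lemma emb_munit [simp]: "emb (munit a p q) = eunit a p q"
  by (subst emb_eq[of "{(p, q)}"]) (auto simp: entry_munit split: if_splits)

context twisted_bands
begin

text \<open>The cocycle of the matrix Lie algebra.  Only finitely many entries of a band connect the two
  sides of 0, so it is defined for all bands, not only for finite ones.\<close>

definition psi :: "'a band \<Rightarrow> 'a band \<Rightarrow> complex" where
  "psi F G = (\<Sum>(p, q) | jump p q \<noteq> 0 \<and> entry F p q \<noteq> 0. jump p q * tr (entry F p q * entry G q p))"

lemma psi_eq: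
  assumes "finite S"
    and "\<And>p q. jump p q \<noteq> 0 \<Longrightarrow> entry F p q \<noteq> 0 \<Longrightarrow> entry G q p \<noteq> 0 \<Longrightarrow> (p, q) \<in> S"
  shows "psi F G = (\<Sum>(p, q)\<in>S. jump p q * tr (entry F p q * entry G q p))"
proof -
  let ?T = "{(p, q). jump p q \<noteq> 0 \<and> entry F p q \<noteq> 0}"
  let ?f = "\<lambda>(p, q). jump p q * tr (entry F p q * entry G q p)"
  have "?f x = 0" if "x \<in> ?T - ?T \<inter> S" for x
    using assms(2)[of "fst x" "snd x"] that
    by (cases "entry G (snd x) (fst x) = 0") (auto simp: trl.zero)
  then have "psi F G = sum ?f (?T \<inter> S)"
    unfolding psi_def by (intro sum.mono_neutral_right) (use finite_jump in blast)+
  also have "\<dots> = sum ?f S"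
    by (rule sum.mono_neutral_left) (use assms(1) in \<open>auto simp: trl.zero\<close>)
  finally show ?thesis .
qed

lemma psi_add_left: "psi (F + F') G = psi F G + psi F' G"
proof -
  let ?S = "{(p, q). jump p q \<noteq> 0 \<and> entry F p q \<noteq> 0} \<union> {(p, q). jump p q \<noteq> 0 \<and> entry F' p q \<noteq> 0}"
  have S: "finite ?S" by (simp add: finite_jump)
  show ?thesis
    by (subst (1 2 3) psi_eq[OF S])
       (auto simp: distrib_right trl.add distrib_left sum.distrib case_prod_unfold)
qed

lemma psi_add_right: "psi F (G + G') = psi F G + psi F G'"
  by (simp add: psi_def distrib_left trl.add sum.distrib case_prod_unfold)

lemma psi_0_left [simp]: "psi 0 G = 0" and psi_0_right [simp]: "psi F 0 = 0"
  by (simp_all add: psi_def trl.zero case_prod_unfold)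

lemma psi_sum_left: "psi (\<Sum>x\<in>S. f x) G = (\<Sum>x\<in>S. psi (f x) G)"
  by (induction S rule: infinite_finite_induct) (simp_all add: psi_add_left)

lemma psi_sum_right: "psi F (\<Sum>x\<in>S. f x) = (\<Sum>x\<in>S. psi F (f x))"
  by (induction S rule: infinite_finite_induct) (simp_all add: psi_add_right)

lemma check_bracket_add_left:
  "check_bracket tr (X + X') Y = check_bracket tr X Y + check_bracket tr X' Y"
proof -
  have add: "check_bracket_mon tr (a + a') p b q = check_bracket_mon tr a p b q + check_bracket_mon tr a' p b q"
    for a a' b p q
    by (cases p; cases q)
       (auto simp: check_bracket_mon_def mat_unit_add distrib_left distrib_right trl.add zero_prod_def)
  have zero: "check_bracket_mon tr 0 p b q = 0" for p b q
    using add[of 0 0 p b q] by simp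
  show ?thesis
    unfolding check_bracket_def fst_add
    by (rule sum_keys_add) (simp_all add: zero add sum.distrib)
qed

lemma check_bracket_add_right:
  "check_bracket tr Y (X + X') = check_bracket tr Y X + check_bracket tr Y X'"
proof -
  have add: "check_bracket_mon tr b q (a + a') p = check_bracket_mon tr b q a p + check_bracket_mon tr b q a' p"
    for a a' b p q
    by (cases p; cases q)
       (auto simp: check_bracket_mon_def mat_unit_add distrib_left distrib_right trl.add zero_prod_def)
  have zero: "check_bracket_mon tr b q 0 p = 0" for p b q
    using add[of b q 0 0 p] by simp
  show ?thesis
    unfolding check_bracket_def fst_add
    by (subst sum.swap, subst (2 3) sum.swap, rule sum_keys_add) (simp_all add: zero add sum.distrib)
qed

lemma check_bracket_0_left [simp]: "check_bracket tr 0 Y = 0"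
  and check_bracket_0_right [simp]: "check_bracket tr Y 0 = 0"
  using check_bracket_add_left[of 0 0 Y] check_bracket_add_right[of Y 0 0] by simp_all

lemma check_bracket_sum_left: "check_bracket tr (\<Sum>x\<in>S. f x) Y = (\<Sum>x\<in>S. check_bracket tr (f x) Y)"
  by (induction S rule: infinite_finite_induct) (simp_all add: check_bracket_add_left)

lemma check_bracket_sum_right: "check_bracket tr Y (\<Sum>x\<in>S. f x) = (\<Sum>x\<in>S. check_bracket tr Y (f x))"
  by (induction S rule: infinite_finite_induct) (simp_all add: check_bracket_add_right)

lemma check_bracket_eunit:
  "check_bracket tr (eunit a p q) (eunit b p' q') =
     (if p' = q then eunit (a * b) p q' else 0) - (if q' = p then eunit (b * a) p' q else 0)
     + (0, if q' = p then if p' = q then jump p q * tr (a * b) else 0 else 0)"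
proof -
  have 1: "- rat_of_int q - 1/2 + (of_int p' + 1/2) = 0 \<longleftrightarrow> p' = q" by auto
  have 2: "rat_of_int p + 1/2 + (- of_int q' - 1/2) = 0 \<longleftrightarrow> q' = p" by auto
  have pos: "0 < rat_of_int x + 1/2 \<longleftrightarrow> 0 \<le> x" for x
  proof -
    have "0 < rat_of_int x + 1/2 \<longleftrightarrow> 0 < rat_of_int (2 * x + 1)" by (simp add: field_simps)
    also have "\<dots> \<longleftrightarrow> 0 \<le> x" unfolding of_int_0_less_iff by presburger
    finally show ?thesis .
  qed
  have h1: "heaviside (of_int x + 1/2) = (if 0 \<le> x then 1 else 0)" for x
    by (simp add: heaviside_def pos)
  have h2: "heaviside (- of_int x - 1/2) = (if x < 0 then 1 else 0)" for x
  proof -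
    have "- rat_of_int x - 1/2 = of_int (- x - 1) + 1/2" by simp
    then show ?thesis unfolding heaviside_def by (simp only: pos) auto
  qed
  show ?thesis
    unfolding eunit_def check_bracket_mon_eq 1 2 h1 h2 by (auto simp: jump_def)
qed

text \<open>Products of matrix units turn the defining formula of the bracket into the commutator of
  matrices together with the cocycle.\<close>

lemma check_bracket_emb:
  assumes "finite_band F" "finite_band G"
  shows "check_bracket tr (emb F) (emb G) = emb (F * G - G * F) + (0, psi F G)"
proof -
  obtain R where R: "\<And>p q. entry F p q \<noteq> 0 \<Longrightarrow> \<bar>p\<bar> \<le> R \<and> \<bar>q\<bar> \<le> R"
    using finite_bandE[OF assms(1)] by blast
  obtain R' where R': "\<And>p q. entry G p q \<noteq> 0 \<Longrightarrow> \<bar>p\<bar> \<le> R' \<and> \<bar>q\<bar> \<le> R'"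
    using finite_bandE[OF assms(2)] by blast
  define W where "W = {- max R R'..max R R'}"
  have W: "finite W" by (simp add: W_def)
  have F: "p \<in> W \<and> q \<in> W" if "entry F p q \<noteq> 0" for p q
    using R[OF that] by (auto simp: W_def)
  have G: "p \<in> W \<and> q \<in> W" if "entry G p q \<noteq> 0" for p q
    using R'[OF that] by (auto simp: W_def)
  let ?A = "\<lambda>p q p' q'. if p' = q then eunit (entry F p q * entry G p' q') p q' else 0"
  let ?B = "\<lambda>p q p' q'. if q' = p then eunit (entry G p' q' * entry F p q) p' q else 0"
  let ?C = "\<lambda>p q p' q'. if q' = p then if p' = q then jump p q * tr (entry F p q * entry G p' q') else 0 else 0"
  have FG: "emb (F * G) = (\<Sum>p\<in>W. \<Sum>q\<in>W. \<Sum>p'\<in>W. \<Sum>q'\<in>W. ?A p q p' q')"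
  proof -
    have "emb (F * G) = (\<Sum>p\<in>W. \<Sum>q'\<in>W. eunit (entry (F * G) p q') p q')"
      by (rule emb_eq_box) (use W F G in \<open>auto elim!: entry_times_nonzero\<close>)
    also have "\<dots> = (\<Sum>p\<in>W. \<Sum>q'\<in>W. \<Sum>q\<in>W. eunit (entry F p q * entry G q q') p q')"
      unfolding eunit_sum[symmetric]
      by (intro sum.cong refl arg_cong[where f = "\<lambda>a. eunit a _ _"] entry_times) (use W F in auto)
    also have "\<dots> = (\<Sum>p\<in>W. \<Sum>q\<in>W. \<Sum>q'\<in>W. \<Sum>p'\<in>W. ?A p q p' q')"
      using W by (subst sum.swap) (simp add: sum.delta)
    also have "\<dots> = (\<Sum>p\<in>W. \<Sum>q\<in>W. \<Sum>p'\<in>W. \<Sum>q'\<in>W. ?A p q p' q')"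
      by (intro sum.cong refl sum.swap)
    finally show ?thesis .
  qed
  have GF: "emb (G * F) = (\<Sum>p\<in>W. \<Sum>q\<in>W. \<Sum>p'\<in>W. \<Sum>q'\<in>W. ?B p q p' q')"
  proof -
    have "emb (G * F) = (\<Sum>p'\<in>W. \<Sum>q\<in>W. eunit (entry (G * F) p' q) p' q)"
      by (rule emb_eq_box) (use W F G in \<open>auto elim!: entry_times_nonzero\<close>)
    also have "\<dots> = (\<Sum>p'\<in>W. \<Sum>q\<in>W. \<Sum>p\<in>W. eunit (entry G p' p * entry F p q) p' q)"
      unfolding eunit_sum[symmetric]
      by (intro sum.cong refl arg_cong[where f = "\<lambda>a. eunit a _ _"] entry_times) (use W F in auto)
    also have "\<dots> = (\<Sum>q\<in>W. \<Sum>p'\<in>W. \<Sum>p\<in>W. eunit (entry G p' p * entry F p q) p' q)"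
      by (rule sum.swap)
    also have "\<dots> = (\<Sum>q\<in>W. \<Sum>p\<in>W. \<Sum>p'\<in>W. eunit (entry G p' p * entry F p q) p' q)"
      by (intro sum.cong refl sum.swap)
    also have "\<dots> = (\<Sum>p\<in>W. \<Sum>q\<in>W. \<Sum>p'\<in>W. eunit (entry G p' p * entry F p q) p' q)"
      by (rule sum.swap)
    finally show ?thesis using W by (simp add: sum.delta)
  qed
  have C: "(\<Sum>p\<in>W. \<Sum>q\<in>W. \<Sum>p'\<in>W. \<Sum>q'\<in>W. ?C p q p' q') = psi F G"
  proof -
    have "psi F G = (\<Sum>(p, q)\<in>W \<times> W. jump p q * tr (entry F p q * entry G q p))"
      by (rule psi_eq) (use W F in auto)
    then show ?thesis using W by (simp add: sum.delta sum.cartesian_product)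
  qed
  have pair: "(\<Sum>x\<in>S. (0 :: ((rat \<times> rat) \<Rightarrow>\<^sub>0 'a), f x)) = (0, \<Sum>x\<in>S. f x)" for S :: "int set" and f :: "int \<Rightarrow> complex"
    by (induction S rule: infinite_finite_induct) (simp_all add: zero_prod_def)
  have "check_bracket tr (emb F) (emb G)
      = (\<Sum>p\<in>W. \<Sum>q\<in>W. \<Sum>p'\<in>W. \<Sum>q'\<in>W. check_bracket tr (eunit (entry F p q) p q) (eunit (entry G p' q') p' q'))"
  proof -
    have 1: "emb F = (\<Sum>p\<in>W. \<Sum>q\<in>W. eunit (entry F p q) p q)" using F W by (intro emb_eq_box) auto
    have 2: "emb G = (\<Sum>p\<in>W. \<Sum>q\<in>W. eunit (entry G p q) p q)" using G W by (intro emb_eq_box) auto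
    show ?thesis unfolding 1 check_bracket_sum_left unfolding 2 check_bracket_sum_right ..
  qed
  also have "\<dots> = emb (F * G) - emb (G * F) + (0, psi F G)"
    unfolding check_bracket_eunit sum.distrib sum_subtractf FG GF C[symmetric] pair ..
  also have "emb (F * G) - emb (G * F) = emb (F * G - G * F)"
    by (rule emb_diff[symmetric]) (simp_all add: assms finite_band_times_left)
  finally show ?thesis .
qed

lemma sign_munit: "(-1) ^ m * munit a p q = munit ((-1) ^ m * a) p q"
  by (cases "even m") (auto intro!: band_eqI simp: entry_munit)

lemma adj_munit: "adj (munit a p q) = munit (\<tau> a) (- 1 - \<nu> - q) (- 1 - \<nu> - p)"
  by (rule band_eqI) (auto simp: entry_adj entry_munit taul.zero)

lemma munit_Lam:
  assumes i: "i \<in> {1..n}" and j: "j \<in> {1..n}" and a: "a \<in> B i j"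
  shows "munit a p q * Lam = munit (sA (falling (expo (q + int (\<l> j))) (\<l> j)) a) p (q + int (\<l> j))"
proof (rule band_eqI)
  fix p' q'
  have "entry (munit a p q * Lam) p' q'
      = (\<Sum>k\<in>{1..n}. entry (munit a p q) p' (q' - int (\<l> k)) * sA (falling (expo q') (\<l> k)) (e k))"
    unfolding Lam_def sum_distrib_left entry_sum by (intro sum.cong refl) (simp add: entry_times_wshift)
  also have "\<dots> = (\<Sum>k\<in>{1..n}. if k = j then
      (if p' = p \<and> q' - int (\<l> j) = q then sA (falling (expo q') (\<l> j)) a else 0) else 0)"
  proof (intro sum.cong refl)
    fix k assume k: "k \<in> {1..n}"
    show "entry (munit a p q) p' (q' - int (\<l> k)) * sA (falling (expo q') (\<l> k)) (e k) =
      (if k = j then (if p' = p \<and> q' - int (\<l> j) = q then sA (falling (expo q') (\<l> j)) a else 0) else 0)"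
      using L_times_e[OF j k B_L[OF i j a]] by (cases "k = j") (auto simp: entry_munit scale_mult_right)
  qed
  also have "\<dots> = (if p' = p \<and> q' - int (\<l> j) = q then sA (falling (expo q') (\<l> j)) a else 0)"
    using j by simp
  also have "\<dots> = entry (munit (sA (falling (expo (q + int (\<l> j))) (\<l> j)) a) p (q + int (\<l> j))) p' q'"
    by (auto simp: entry_munit)
  finally show "entry (munit a p q * Lam) p' q' = entry (munit (sA (falling (expo (q + int (\<l> j))) (\<l> j)) a) p (q + int (\<l> j))) p' q'" .
qed

text \<open>The generators of the twisted matrix algebra, indexed by the position of the matrix unit in front
  of \<open>\<Lambda>\<close>.\<close>

definition gen_at :: "nat \<Rightarrow> nat \<Rightarrow> 'a \<Rightarrow> int \<Rightarrow> int \<Rightarrow> 'a checkA" where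
  "gen_at i j a p q = check_gen sA \<tau> \<epsilon> \<l> \<iota> i j a (of_int p + 1/2) (- of_int (q + \<nu>) - 1/2)"

lemma ext_scale_mat_unit: "ext_scale sA c (mat_unit a x y) = mat_unit (sA c a) x y"
  by (auto simp: ext_scale_def mat_unit_def Poly_Mapping.map.rep_eq lookup_single when_def
        intro!: poly_mapping_eqI)

text \<open>The two falling factorials in the definition of a generator are matrix coefficients of \<open>\<Lambda>\<close>: the
  first after \<open>u \<mapsto> -1 - u\<close>, the second at the reflected position.\<close>

lemma gen_at_eq:
  assumes i: "i \<in> {1..n}" and j: "j \<in> {1..n}" and a: "a \<in> B i j"
  shows "gen_at i j a p q = emb ((munit a p q - (-1) ^ \<epsilon> * adj (munit a p q)) * Lam)"
proof -
  let ?p = "- 1 - \<nu> - q" and ?q = "- 1 - \<nu> - p"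
  have nu: "rat_of_int \<nu> = 2 * \<iota>" by (simp add: iota)
  have ta: "\<tau> a \<in> B (\<pi> j) (\<pi> i)" using tau_pieces[OF i j] a by auto
  have c1: "(-1) ^ \<epsilon> * falling (of_rat (- of_int (q + \<nu>) - 1/2 + \<iota> - 1/2)) (\<l> j)
      = falling (expo (q + int (\<l> j))) (\<l> j)"
  proof -
    have "- of_int (q + \<nu>) - 1/2 + \<iota> - 1/2 = - of_int q - \<iota> - 1" by (simp add: nu)
    then have "of_rat (- of_int (q + \<nu>) - 1/2 + \<iota> - 1/2) = of_nat (\<l> j) - 1 - expo (q + int (\<l> j))"
      by (simp add: of_rat_diff of_rat_minus of_rat_nu)
    then have "(-1) ^ \<epsilon> * falling (of_rat (- of_int (q + \<nu>) - 1/2 + \<iota> - 1/2)) (\<l> j)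
       = (-1) ^ \<epsilon> * ((-1) ^ \<epsilon> * falling (expo (q + int (\<l> j))) (\<l> j))"
      by (simp only: falling_reflect sign_l[OF j])
    then show ?thesis by (simp only: sign_sign)
  qed
  have c2: "falling (of_rat (of_int p + 1/2 + \<iota> - 1/2)) (\<l> i)
      = (-1) ^ \<epsilon> * falling (expo (?q + int (\<l> i))) (\<l> i)"
  proof -
    have "expo (?q + int (\<l> i)) = of_nat (\<l> i) - 1 - expo p"
      by (simp add: algebra_simps flip: of_rat_nu)
    then have "(-1) ^ \<epsilon> * falling (expo (?q + int (\<l> i))) (\<l> i) = (-1) ^ \<epsilon> * ((-1) ^ \<epsilon> * falling (expo p) (\<l> i))"
      by (simp only: falling_reflect sign_l[OF i])
    then show ?thesis by (simp add: sign_sign of_rat_add)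
  qed
  have x1: "- of_int (q + \<nu>) - 1/2 + 2 * \<iota> - of_nat (\<l> j) = - rat_of_int (q + int (\<l> j)) - 1/2"
    by (simp add: nu)
  have x2: "- of_int (q + \<nu>) - 1/2 = rat_of_int ?p + 1/2" by simp
  have x3: "of_int p + 1/2 + 2 * \<iota> - of_nat (\<l> i) = - rat_of_int (?q + int (\<l> i)) - 1/2"
    by (simp add: nu)
  have "gen_at i j a p q = eunit (sA (falling (expo (q + int (\<l> j))) (\<l> j)) a) p (q + int (\<l> j))
     - eunit (sA ((-1) ^ \<epsilon> * falling (expo (?q + int (\<l> i))) (\<l> i)) (\<tau> a)) ?p (?q + int (\<l> i))"
    unfolding gen_at_def check_gen_def c1 c2 x1 x3 ext_scale_mat_unit eunit_def unfolding x2 ..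
  also have "\<dots> = emb (munit a p q * Lam) - emb ((-1) ^ \<epsilon> * adj (munit a p q) * Lam)"
    unfolding adj_munit mult.assoc[of "(-1) ^ \<epsilon>"] munit_Lam[OF i j a]
      munit_Lam[OF pi_in[OF j] pi_in[OF i] ta]
    unfolding sign_munit l_perm[OF i] emb_munit scale_sign[symmetric] scale_scale ..
  also have "\<dots> = emb ((munit a p q - (-1) ^ \<epsilon> * adj (munit a p q)) * Lam)"
    unfolding left_diff_distrib
    by (rule emb_diff[symmetric])
       (simp_all add: finite_band_times_right finite_band_times_left finite_band_munit finite_band_adj)
  finally show ?thesis .
qed

text \<open>Twice \<open>X\<close> is the skewing of \<open>X\<close>, and the skewing of each Peirce component of a matrix entry gives
  one generator, placed at that entry.\<close>

lemma emb_skew_span: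
  assumes fin: "finite_band X" and skew: "skew X"
  shows "emb (X * Lam) \<in> ext.span {gen_at i j a p q | i j a p q.
           i \<in> {1..n} \<and> j \<in> {1..n} \<and> a \<in> B i j \<and> entry X p q \<noteq> 0}" (is "_ \<in> ext.span ?G")
proof -
  define g where "g Y = emb ((Y - (-1) ^ \<epsilon> * adj Y) * Lam)" for Y
  have g_fin: "finite_band ((Y - (-1) ^ \<epsilon> * adj Y) * Lam)" if "finite_band Y" for Y
    by (intro finite_band_times_right finite_band_diff finite_band_times_left finite_band_adj that)
  have g_add: "g (Y + Z) = g Y + g Z" if "finite_band Y" "finite_band Z" for Y Z
  proof -
    have "(Y + Z - (-1) ^ \<epsilon> * adj (Y + Z)) * Lam
        = (Y - (-1) ^ \<epsilon> * adj Y) * Lam + (Z - (-1) ^ \<epsilon> * adj Z) * Lam"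
      by (simp add: adj_add distrib_left distrib_right left_diff_distrib)
    then show ?thesis unfolding g_def by (simp add: emb_add g_fin that)
  qed
  have g_0: "g 0 = 0" using g_add[of 0 0] finite_band_0 by simp
  have g_sum: "g (\<Sum>x\<in>S. f x) = (\<Sum>x\<in>S. g (f x))" if "\<And>x. x \<in> S \<Longrightarrow> finite_band (f x)"
    for S and f :: "'k \<Rightarrow> 'a band"
    using that
    by (induction S rule: infinite_finite_induct) (auto simp: g_0 g_add finite_band_sum)
  let ?S = "{(p, q). entry X p q \<noteq> 0}"
  let ?m = "\<lambda>x i j. munit (e i * entry X (fst x) (snd x) * e j) (fst x) (snd x)"
  have S: "finite ?S" using fin by (simp add: finite_band_def)
  have munit_sum: "munit (\<Sum>x\<in>T. f x) p q = (\<Sum>x\<in>T. munit (f x) p q)" for T :: "nat set" and f p q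
    by (rule band_eqI) (auto simp: entry_munit intro!: sum.neutral)
  have dec: "(\<Sum>i\<in>{1..n}. \<Sum>j\<in>{1..n}. e i * a * e j) = a" for a
    unfolding sum_distrib_left[symmetric] sum_distrib_right[symmetric] e_sum by simp
  have "X = (\<Sum>x\<in>?S. munit (entry X (fst x) (snd x)) (fst x) (snd x))"
    using band_sum_munit[OF S, of X] by (simp add: case_prod_unfold)
  also have "\<dots> = (\<Sum>x\<in>?S. \<Sum>i\<in>{1..n}. \<Sum>j\<in>{1..n}. ?m x i j)"
    unfolding munit_sum[symmetric] dec ..
  finally have X: "X = (\<Sum>x\<in>?S. \<Sum>i\<in>{1..n}. \<Sum>j\<in>{1..n}. ?m x i j)" .
  \<comment> \<open>The skewing map is additive, so it may be applied to each entry of the Peirce decomposition.\<close>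
  have "g X = (\<Sum>x\<in>?S. \<Sum>i\<in>{1..n}. \<Sum>j\<in>{1..n}. g (?m x i j))"
    by (subst X) (simp add: g_sum finite_band_sum finite_band_munit)
  also have "\<dots> \<in> ext.span ?G"
  proof (intro ext.span_sum)
    fix x i j assume "x \<in> ?S" "i \<in> {1..n}" "j \<in> {1..n}"
    then show "g (?m x i j) \<in> ext.span ?G"
      unfolding g_def using gen_at_eq[of i j _ "fst x" "snd x", symmetric] peirce[of i j]
      by (intro ext.span_base CollectI exI[of _ i] exI[of _ j] exI[of _ "fst x"] exI[of _ "snd x"]
           exI[of _ "e i * entry X (fst x) (snd x) * e j"]) auto
  qed
  finally have "ext_scale sA (1/2) (g X) \<in> ext.span ?G" by (rule ext.span_scale)
  moreover have "g X = emb (X * Lam) + emb (X * Lam)"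
    unfolding g_def skewing_skew[OF skew] distrib_right
    by (intro emb_add finite_band_times_right fin)
  moreover have "ext_scale sA (1/2) (E + E) = E" for E :: "'a checkA"
  proof -
    have "ext_scale sA (1/2) (E + E) = ext_scale sA (1/2 + 1/2) E"
      unfolding ext.scale_right_distrib ext.scale_left_distrib ..
    then show ?thesis by simp
  qed
  ultimately show ?thesis by simp
qed

end



context twisted_bands
begin

definition scl :: "complex \<Rightarrow> 'a band \<Rightarrow> 'a band" where
  "scl c F = wshift 0 (\<lambda>q. sA c 1) * F"

lemma entry_scl [simp]: "entry (scl c F) p q = sA c (entry F p q)"
  by (simp add: scl_def entry_wshift_times scale_mult_left)

lemma scl_times: "scl c F * G = scl c (F * G)"
  by (simp add: scl_def mult.assoc)

lemma skew_scl:
  assumes "skew X" shows "skew (scl c X)"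
proof -
  have "adj (scl c X) = scl c (adj X)"
    by (rule band_eqI) (simp add: entry_adj taul.scale)
  also have "\<dots> = scl c (- ((-1) ^ \<epsilon> * X))" using assms by (simp only: skew_def)
  also have "\<dots> = - ((-1) ^ \<epsilon> * scl c X)"
    by (cases "even \<epsilon>") (auto intro!: band_eqI)
  finally show ?thesis by (simp only: skew_def)
qed

lemma emb_scl:
  assumes "finite_band F" shows "emb (scl c F) = ext_scale sA c (emb F)"
proof -
  have S: "finite {(p, q). entry F p q \<noteq> 0}" using assms by (simp add: finite_band_def)
  have "emb (scl c F) = (\<Sum>(p, q)\<in>{(p, q). entry F p q \<noteq> 0}. eunit (entry (scl c F) p q) p q)"
    by (rule emb_eq[OF S]) auto
  also have "\<dots> = ext_scale sA c (emb F)"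
    unfolding emb_def ext.scale_sum_right
    by (intro sum.cong refl) (simp add: eunit_def ext_scale_mat_unit case_prod_unfold)
  finally show ?thesis .
qed

section \<open>Truncation to windows\<close>

text \<open>This interval is invariant under \<open>p \<mapsto> -1 - \<nu> - p\<close>, so truncation preserves skew bands.\<close>

definition window :: "int \<Rightarrow> int set" where
  "window N = {- N..N - 1 - \<nu>}"

definition cut :: "int \<Rightarrow> 'a band" where
  "cut N = wshift 0 (\<lambda>p. if p \<in> window N then 1 else 0)"

text \<open>Truncation of \<open>X \<Lambda>\<close> on the right that corresponds to truncation of \<open>X\<close>.  It is needed because \<open>X\<close>
  is not determined by \<open>X \<Lambda>\<close>: derivatives kill some of the powers \<open>t^u\<close> when \<open>\<iota>\<close> is an
  integer.\<close>

definition cut_dom :: "int \<Rightarrow> 'a band" where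
  "cut_dom N = (\<Sum>j\<in>{1..n}. wshift 0 (\<lambda>q. if q - int (\<l> j) \<in> window N then e j else 0))"

definition trunc :: "int \<Rightarrow> 'a band \<Rightarrow> 'a band" where
  "trunc N X = cut N * X * cut N"

lemma entry_trunc: "entry (trunc N X) p q = (if p \<in> window N \<and> q \<in> window N then entry X p q else 0)"
  by (simp add: trunc_def cut_def entry_times_wshift entry_wshift_times)

lemma adj_cut: "adj (cut N) = cut N"
  unfolding cut_def adj_wshift
  by (rule arg_cong[where f = "wshift 0"]) (auto simp: window_def tau_one taul.zero)

lemma skew_trunc:
  assumes "skew X" shows "skew (trunc N X)"
proof -
  have "adj (trunc N X) = cut N * adj X * cut N"
    unfolding trunc_def by (simp only: adj_times adj_cut mult.assoc)
  also have "\<dots> = - ((-1) ^ \<epsilon> * trunc N X)"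
    unfolding trunc_def assms[unfolded skew_def] by (cases "even \<epsilon>") simp_all
  finally show ?thesis by (simp only: skew_def)
qed

lemma finite_band_trunc: "finite_band (trunc N X)"
  by (rule finite_bandI[where S = "window N"]) (auto simp: entry_trunc window_def split: if_splits)

lemma trunc_add: "trunc N (X + Y) = trunc N X + trunc N Y"
  by (simp add: trunc_def distrib_left distrib_right)

lemma trunc_scl: "trunc N (scl c X) = scl c (trunc N X)"
  by (rule band_eqI) (simp add: entry_trunc)

lemma Lam_cut_dom: "Lam * cut_dom N = cut N * Lam"
proof -
  let ?f = "\<lambda>j q. sA (falling (expo q) (\<l> j)) (e j)"
  let ?g = "\<lambda>j q. if q - int (\<l> j) \<in> window N then e j else 0"
  have "Lam * cut_dom N = (\<Sum>j\<in>{1..n}. \<Sum>k\<in>{1..n}. wshift (- int (\<l> j)) (\<lambda>q. ?f j q * ?g k q))"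
    unfolding Lam_def cut_dom_def sum_distrib_left sum_distrib_right wshift_times
    by (subst sum.swap) simp
  also have "\<dots> = (\<Sum>j\<in>{1..n}. \<Sum>k\<in>{1..n}. if k = j then
      wshift (- int (\<l> j)) (\<lambda>q. if q - int (\<l> j) \<in> window N then ?f j q else 0) else 0)"
  proof (intro sum.cong refl)
    fix j k assume jk: "j \<in> {1..n}" "k \<in> {1..n}"
    have "(\<lambda>q. ?f j q * ?g k q) = (\<lambda>q. if k = j then if q - int (\<l> j) \<in> window N then ?f j q else 0 else 0)"
      using e_times_e[OF jk] by (cases "k = j") (auto simp: fun_eq_iff scale_mult_left)
    then show "wshift (- int (\<l> j)) (\<lambda>q. ?f j q * ?g k q) = (if k = j then
      wshift (- int (\<l> j)) (\<lambda>q. if q - int (\<l> j) \<in> window N then ?f j q else 0) else 0)"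
      by (simp only: wshift_zero split: if_split) simp
  qed
  also have "\<dots> = (\<Sum>j\<in>{1..n}. wshift (- int (\<l> j)) (\<lambda>q. if q - int (\<l> j) \<in> window N then ?f j q else 0))"
    by (intro sum.cong refl) (simp add: sum.delta)
  also have "\<dots> = cut N * Lam"
    unfolding Lam_def cut_def sum_distrib_left wshift_times
    by (intro sum.cong refl arg_cong2[where f = wshift]) auto
  finally show ?thesis .
qed

lemma cut_times_Lam: "cut N * (X * Lam) * cut_dom N = trunc N X * Lam"
  by (simp only: trunc_def mult.assoc Lam_cut_dom)

lemma entry_trunc_Lam_stable:
  "\<exists>N0. \<forall>N\<ge>N0. \<forall>p q. \<bar>p\<bar> \<le> w \<longrightarrow> \<bar>q\<bar> \<le> w \<longrightarrow> entry (trunc N X * Lam) p q = entry (X * Lam) p q"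
proof (intro exI allI impI)
  fix N p q
  define b where "b = (\<Sum>j\<in>{1..n}. int (\<l> j))"
  assume N: "w + b + \<bar>\<nu>\<bar> + 1 \<le> N" and p: "\<bar>p\<bar> \<le> w" and q: "\<bar>q\<bar> \<le> w"
  have b: "int (\<l> j) \<le> b" if "j \<in> {1..n}" for j
    unfolding b_def by (rule member_le_sum) (use that in auto)
  have "0 \<le> b" unfolding b_def by (rule sum_nonneg) simp
  then have pw: "p \<in> window N" using N p by (auto simp: window_def)
  have qw: "q - int (\<l> j) \<in> window N" if "j \<in> {1..n}" for j
    using b[OF that] N q by (auto simp: window_def)
  have "entry (trunc N X * Lam) p q = (\<Sum>j\<in>{1..n}. entry (cut N * (X * Lam)) p q * (if q - int (\<l> j) \<in> window N then e j else 0))"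
    unfolding cut_times_Lam[symmetric] cut_dom_def sum_distrib_left entry_sum
    by (simp only: entry_times_wshift add_0_right)
  also have "\<dots> = (\<Sum>j\<in>{1..n}. entry (X * Lam) p q * e j)"
    using pw qw by (intro sum.cong refl) (simp add: cut_def entry_wshift_times)
  also have "\<dots> = entry (X * Lam) p q"
    unfolding sum_distrib_left[symmetric] e_sum by simp
  finally show "entry (trunc N X * Lam) p q = entry (X * Lam) p q" .
qed

text \<open>The cocycle sees only entries close to 0, and these do not change under large
  truncations.\<close>

lemma psi_trunc_stable:
  "\<exists>N0. \<forall>N\<ge>N0. psi (trunc N X * Lam) (trunc N Y * Lam) = psi (X * Lam) (Y * Lam)"
proof -
  obtain w where w: "\<And>p q. entry Lam p q \<noteq> 0 \<Longrightarrow> \<bar>p - q\<bar> \<le> w" using band_width[of Lam] by blast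
  obtain w' where w': "\<And>p q. entry X p q \<noteq> 0 \<Longrightarrow> \<bar>p - q\<bar> \<le> w'" using band_width[of X] by blast
  define S where "S = {- (w + w')..w + w'}"
  have near: "(p, q) \<in> S \<times> S" if jp: "jump p q \<noteq> 0" and nz: "entry (T * Lam) p q \<noteq> 0"
      and T: "\<And>p q. entry T p q \<noteq> 0 \<Longrightarrow> entry X p q \<noteq> 0" for T p q
  proof -
    obtain r where "entry T p r \<noteq> 0" "entry Lam r q \<noteq> 0" using nz by (rule entry_times_nonzero)
    then have "\<bar>p - q\<bar> \<le> w + w'" using w[of r q] w'[of p r] T by fastforce
    then show ?thesis using jp by (auto simp: S_def jump_def split: if_splits)
  qed
  have S: "finite (S \<times> S)" by (simp add: S_def)
  obtain N1 where N1: "\<And>N p q. N \<ge> N1 \<Longrightarrow> \<bar>p\<bar> \<le> w + w' \<Longrightarrow> \<bar>q\<bar> \<le> w + w' \<Longrightarrow> entry (trunc N X * Lam) p q = entry (X * Lam) p q"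
    using entry_trunc_Lam_stable by blast
  obtain N2 where N2: "\<And>N p q. N \<ge> N2 \<Longrightarrow> \<bar>p\<bar> \<le> w + w' \<Longrightarrow> \<bar>q\<bar> \<le> w + w' \<Longrightarrow> entry (trunc N Y * Lam) p q = entry (Y * Lam) p q"
    using entry_trunc_Lam_stable by blast
  show ?thesis
  proof (intro exI allI impI)
    fix N assume N: "max N1 N2 \<le> N"
    have "psi (trunc N X * Lam) (trunc N Y * Lam)
        = (\<Sum>(p, q)\<in>S \<times> S. jump p q * tr (entry (trunc N X * Lam) p q * entry (trunc N Y * Lam) q p))"
      by (rule psi_eq[OF S], rule near, assumption+) (auto simp: entry_trunc split: if_splits)
    also have "\<dots> = (\<Sum>(p, q)\<in>S \<times> S. jump p q * tr (entry (X * Lam) p q * entry (Y * Lam) q p))"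
      using N N1 N2 by (intro sum.cong refl) (auto simp: S_def abs_le_iff)
    also have "\<dots> = psi (X * Lam) (Y * Lam)"
      by (rule psi_eq[OF S, symmetric], rule near, assumption+)
    finally show "psi (trunc N X * Lam) (trunc N Y * Lam) = psi (X * Lam) (Y * Lam)" .
  qed
qed

text \<open>Positions near the two ends of a large window; the generators there will kill a given
  vector.\<close>

definition corner :: "int \<Rightarrow> int \<Rightarrow> int \<Rightarrow> bool" where
  "corner N p q \<longleftrightarrow> (N \<le> p \<and> N \<le> q) \<or> (p < - N \<and> q < - N)"

lemma corner_near:
  assumes "r \<notin> window N" "\<bar>p - r\<bar> \<le> w" "\<bar>q - r\<bar> \<le> w" "K + w + \<bar>\<nu>\<bar> + 1 \<le> N"
  shows "corner K p q"
  using assms by (auto simp: window_def corner_def)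

lemma half_odd_row: "of_int p + 1/2 \<in> half_odd"
  by (auto simp: half_odd_def)

lemma half_odd_col: "- of_int q - 1/2 \<in> half_odd"
  unfolding half_odd_def by (intro CollectI exI[of _ "- q - 1"]) simp

lemma half_odd_gen_at:
  assumes "l1 \<in> half_odd" "l2 \<in> half_odd"
  obtains p q where "l1 = of_int p + 1/2" "l2 = - of_int (q + \<nu>) - 1/2"
proof -
  obtain x y where "l1 = of_int x + 1/2" "l2 = of_int y + 1/2" using assms by (auto simp: half_odd_def)
  then show ?thesis by (intro that[of x "- y - 1 - \<nu>"]) simp_all
qed

text \<open>The generator at a position and the generator at its reflection agree up to sign, which exchanges
  the two kinds of corners.\<close>

lemma gen_at_swap:
  assumes i: "i \<in> {1..n}" and j: "j \<in> {1..n}" and a: "a \<in> B i j"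
  shows "gen_at (\<pi> j) (\<pi> i) (\<tau> a) (- 1 - \<nu> - q) (- 1 - \<nu> - p)
     = (if even \<epsilon> then - gen_at i j a p q else gen_at i j a p q)"
proof -
  let ?Y = "munit a p q"
  have ta: "\<tau> a \<in> B (\<pi> j) (\<pi> i)" using tau_pieces[OF i j] a by auto
  have fin: "finite_band ((?Y - (-1) ^ \<epsilon> * adj ?Y) * Lam)"
    by (intro finite_band_times_right finite_band_diff finite_band_times_left finite_band_adj finite_band_munit)
  have "gen_at (\<pi> j) (\<pi> i) (\<tau> a) (- 1 - \<nu> - q) (- 1 - \<nu> - p) = emb ((adj ?Y - (-1) ^ \<epsilon> * ?Y) * Lam)"
    using gen_at_eq[OF pi_in[OF j] pi_in[OF i] ta] adj_adj[of ?Y] by (simp only: adj_munit)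
  also have "\<dots> = (if even \<epsilon> then emb (0 - (?Y - (-1) ^ \<epsilon> * adj ?Y) * Lam) else emb ((?Y - (-1) ^ \<epsilon> * adj ?Y) * Lam))"
    by (cases "even \<epsilon>") (simp_all add: left_diff_distrib distrib_right add.commute)
  also have "emb (0 - (?Y - (-1) ^ \<epsilon> * adj ?Y) * Lam) = - emb ((?Y - (-1) ^ \<epsilon> * adj ?Y) * Lam)"
    by (subst emb_diff[OF finite_band_0 fin]) simp
  finally show ?thesis unfolding gen_at_eq[OF i j a] .
qed

end

section \<open>Tame vectors and the projective action of infinite bands\<close>

locale twisted_module = twisted_bands sA tr n L B \<tau> \<pi> \<epsilon> \<l> \<iota> \<nu>
  for sA :: "complex \<Rightarrow> 'a::ring_1 \<Rightarrow> 'a" and tr n L B \<tau> \<pi> \<epsilon> \<l> \<iota> \<nu> +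
  fixes sM :: "complex \<Rightarrow> 'm::ab_group_add \<Rightarrow> 'm"
    and \<rho> :: "'a checkA \<Rightarrow> 'm \<Rightarrow> 'm" and M0 :: "'m set" and m :: nat
  assumes rep: "lie_representation (check_sub sA n B \<tau> \<epsilon> \<l> \<iota>) (ext_scale sA) (check_bracket tr) sM \<rho>"
    and gen: "generated_by (check_sub sA n B \<tau> \<epsilon> \<l> \<iota>) sM \<rho> M0"
    and vanish: "\<forall>x\<in>check_sub_ge sA n B \<tau> \<epsilon> \<l> \<iota> m. \<forall>v\<in>M0. \<rho> x v = 0"
begin

abbreviation "check_alg \<equiv> check_sub sA n B \<tau> \<epsilon> \<l> \<iota>"

sublocale modM: vector_space sM
  using rep by (simp add: lie_representation_def)

lemma rho_linear: "x \<in> check_alg \<Longrightarrow> Vector_Spaces.linear sM sM (\<rho> x)"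
  using rep by (simp add: lie_representation_def)

lemma rho_add: "x \<in> check_alg \<Longrightarrow> y \<in> check_alg \<Longrightarrow> \<rho> (x + y) v = \<rho> x v + \<rho> y v"
  using rep by (simp add: lie_representation_def)

lemma rho_scale: "x \<in> check_alg \<Longrightarrow> \<rho> (ext_scale sA c x) v = sM c (\<rho> x v)"
  using rep by (simp add: lie_representation_def)

lemma rho_bracket: "x \<in> check_alg \<Longrightarrow> y \<in> check_alg \<Longrightarrow> \<rho> (check_bracket tr x y) v = \<rho> x (\<rho> y v) - \<rho> y (\<rho> x v)"
  using rep by (simp add: lie_representation_def)

lemma check_alg_subspace: "ext.subspace check_alg"
  unfolding check_sub_def by (rule ext.subspace_span)

lemma rho_0: "\<rho> 0 v = 0"
  using rho_add[of 0 0 v] ext.subspace_0[OF check_alg_subspace] by simp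

lemma rho_uminus: "x \<in> check_alg \<Longrightarrow> \<rho> (- x) v = - \<rho> x v"
  using rho_add[of x "- x" v] ext.subspace_neg[OF check_alg_subspace, of x] rho_0
  by (simp add: eq_neg_iff_add_eq_0 add.commute)

lemma rho_sum: "(\<And>x. x \<in> S \<Longrightarrow> f x \<in> check_alg) \<Longrightarrow> \<rho> (\<Sum>x\<in>S. f x) v = (\<Sum>x\<in>S. \<rho> (f x) v)"
proof (induction S rule: infinite_finite_induct)
  case (insert x S)
  have "(\<Sum>x\<in>S. f x) \<in> check_alg" by (rule ext.subspace_sum[OF check_alg_subspace]) (use insert in auto)
  then show ?case using insert by (simp add: rho_add)
qed (simp_all add: rho_0)

lemma
  assumes "x \<in> check_alg"
  shows rho_vadd: "\<rho> x (v + w) = \<rho> x v + \<rho> x w"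
    and rho_vscale: "\<rho> x (sM c v) = sM c (\<rho> x v)"
    and rho_v0: "\<rho> x 0 = 0"
proof -
  interpret l: Vector_Spaces.linear sM sM "\<rho> x" by (rule rho_linear[OF assms])
  show "\<rho> x (v + w) = \<rho> x v + \<rho> x w" "\<rho> x (sM c v) = sM c (\<rho> x v)" "\<rho> x 0 = 0"
    by (rule l.add l.scale l.zero)+
qed

lemma gen_at_check_alg:
  assumes "i \<in> {1..n}" "j \<in> {1..n}" "a \<in> B i j"
  shows "gen_at i j a p q \<in> check_alg"
  unfolding check_sub_def gen_at_def
  by (rule ext.span_base) (use assms half_odd_row half_odd_col in blast)

lemma central_check_alg: "central \<in> check_alg"
  unfolding check_sub_def by (rule ext.span_base) simp

lemma scaled_central: "ext_scale sA c central = (0, c)"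
  by (auto simp: ext_scale_def intro!: poly_mapping_eqI simp: Poly_Mapping.map.rep_eq)

lemma pair_check_alg: "(0, c) \<in> check_alg" and rho_pair: "\<rho> (0, c) v = sM c (\<rho> central v)"
proof -
  show "(0, c) \<in> check_alg" using ext.subspace_scale[OF check_alg_subspace central_check_alg, of c] by (simp add: scaled_central)
  show "\<rho> (0, c) v = sM c (\<rho> central v)" using rho_scale[OF central_check_alg, of c v] by (simp add: scaled_central)
qed

lemma emb_skew_check_alg:
  assumes "finite_band X" "skew X" shows "emb (X * Lam) \<in> check_alg"
proof -
  have "{gen_at i j a p q | i j a p q. i \<in> {1..n} \<and> j \<in> {1..n} \<and> a \<in> B i j \<and> entry X p q \<noteq> 0} \<subseteq> check_alg"
    using gen_at_check_alg by blast
  from ext.span_minimal[OF this check_alg_subspace] emb_skew_span[OF assms] show ?thesis by blast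
qed

definition tame :: "int \<Rightarrow> 'm \<Rightarrow> bool" where
  "tame N v \<longleftrightarrow> (\<forall>i\<in>{1..n}. \<forall>j\<in>{1..n}. \<forall>a\<in>B i j. \<forall>p q. corner N p q \<longrightarrow> \<rho> (gen_at i j a p q) v = 0)"

lemma tame_mono: "tame N v \<Longrightarrow> N \<le> N' \<Longrightarrow> tame N' v"
  unfolding tame_def corner_def by (smt (verit))

lemma rho_corner:
  assumes "finite_band X" "skew X" "tame N v" "\<And>p q. entry X p q \<noteq> 0 \<Longrightarrow> corner N p q"
  shows "\<rho> (emb (X * Lam)) v = 0"
proof -
  let ?K = "{x \<in> check_alg. \<rho> x v = 0}"
  have "ext.subspace ?K"
    using check_alg_subspace by (auto simp: ext.subspace_def rho_0 rho_add rho_scale)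
  then have "ext.span {gen_at i j a p q | i j a p q.
           i \<in> {1..n} \<and> j \<in> {1..n} \<and> a \<in> B i j \<and> entry X p q \<noteq> 0} \<subseteq> ?K"
    by (rule ext.span_minimal[rotated]) (use assms(3,4) gen_at_check_alg in \<open>unfold tame_def, blast\<close>)
  then show ?thesis using emb_skew_span[OF assms(1,2)] by blast
qed

text \<open>A generator at a far corner involves only rows and columns far from 0, so its products with a
  fixed finite matrix are zero and the cocycle vanishes too.\<close>

lemma far_bracket:
  assumes i: "i \<in> {1..n}" and j: "j \<in> {1..n}" and a: "a \<in> B i j"
  shows "\<exists>N. \<forall>i'\<in>{1..n}. \<forall>j'\<in>{1..n}. \<forall>b\<in>B i' j'. \<forall>p' q'. corner N p' q' \<longrightarrow>
     check_bracket tr (gen_at i' j' b p' q') (gen_at i j a p q) = 0"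
proof -
  define X where "X = (munit a p q - (-1) ^ \<epsilon> * adj (munit a p q)) * Lam"
  have finX: "finite_band X" unfolding X_def
    by (intro finite_band_times_right finite_band_diff finite_band_times_left finite_band_adj finite_band_munit)
  obtain R where R: "\<And>p q. entry X p q \<noteq> 0 \<Longrightarrow> \<bar>p\<bar> \<le> R \<and> \<bar>q\<bar> \<le> R"
    using finite_bandE[OF finX] by blast
  obtain w where w: "\<And>p q. entry Lam p q \<noteq> 0 \<Longrightarrow> \<bar>p - q\<bar> \<le> w" using band_width[of Lam] by blast
  show ?thesis
  proof (intro exI ballI allI impI)
    fix i' j' b p' q'
    assume i': "i' \<in> {1..n}" and j': "j' \<in> {1..n}" and b: "b \<in> B i' j'"
      and corner: "corner (R + \<bar>w\<bar> + \<bar>\<nu>\<bar> + 2) p' q'"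
    define Y where "Y = munit b p' q' - (-1) ^ \<epsilon> * adj (munit b p' q')"
    have finY: "finite_band (Y * Lam)" unfolding Y_def
      by (intro finite_band_times_right finite_band_diff finite_band_times_left finite_band_adj finite_band_munit)
    \<comment> \<open>The reflection moves indices by \<open>1 + \<nu>\<close> and \<open>\<Lambda>\<close> by at most \<open>w\<close>, whence the margin in the corner.\<close>
    have Y: "\<bar>x\<bar> > R + \<bar>w\<bar> \<and> \<bar>y\<bar> > R + \<bar>w\<bar>" if "entry Y x y \<noteq> 0" for x y
    proof -
      have "(x = p' \<and> y = q') \<or> (x = - 1 - \<nu> - q' \<and> y = - 1 - \<nu> - p')"
        using that unfolding Y_def adj_munit sign_munit by (auto simp: entry_munit split: if_splits)
      with corner show ?thesis by (auto simp: corner_def)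
    qed
    have YL: "\<bar>x\<bar> > R \<and> \<bar>y\<bar> > R" if nz: "entry (Y * Lam) x y \<noteq> 0" for x y
    proof -
      obtain r where "entry Y x r \<noteq> 0" "entry Lam r y \<noteq> 0" using nz by (rule entry_times_nonzero)
      with Y[of x r] w[of r y] show ?thesis by auto
    qed
    have "entry (Y * Lam * X) x y = 0" for x y
    proof (rule ccontr)
      assume "entry (Y * Lam * X) x y \<noteq> 0"
      then obtain r where "entry (Y * Lam) x r \<noteq> 0" "entry X r y \<noteq> 0" by (rule entry_times_nonzero)
      with YL[of x r] R[of r y] show False by simp
    qed
    then have "Y * Lam * X = 0" by (intro band_eqI) simp
    moreover have "entry (X * (Y * Lam)) x y = 0" for x y
    proof (rule ccontr)
      assume "entry (X * (Y * Lam)) x y \<noteq> 0"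
      then obtain r where "entry X x r \<noteq> 0" "entry (Y * Lam) r y \<noteq> 0" by (rule entry_times_nonzero)
      with YL[of r y] R[of x r] show False by simp
    qed
    then have "X * (Y * Lam) = 0" by (intro band_eqI) simp
    moreover have "psi (Y * Lam) X = 0"
    proof -
      have False if "entry (Y * Lam) x y \<noteq> 0" "entry X y x \<noteq> 0" for x y
        using YL[OF that(1)] R[OF that(2)] by simp
      then show ?thesis by (subst psi_eq[of "{}"]) auto
    qed
    ultimately show "check_bracket tr (gen_at i' j' b p' q') (gen_at i j a p q) = 0"
      unfolding gen_at_eq[OF i j a] gen_at_eq[OF i' j' b] X_def[symmetric] Y_def[symmetric]
        check_bracket_emb[OF finY finX] by (simp add: zero_prod_def)
  qed
qed

lemma check_alg_induct [consumes 1, case_names central gen add scale]: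
  assumes "x \<in> check_alg" "P central"
    and gen: "\<And>i j a p q. i \<in> {1..n} \<Longrightarrow> j \<in> {1..n} \<Longrightarrow> a \<in> B i j \<Longrightarrow> P (gen_at i j a p q)"
    and add: "\<And>x y. x \<in> check_alg \<Longrightarrow> y \<in> check_alg \<Longrightarrow> P x \<Longrightarrow> P y \<Longrightarrow> P (x + y)"
    and scale: "\<And>c x. x \<in> check_alg \<Longrightarrow> P x \<Longrightarrow> P (ext_scale sA c x)"
  shows "P x"
proof -
  let ?S = "insert central {check_gen sA \<tau> \<epsilon> \<l> \<iota> i j a l1 l2 | i j a l1 l2.
          i \<in> {1..n} \<and> j \<in> {1..n} \<and> a \<in> B i j \<and> l1 \<in> half_odd \<and> l2 \<in> half_odd}"
  have base: "P x" if xS: "x \<in> ?S" for x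
  proof (cases "x = central")
    case False
    then obtain i j a l1 l2 where x: "x = check_gen sA \<tau> \<epsilon> \<l> \<iota> i j a l1 l2"
      and ij: "i \<in> {1..n}" "j \<in> {1..n}" "a \<in> B i j" and l: "l1 \<in> half_odd" "l2 \<in> half_odd"
      using xS by blast
    obtain p q where "l1 = of_int p + 1/2" "l2 = - of_int (q + \<nu>) - 1/2"
      using l by (rule half_odd_gen_at)
    then have "x = gen_at i j a p q" unfolding x gen_at_def by simp
    then show ?thesis using gen[OF ij] by simp
  qed (simp add: assms)
  have "x \<in> ext.span ?S" using assms(1) by (simp only: check_sub_def)
  moreover have "ext.subspace {x \<in> check_alg. P x}"
    unfolding ext.subspace_def
  proof (intro conjI ballI allI)
    have "P (ext_scale sA 0 central)" by (rule scale[OF central_check_alg assms(2)])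
    then show "0 \<in> {x \<in> check_alg. P x}" using ext.subspace_0[OF check_alg_subspace] by simp
  qed (use check_alg_subspace add scale in \<open>auto simp: ext.subspace_def\<close>)
  moreover have "?S \<subseteq> {x \<in> check_alg. P x}" using base ext.span_base[of _ ?S] unfolding check_sub_def by blast
  ultimately show ?thesis using ext.span_minimal by blast
qed

lemma far_commute:
  assumes "x \<in> check_alg"
  shows "\<exists>N. \<forall>i'\<in>{1..n}. \<forall>j'\<in>{1..n}. \<forall>b\<in>B i' j'. \<forall>p' q'. corner N p' q' \<longrightarrow>
     (\<forall>v. \<rho> (gen_at i' j' b p' q') (\<rho> x v) = \<rho> x (\<rho> (gen_at i' j' b p' q') v))"
    (is "\<exists>N. ?P N x")
  using assms
proof (induction rule: check_alg_induct)
  case central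
  have "check_bracket tr y central = 0" for y by (simp add: check_bracket_def)
  then show ?case
    using rho_bracket[OF gen_at_check_alg central_check_alg] rho_0 by (intro exI[of _ 0] ballI allI impI) simp
next
  case (gen i j a p q)
  obtain N where N: "\<forall>i'\<in>{1..n}. \<forall>j'\<in>{1..n}. \<forall>b\<in>B i' j'. \<forall>p' q'. corner N p' q' \<longrightarrow>
     check_bracket tr (gen_at i' j' b p' q') (gen_at i j a p q) = 0"
    using far_bracket[OF gen] by blast
  show ?case
  proof (intro exI ballI allI impI)
    fix i' j' b p' q' v
    assume *: "i' \<in> {1..n}" "j' \<in> {1..n}" "b \<in> B i' j'" "corner N p' q'"
    show "\<rho> (gen_at i' j' b p' q') (\<rho> (gen_at i j a p q) v) = \<rho> (gen_at i j a p q) (\<rho> (gen_at i' j' b p' q') v)"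
      using rho_bracket[OF gen_at_check_alg[OF *(1-3)] gen_at_check_alg[OF gen], of p' q' p q v] N * rho_0 by simp
  qed
next
  case (add x y)
  obtain N N' where "?P N x" "?P N' y" using add by blast
  moreover have "corner (max N N') p q \<Longrightarrow> corner N p q \<and> corner N' p q" for p q
    by (auto simp: corner_def)
  ultimately have "?P (max N N') (x + y)"
    using add(1,2) gen_at_check_alg by (simp add: rho_add rho_vadd)
  then show ?case by blast
next
  case (scale c x)
  then obtain N where "?P N x" by blast
  then have "?P N (ext_scale sA c x)"
    using scale(1) gen_at_check_alg by (simp add: rho_scale rho_vscale)
  then show ?case by blast
qed

text \<open>The hypothesis on \<open>M\<^sub>0\<close> covers the corner at which both indices are large; the other one is its
  reflection.  The margin \<open>2 \<bar>\<nu>\<bar> + 2\<close> absorbs the shifts by \<open>\<nu>\<close> and \<open>1 + \<nu>\<close>.\<close>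

lemma tame_M0:
  assumes v: "v \<in> M0"
  shows "tame (int m + 2 * \<bar>\<nu>\<bar> + 2) v"
proof -
  have kill: "\<rho> (gen_at i j a p q) v = 0"
    if ij: "i \<in> {1..n}" "j \<in> {1..n}" "a \<in> B i j" and pq: "int m \<le> p" "int m \<le> q + \<nu>" for i j a p q
  proof -
    have c: "rat_of_nat m \<le> of_int x" if "int m \<le> x" for x
      using that by (metis of_int_le_iff of_int_of_nat_eq)
    have "gen_at i j a p q = check_gen sA \<tau> \<epsilon> \<l> \<iota> i j a (of_int p + 1/2) (- (of_int (q + \<nu>) + 1/2))"
      by (simp add: gen_at_def)
    moreover have "of_int (q + \<nu>) + 1/2 \<in> half_odd" by (rule half_odd_row)
    moreover have "rat_of_nat m < of_int p + 1/2" "rat_of_nat m < of_int (q + \<nu>) + 1/2"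
      using c[OF pq(1)] c[OF pq(2)] by simp_all
    ultimately have "gen_at i j a p q \<in> check_sub_ge sA n B \<tau> \<epsilon> \<l> \<iota> m"
      unfolding check_sub_ge_def using ij half_odd_row by (intro ext.span_base) blast
    then show ?thesis using vanish v by blast
  qed
  show ?thesis
    unfolding tame_def
  proof (intro ballI allI impI)
    fix i j a p q
    assume ij: "i \<in> {1..n}" "j \<in> {1..n}" "a \<in> B i j" and "corner (int m + 2 * \<bar>\<nu>\<bar> + 2) p q"
    then consider "int m \<le> p" "int m \<le> q + \<nu>" | "int m \<le> - 1 - \<nu> - q" "int m \<le> - 1 - \<nu> - p + \<nu>"
      unfolding corner_def by linarith
    then show "\<rho> (gen_at i j a p q) v = 0"
    proof cases
      case 1 then show ?thesis using kill ij by blast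
    next
      case 2
      have "\<tau> a \<in> B (\<pi> j) (\<pi> i)" using tau_pieces ij by blast
      then have "\<rho> (gen_at (\<pi> j) (\<pi> i) (\<tau> a) (- 1 - \<nu> - q) (- 1 - \<nu> - p)) v = 0"
        using kill[OF pi_in pi_in] ij 2 by blast
      then show ?thesis
        unfolding gen_at_swap[OF ij] using rho_uminus[OF gen_at_check_alg[OF ij]] by (simp split: if_splits)
    qed
  qed
qed

text \<open>The tame vectors form a submodule, as a generator far enough out commutes with a given element of
  the algebra.\<close>

lemma all_tame: "\<exists>N. tame N v"
proof -
  let ?N = "{v. \<exists>N. tame N v}"
  have "modM.subspace ?N"
    unfolding modM.subspace_def
  proof (intro conjI ballI allI)
    show "0 \<in> ?N" by (auto simp: tame_def rho_v0 gen_at_check_alg)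
  next
    fix x y assume "x \<in> ?N" "y \<in> ?N"
    then obtain N N' where "tame N x" "tame N' y" by blast
    then have "tame (max N N') x" "tame (max N N') y" by (auto intro: tame_mono)
    then have "tame (max N N') (x + y)" by (simp add: tame_def rho_vadd gen_at_check_alg)
    then show "x + y \<in> ?N" by blast
  next
    fix c x assume "x \<in> ?N"
    then obtain N where "tame N x" by blast
    then have "tame N (sM c x)" by (simp add: tame_def rho_vscale gen_at_check_alg)
    then show "sM c x \<in> ?N" by blast
  qed
  moreover have "M0 \<subseteq> ?N" using tame_M0 by blast
  moreover have "\<rho> x v \<in> ?N" if x: "x \<in> check_alg" and v: "v \<in> ?N" for x v
  proof -
    obtain N where N: "tame N v" using v by blast
    obtain N' where N': "\<forall>i'\<in>{1..n}. \<forall>j'\<in>{1..n}. \<forall>b\<in>B i' j'. \<forall>p' q'. corner N' p' q' \<longrightarrow>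
     (\<forall>v. \<rho> (gen_at i' j' b p' q') (\<rho> x v) = \<rho> x (\<rho> (gen_at i' j' b p' q') v))"
      using far_commute[OF x] by blast
    have "tame (max N N') (\<rho> x v)"
      unfolding tame_def
    proof (intro ballI allI impI)
      fix i j a p q assume ij: "i \<in> {1..n}" "j \<in> {1..n}" "a \<in> B i j" and "corner (max N N') p q"
      then have "corner N p q" "corner N' p q" by (auto simp: corner_def)
      then show "\<rho> (gen_at i j a p q) (\<rho> x v) = 0"
        using N N' ij rho_v0[OF x] unfolding tame_def by simp
    qed
    then show ?thesis by blast
  qed
  ultimately have "?N = UNIV" using gen unfolding generated_by_def by blast
  then show ?thesis by blast
qed

end



context twisted_module
begin

text \<open>The eventual value of the action of the truncations.  It depends on \<open>Z = X \<Lambda>\<close> only, which makes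
  it a function of the differential operator.\<close>

definition act :: "'a band \<Rightarrow> 'm \<Rightarrow> 'm" where
  "act Z v = (SOME w. \<exists>N0. \<forall>N\<ge>N0. \<rho> (emb (cut N * Z * cut_dom N)) v = w)"

lemma act_eqI:
  assumes "\<forall>N\<ge>N0. \<rho> (emb (trunc N X * Lam)) v = w"
  shows "act (X * Lam) v = w"
  unfolding act_def cut_times_Lam
proof (rule some_equality)
  fix w' assume "\<exists>N0. \<forall>N\<ge>N0. \<rho> (emb (trunc N X * Lam)) v = w'"
  then obtain N1 where "\<forall>N\<ge>N1. \<rho> (emb (trunc N X * Lam)) v = w'" by blast
  with assms show "w' = w" by (metis max.cobounded1 max.cobounded2)
qed (use assms in blast)

lemma emb_trunc_check_alg: "skew X \<Longrightarrow> emb (trunc N X * Lam) \<in> check_alg"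
  by (intro emb_skew_check_alg finite_band_trunc skew_trunc)

text \<open>Two large truncations differ by a skew finite matrix with entries at far corners, since the
  entries of \<open>X\<close> lie in a band.\<close>

lemma act_eventually:
  assumes X: "skew X"
  shows "\<exists>N0. \<forall>N\<ge>N0. \<rho> (emb (trunc N X * Lam)) v = act (X * Lam) v"
proof -
  obtain K where K: "tame K v" using all_tame by blast
  obtain w where w: "\<And>p q. entry X p q \<noteq> 0 \<Longrightarrow> \<bar>p - q\<bar> \<le> w" using band_width[of X] by blast
  \<comment> \<open>A position outside the window and a position within distance \<open>w\<close> of it are then both beyond \<open>K\<close>.\<close>
  define N0 where "N0 = K + \<bar>w\<bar> + \<bar>\<nu>\<bar> + 1"
  have "\<forall>N\<ge>N0. \<rho> (emb (trunc N X * Lam)) v = \<rho> (emb (trunc N0 X * Lam)) v"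
  proof (intro allI impI)
    fix N assume N: "N0 \<le> N"
    define D where "D = trunc N X - trunc N0 X"
    have D: "finite_band D" "skew D"
      unfolding D_def by (simp_all add: finite_band_diff finite_band_trunc skew_diff skew_trunc X)
    have "corner K p q" if nz: "entry D p q \<noteq> 0" for p q
    proof -
      have *: "entry X p q \<noteq> 0" "p \<notin> window N0 \<or> q \<notin> window N0"
        using nz N unfolding D_def by (auto simp: entry_trunc window_def split: if_splits)
      have "\<bar>p - q\<bar> \<le> \<bar>w\<bar>" using w[OF *(1)] by simp
      with *(2) show ?thesis
        by (auto intro: corner_near[of p N0 _ "\<bar>w\<bar>"] corner_near[of q N0 _ "\<bar>w\<bar>"] simp: N0_def abs_minus_commute)
    qed
    then have "\<rho> (emb (D * Lam)) v = 0" by (intro rho_corner[OF D K])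
    moreover have "emb (trunc N X * Lam) = emb (D * Lam) + emb (trunc N0 X * Lam)"
      unfolding D_def
      by (subst emb_add[symmetric]) (simp_all add: finite_band_times_right finite_band_diff finite_band_trunc left_diff_distrib)
    ultimately show "\<rho> (emb (trunc N X * Lam)) v = \<rho> (emb (trunc N0 X * Lam)) v"
      using emb_skew_check_alg[OF D] emb_trunc_check_alg[OF X] by (simp add: rho_add)
  qed
  from act_eqI[OF this] this show ?thesis by metis
qed

lemma act_add:
  assumes X: "skew X" and Y: "skew Y"
  shows "act ((X + Y) * Lam) v = act (X * Lam) v + act (Y * Lam) v"
proof -
  obtain N1 where N1: "\<forall>N\<ge>N1. \<rho> (emb (trunc N X * Lam)) v = act (X * Lam) v" using act_eventually[OF X] by blast
  obtain N2 where N2: "\<forall>N\<ge>N2. \<rho> (emb (trunc N Y * Lam)) v = act (Y * Lam) v" using act_eventually[OF Y] by blast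
  show ?thesis
  proof (rule act_eqI, intro allI impI)
    fix N assume N: "max N1 N2 \<le> N"
    have "\<rho> (emb (trunc N (X + Y) * Lam)) v = \<rho> (emb (trunc N X * Lam) + emb (trunc N Y * Lam)) v"
      by (simp add: trunc_add distrib_right emb_add finite_band_times_right finite_band_trunc)
    also have "\<dots> = act (X * Lam) v + act (Y * Lam) v"
      using N N1 N2 by (simp add: rho_add emb_trunc_check_alg X Y)
    finally show "\<rho> (emb (trunc N (X + Y) * Lam)) v = act (X * Lam) v + act (Y * Lam) v" .
  qed
qed

lemma act_scl:
  assumes X: "skew X"
  shows "act (scl c X * Lam) v = sM c (act (X * Lam) v)"
proof -
  obtain N1 where N1: "\<forall>N\<ge>N1. \<rho> (emb (trunc N X * Lam)) v = act (X * Lam) v" using act_eventually[OF X] by blast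
  show ?thesis
  proof (rule act_eqI, intro allI impI)
    fix N assume N: "N1 \<le> N"
    have "\<rho> (emb (trunc N (scl c X) * Lam)) v = \<rho> (ext_scale sA c (emb (trunc N X * Lam))) v"
      by (simp add: trunc_scl scl_times emb_scl finite_band_times_right finite_band_trunc)
    also have "\<dots> = sM c (act (X * Lam) v)"
      using N N1 by (simp add: rho_scale emb_trunc_check_alg X)
    finally show "\<rho> (emb (trunc N (scl c X) * Lam)) v = sM c (act (X * Lam) v)" .
  qed
qed

lemma act_linear:
  assumes X: "skew X"
  shows "Vector_Spaces.linear sM sM (act (X * Lam))"
proof (unfold_locales)
  fix v w c
  obtain N1 where N1: "\<forall>N\<ge>N1. \<rho> (emb (trunc N X * Lam)) v = act (X * Lam) v" using act_eventually[OF X] by blast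
  obtain N2 where N2: "\<forall>N\<ge>N2. \<rho> (emb (trunc N X * Lam)) w = act (X * Lam) w" using act_eventually[OF X] by blast
  show "act (X * Lam) (v + w) = act (X * Lam) v + act (X * Lam) w"
    by (rule act_eqI[of "max N1 N2"]) (use N1 N2 in \<open>simp add: rho_vadd emb_trunc_check_alg X\<close>)
  show "act (X * Lam) (sM c v) = sM c (act (X * Lam) v)"
    by (rule act_eqI[of N1]) (use N1 in \<open>simp add: rho_vscale emb_trunc_check_alg X\<close>)
qed

text \<open>The defect is the truncation of \<open>X (\<Lambda> - \<Lambda>\<^sub>N) Y\<close>, where \<open>\<Lambda>\<^sub>N\<close> is the truncation of \<open>\<Lambda>\<close>.  An entry
  passes through a position outside the window and returns, and the bandwidths bound how far it can
  be from the ends.\<close>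

lemma trunc_defect_corner:
  "\<exists>N0. \<forall>N\<ge>N0. \<forall>p q. entry (trunc N (X * Lam * Y) - trunc N X * Lam * trunc N Y) p q \<noteq> 0 \<longrightarrow> corner K p q"
proof -
  obtain w1 where w1: "\<And>p q. entry X p q \<noteq> 0 \<Longrightarrow> \<bar>p - q\<bar> \<le> w1" using band_width[of X] by blast
  obtain w2 where w2: "\<And>p q. entry Lam p q \<noteq> 0 \<Longrightarrow> \<bar>p - q\<bar> \<le> w2" using band_width[of Lam] by blast
  obtain w3 where w3: "\<And>p q. entry Y p q \<noteq> 0 \<Longrightarrow> \<bar>p - q\<bar> \<le> w3" using band_width[of Y] by blast
  define w where "w = \<bar>w1\<bar> + \<bar>w2\<bar> + \<bar>w3\<bar>"
  show ?thesis
  proof (intro exI allI impI)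
    fix N p q
    assume N: "K + w + \<bar>\<nu>\<bar> + 1 \<le> N"
      and nz: "entry (trunc N (X * Lam * Y) - trunc N X * Lam * trunc N Y) p q \<noteq> 0"
    have "trunc N (X * Lam * Y) - trunc N X * Lam * trunc N Y
        = cut N * X * (Lam - trunc N Lam) * (Y * cut N)"
      by (simp add: trunc_def algebra_simps)
    with nz have "entry (cut N * X * (Lam - trunc N Lam) * (Y * cut N)) p q \<noteq> 0" by simp
    then obtain s where s: "entry (cut N * X * (Lam - trunc N Lam)) p s \<noteq> 0" "entry (Y * cut N) s q \<noteq> 0"
      by (rule entry_times_nonzero)
    from s(1) obtain r where r: "entry (cut N * X) p r \<noteq> 0" "entry (Lam - trunc N Lam) r s \<noteq> 0"
      by (rule entry_times_nonzero)
    have "entry X p r \<noteq> 0" using r(1) by (auto simp: cut_def entry_wshift_times split: if_splits)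
    from w1[OF this] have pr: "\<bar>p - r\<bar> \<le> w1" .
    have "entry Y s q \<noteq> 0" using s(2) by (auto simp: cut_def entry_times_wshift split: if_splits)
    from w3[OF this] have sq: "\<bar>s - q\<bar> \<le> w3" .
    have rs: "entry Lam r s \<noteq> 0" "r \<notin> window N \<or> s \<notin> window N"
      using r(2) by (auto simp: entry_trunc split: if_splits)
    from w2[OF rs(1)] have "\<bar>r - s\<bar> \<le> w2" .
    with pr sq have "\<bar>p - r\<bar> \<le> w" "\<bar>q - r\<bar> \<le> w" "\<bar>p - s\<bar> \<le> w" "\<bar>q - s\<bar> \<le> w"
      unfolding w_def by linarith+
    then show "corner K p q" using rs(2) corner_near N by blast
  qed
qed

text \<open>For one sufficiently large window, every occurrence of the action may be replaced by the action of
  the truncations; the bracket of the truncations is then the truncation of the bracket up to a matrix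
  that kills \<open>v\<close>, plus the cocycle.\<close>

lemma act_bracket:
  assumes X: "skew X" and Y: "skew Y"
  shows "act ((X * Lam * Y - Y * Lam * X) * Lam) v + sM (psi (X * Lam) (Y * Lam)) (\<rho> central v)
       = act (X * Lam) (act (Y * Lam) v) - act (Y * Lam) (act (X * Lam) v)"
proof -
  let ?C = "X * Lam * Y - Y * Lam * X"
  have C: "skew ?C" by (rule skew_bracket[OF X Y])
  obtain K where K: "tame K v" using all_tame by blast
  have "\<exists>N. (\<forall>u\<in>{v, act (Y * Lam) v}. \<rho> (emb (trunc N X * Lam)) u = act (X * Lam) u)
     \<and> (\<forall>u\<in>{v, act (X * Lam) v}. \<rho> (emb (trunc N Y * Lam)) u = act (Y * Lam) u)
     \<and> \<rho> (emb (trunc N ?C * Lam)) v = act (?C * Lam) v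
     \<and> psi (trunc N X * Lam) (trunc N Y * Lam) = psi (X * Lam) (Y * Lam)
     \<and> (\<forall>p q. entry (trunc N (X * Lam * Y) - trunc N X * Lam * trunc N Y) p q \<noteq> 0 \<longrightarrow> corner K p q)
     \<and> (\<forall>p q. entry (trunc N (Y * Lam * X) - trunc N Y * Lam * trunc N X) p q \<noteq> 0 \<longrightarrow> corner K p q)"
  proof -
    have ev: "(\<exists>N0::int. \<forall>N\<ge>N0. P N) \<longleftrightarrow> eventually P at_top" for P
      by (simp add: eventually_at_top_linorder)
    have "\<forall>\<^sub>F N in at_top. (\<forall>u\<in>{v, act (Y * Lam) v}. \<rho> (emb (trunc N X * Lam)) u = act (X * Lam) u)
     \<and> (\<forall>u\<in>{v, act (X * Lam) v}. \<rho> (emb (trunc N Y * Lam)) u = act (Y * Lam) u)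
     \<and> \<rho> (emb (trunc N ?C * Lam)) v = act (?C * Lam) v
     \<and> psi (trunc N X * Lam) (trunc N Y * Lam) = psi (X * Lam) (Y * Lam)
     \<and> (\<forall>p q. entry (trunc N (X * Lam * Y) - trunc N X * Lam * trunc N Y) p q \<noteq> 0 \<longrightarrow> corner K p q)
     \<and> (\<forall>p q. entry (trunc N (Y * Lam * X) - trunc N Y * Lam * trunc N X) p q \<noteq> 0 \<longrightarrow> corner K p q)"
      using act_eventually[OF X, unfolded ev] act_eventually[OF Y, unfolded ev] act_eventually[OF C, unfolded ev]
        psi_trunc_stable[unfolded ev] trunc_defect_corner[unfolded ev]
      by (intro eventually_conj eventually_ball_finite ballI) blast+
    then show ?thesis by (simp only: eventually_at_top_linorder) blast
  qed
  then obtain N where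
      NX: "\<And>u. u \<in> {v, act (Y * Lam) v} \<Longrightarrow> \<rho> (emb (trunc N X * Lam)) u = act (X * Lam) u"
    and NY: "\<And>u. u \<in> {v, act (X * Lam) v} \<Longrightarrow> \<rho> (emb (trunc N Y * Lam)) u = act (Y * Lam) u"
    and NC: "\<rho> (emb (trunc N ?C * Lam)) v = act (?C * Lam) v"
    and psi: "psi (trunc N X * Lam) (trunc N Y * Lam) = psi (X * Lam) (Y * Lam)"
    and c1: "\<And>p q. entry (trunc N (X * Lam * Y) - trunc N X * Lam * trunc N Y) p q \<noteq> 0 \<Longrightarrow> corner K p q"
    and c2: "\<And>p q. entry (trunc N (Y * Lam * X) - trunc N Y * Lam * trunc N X) p q \<noteq> 0 \<Longrightarrow> corner K p q"
    by blast
  let ?X = "trunc N X" and ?Y = "trunc N Y"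
  define E where "E = ?X * Lam * ?Y - ?Y * Lam * ?X"
  define D where "D = trunc N ?C - E"
  have E: "finite_band E" "skew E"
    unfolding E_def by (simp_all add: finite_band_diff finite_band_times_left finite_band_trunc skew_bracket skew_trunc X Y)
  have D: "finite_band D" "skew D"
    unfolding D_def by (simp_all add: finite_band_diff finite_band_trunc E skew_diff skew_trunc C)
  have "D = (trunc N (X * Lam * Y) - ?X * Lam * ?Y) - (trunc N (Y * Lam * X) - ?Y * Lam * ?X)"
    unfolding D_def E_def by (simp add: trunc_def algebra_simps)
  then have "corner K p q" if "entry D p q \<noteq> 0" for p q
    using that c1[of p q] c2[of p q] by (metis entry_minus diff_self)
  then have D0: "\<rho> (emb (D * Lam)) v = 0" by (intro rho_corner[OF D K])
  have "emb (trunc N ?C * Lam) = emb (D * Lam) + emb (E * Lam)"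
    unfolding D_def
    by (subst emb_add[symmetric]) (simp_all add: finite_band_times_right finite_band_diff finite_band_trunc E left_diff_distrib)
  then have CE: "act (?C * Lam) v = \<rho> (emb (E * Lam)) v"
    using NC D0 rho_add[OF emb_skew_check_alg[OF D] emb_skew_check_alg[OF E], of v] by simp
  have "check_bracket tr (emb (?X * Lam)) (emb (?Y * Lam)) = emb (E * Lam) + (0, psi (X * Lam) (Y * Lam))"
    unfolding E_def by (subst check_bracket_emb) (simp_all add: finite_band_times_right finite_band_trunc psi left_diff_distrib mult.assoc)
  then have h1: "\<rho> (emb (E * Lam) + (0, psi (X * Lam) (Y * Lam))) v
      = \<rho> (check_bracket tr (emb (?X * Lam)) (emb (?Y * Lam))) v"
    by (rule arg_cong[where f = "\<lambda>x. \<rho> x v", symmetric])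
  have h2: "\<rho> (check_bracket tr (emb (?X * Lam)) (emb (?Y * Lam))) v
      = act (X * Lam) (act (Y * Lam) v) - act (Y * Lam) (act (X * Lam) v)"
    by (simp add: rho_bracket emb_trunc_check_alg X Y NX NY)
  have h3: "\<rho> (emb (E * Lam) + (0, psi (X * Lam) (Y * Lam))) v
      = \<rho> (emb (E * Lam)) v + \<rho> (0, psi (X * Lam) (Y * Lam)) v"
    by (rule rho_add[OF emb_skew_check_alg[OF E] pair_check_alg])
  show ?thesis
    by (rule trans[OF _ trans[OF h1 h2]], rule trans[OF _ h3[symmetric]], rule arg_cong2[where f = "(+)"])
       (rule CE, rule rho_pair[symmetric])
qed

end



section \<open>Antidifferences of the symbols of differential operators\<close>

text \<open>The antidifference of \<open>x \<mapsto> falling x k\<close> that vanishes at 0.\<close>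

definition antidiff :: "complex \<Rightarrow> nat \<Rightarrow> complex" where
  "antidiff x k = falling x (Suc k) / of_nat (Suc k)"

lemma falling_0 [simp]: "falling x 0 = 1"
  by (simp add: falling_def)

lemma falling_Suc: "falling x (Suc k) = falling x k * (x - of_nat k)"
  by (simp add: falling_def)

lemma falling_Suc_shift: "falling (x + 1) (Suc k) = (x + 1) * falling x k"
  using falling_add[of "x + 1" 1 k] by (simp add: falling_Suc)

lemma antidiff_diff: "antidiff (x + 1) k - antidiff x k = falling x k"
proof -
  have "antidiff (x + 1) k - antidiff x k = ((1 + of_nat k) * falling x k) / (1 + of_nat k)"
    unfolding antidiff_def falling_Suc_shift falling_Suc[of x]
    by (simp add: diff_divide_distrib[symmetric] algebra_simps)
  then show ?thesis by (simp add: of_nat_Suc[symmetric] del: of_nat_Suc)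
qed

lemma antidiff_0: "antidiff 0 k = 0"
  unfolding antidiff_def falling_def by (auto simp: prod.lessThan_Suc_shift)

text \<open>As \<open>\<iota>\<close> may be half of an odd integer, identities between antidifferences cannot be proved by
  telescoping from 0.  They hold at all natural numbers and extend since both sides are
  polynomials.\<close>

definition polyfun :: "(complex \<Rightarrow> complex) \<Rightarrow> bool" where
  "polyfun f \<longleftrightarrow> (\<exists>p. \<forall>x. f x = poly p x)"

lemma polyfun_const: "polyfun (\<lambda>x. c)"
  unfolding polyfun_def by (intro exI[of _ "[:c:]"]) simp

lemma polyfun_id: "polyfun (\<lambda>x. x)"
  unfolding polyfun_def by (intro exI[of _ "[:0, 1:]"]) simp

lemma polyfun_add: "polyfun f \<Longrightarrow> polyfun g \<Longrightarrow> polyfun (\<lambda>x. f x + g x)"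
  unfolding polyfun_def by (metis poly_add)

lemma polyfun_diff: "polyfun f \<Longrightarrow> polyfun g \<Longrightarrow> polyfun (\<lambda>x. f x - g x)"
  unfolding polyfun_def by (metis poly_diff)

lemma polyfun_mult: "polyfun f \<Longrightarrow> polyfun g \<Longrightarrow> polyfun (\<lambda>x. f x * g x)"
  unfolding polyfun_def by (metis poly_mult)

lemma polyfun_sum: "(\<And>s. s \<in> S \<Longrightarrow> polyfun (f s)) \<Longrightarrow> polyfun (\<lambda>x. \<Sum>s\<in>S. f s x)"
  by (induction S rule: infinite_finite_induct) (auto intro: polyfun_const polyfun_add)

lemma polyfun_falling: "polyfun g \<Longrightarrow> polyfun (\<lambda>x. falling (g x) k)"
  unfolding falling_def
  by (induction k) (simp_all add: polyfun_const polyfun_mult polyfun_diff)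

lemma polyfun_antidiff: "polyfun g \<Longrightarrow> polyfun (\<lambda>x. antidiff (g x) k)"
  unfolding antidiff_def divide_inverse by (intro polyfun_mult polyfun_falling polyfun_const)

lemma polyfun_periodic:
  assumes "polyfun f" "\<And>x. f (x + 1) = f x"
  shows "f x = f 0"
proof -
  obtain p where p: "\<And>x. f x = poly p x" using assms(1) by (auto simp: polyfun_def)
  have nat: "f (of_nat k) = f 0" for k
  proof (induction k)
    case (Suc k)
    then show ?case using assms(2)[of "of_nat k"] by (simp add: add.commute)
  qed simp
  have "p - [:f 0:] = 0"
  proof (rule ccontr)
    assume "p - [:f 0:] \<noteq> 0"
    then have "finite {x. poly (p - [:f 0:]) x = 0}" by (rule poly_roots_finite)
    moreover have "range of_nat \<subseteq> {x. poly (p - [:f 0:]) x = 0}" using nat p by auto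
    ultimately have "finite (range (of_nat :: nat \<Rightarrow> complex))" by (rule rev_finite_subset)
    then show False by (simp add: finite_image_iff inj_of_nat)
  qed
  then show ?thesis using p[of x] by simp
qed

lemma polyfun_eqI:
  assumes "polyfun f" "polyfun g" "\<And>x. f (x + 1) - f x = g (x + 1) - g x" "f 0 = g 0"
  shows "f x = g x"
  using polyfun_periodic[OF polyfun_diff[OF assms(1,2)], of x] assms(3,4) by (simp add: algebra_simps)

text \<open>The antidifference, vanishing at 0, of the symbol of \<open>t^i\<^sub>1 \<partial>^j\<^sub>1 t^i\<^sub>2 \<partial>^j\<^sub>2\<close> for
  \<open>i\<^sub>1 + i\<^sub>2 = j\<^sub>1 + j\<^sub>2\<close>, that is of its eigenvalue on \<open>t^x\<close>; the summands come from the Leibniz rule.\<close>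

definition prod_antidiff :: "nat \<Rightarrow> int \<Rightarrow> nat \<Rightarrow> complex \<Rightarrow> complex" where
  "prod_antidiff j1 i2 j2 x = (\<Sum>s\<le>j1. of_nat (j1 choose s) * falling (of_int i2) s * antidiff x (j1 + j2 - s))"

lemma prod_antidiff_diff:
  "prod_antidiff j1 i2 j2 (x + 1) - prod_antidiff j1 i2 j2 x = falling x j2 * falling (x - of_nat j2 + of_int i2) j1"
  unfolding prod_antidiff_def falling_leibniz sum_subtractf[symmetric] right_diff_distrib[symmetric] antidiff_diff ..

lemma prod_antidiff_0: "prod_antidiff j1 i2 j2 0 = 0"
  by (simp add: prod_antidiff_def antidiff_0)

lemma polyfun_prod_antidiff: "polyfun g \<Longrightarrow> polyfun (\<lambda>x. prod_antidiff j1 i2 j2 (g x))"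
  unfolding prod_antidiff_def by (intro polyfun_sum polyfun_mult polyfun_const polyfun_antidiff)

lemma prod_antidiff_telescope:
  "prod_antidiff j1 i2 j2 (x + of_nat k) - prod_antidiff j1 i2 j2 x
     = (\<Sum>r<k. falling (x + of_nat r) j2 * falling (x + of_nat r - of_nat j2 + of_int i2) j1)"
proof (induction k)
  case (Suc k)
  show ?case
    using prod_antidiff_diff[of j1 i2 j2 "x + of_nat k"] Suc by (simp add: algebra_simps)
qed simp

text \<open>For operators shifting by \<open>s\<close> and \<open>-s\<close>, the symbols of the two products agree up to translation by
  \<open>s\<close>.\<close>

lemma prod_antidiff_swap:
  assumes "i1 + i2 = int j1 + int j2"
  shows "prod_antidiff j2 i1 j1 x = prod_antidiff j1 i2 j2 (x + of_int (i1 - int j1)) - prod_antidiff j1 i2 j2 (of_int (i1 - int j1))"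
proof (rule polyfun_eqI[where x = x])
  fix x :: complex
  let ?s = "of_int (i1 - int j1) :: complex"
  have "i2 = int j2 - (i1 - int j1)" using assms by simp
  then have i2: "of_int i2 = of_nat j2 - ?s" by (simp only: of_int_diff of_int_of_nat_eq)
  have "prod_antidiff j1 i2 j2 (x + 1 + ?s) - prod_antidiff j1 i2 j2 (x + ?s) = falling (x + ?s) j2 * falling x j1"
    using prod_antidiff_diff[of j1 i2 j2 "x + ?s"] unfolding i2 by (simp add: add_ac)
  moreover have "prod_antidiff j2 i1 j1 (x + 1) - prod_antidiff j2 i1 j1 x = falling x j1 * falling (x + ?s) j2"
    using prod_antidiff_diff[of j2 i1 j1 x] by (simp add: algebra_simps)
  ultimately show "prod_antidiff j2 i1 j1 (x + 1) - prod_antidiff j2 i1 j1 x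
    = prod_antidiff j1 i2 j2 (x + 1 + ?s) - prod_antidiff j1 i2 j2 ?s - (prod_antidiff j1 i2 j2 (x + ?s) - prod_antidiff j1 i2 j2 ?s)"
    by simp
qed (simp_all add: prod_antidiff_0 polyfun_prod_antidiff polyfun_diff polyfun_add polyfun_id polyfun_const)

text \<open>Both sides count the subsets of size \<open>a + b + 1\<close> of a set with \<open>s + b\<close> elements, by the position of
  the element that comes after the first \<open>a\<close>.\<close>

lemma choose_convolution:
  "(\<Sum>k<s. (k choose a) * ((s - Suc k + b) choose b)) = (s + b) choose (a + b + 1)"
proof (induction "s + b" arbitrary: s b)
  case 0
  then show ?case by simp
next
  case (Suc N)
  show ?case
  proof (cases s)
    case 0
    then show ?thesis by simp
  next
    case s: (Suc s')
    show ?thesis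
    proof (cases b)
      case 0
      have "(\<Sum>k<s. k choose a) = s choose Suc a"
        unfolding s lessThan_Suc_atMost by (rule sum_choose_upper[unfolded atLeast0AtMost])
      then show ?thesis by (simp add: 0)
    next
      case b: (Suc b')
      have "(\<Sum>k<s. (k choose a) * ((s - Suc k + b) choose b))
          = (\<Sum>k<s. (k choose a) * ((s - Suc k + b') choose b) + (k choose a) * ((s - Suc k + b') choose b'))"
        by (intro sum.cong refl) (simp add: b add_mult_distrib2)
      also have "\<dots> = (\<Sum>k<s. (k choose a) * ((s - Suc k + b') choose b)) + (s + b' choose (a + b' + 1))"
        unfolding sum.distrib using Suc.hyps(1)[of s b'] Suc.hyps(2) b by simp
      also have "(\<Sum>k<s. (k choose a) * ((s - Suc k + b') choose b)) = (\<Sum>k<s'. (k choose a) * ((s' - Suc k + b) choose b))"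
        unfolding s by (simp add: b Suc_diff_Suc)
      also have "\<dots> = (s' + b) choose (a + b + 1)"
        using Suc.hyps(1)[of s' b] Suc.hyps(2) s by simp
      finally show ?thesis by (simp add: s b)
    qed
  qed
qed

lemma prod_antidiff_at_nat:
  assumes "i1 = int j1 + int s" "i2 = int j2 - int s"
  shows "prod_antidiff j1 i2 j2 (of_nat s) = (-1) ^ j1 * fact j1 * fact j2 * (of_int i1 gchoose (j1 + j2 + 1))"
proof -
  have summand: "falling (of_nat r) j2 * falling (of_nat r - of_nat j2 + of_int i2) j1
      = (-1) ^ j1 * fact j1 * fact j2 * of_nat ((r choose j2) * ((s - Suc r + j1) choose j1))" if "r < s" for r
  proof -
    have "of_nat r - of_nat j2 + (of_int i2 :: complex) = of_nat j1 - 1 - of_nat (s - Suc r + j1)"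
      using that by (simp add: assms(2) of_nat_diff)
    then have "falling (of_nat r - of_nat j2 + of_int i2) j1 = (-1) ^ j1 * falling (of_nat (s - Suc r + j1)) j1"
      by (simp only: falling_reflect)
    then show ?thesis by (simp add: falling_gbinomial binomial_gbinomial)
  qed
  have "prod_antidiff j1 i2 j2 (of_nat s) = (\<Sum>r<s. falling (of_nat r) j2 * falling (of_nat r - of_nat j2 + of_int i2) j1)"
    using prod_antidiff_telescope[of j1 i2 j2 0 s] by (simp add: prod_antidiff_0)
  also have "\<dots> = (-1) ^ j1 * fact j1 * fact j2 * of_nat (\<Sum>r<s. (r choose j2) * ((s - Suc r + j1) choose j1))"
    unfolding of_nat_sum sum_distrib_left using summand by (intro sum.cong) auto
  also have "\<dots> = (-1) ^ j1 * fact j1 * fact j2 * (of_int i1 gchoose (j1 + j2 + 1))"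
    unfolding choose_convolution assms(1) by (simp add: binomial_gbinomial add_ac)
  finally show ?thesis .
qed

text \<open>The cocycle of the algebra of differential operators is the value at \<open>s = i\<^sub>1 - j\<^sub>1\<close> of the
  antidifference.  For \<open>s \<ge> 0\<close> the telescoping sum is a convolution of binomial coefficients; the case
  \<open>s < 0\<close> follows by exchanging the operators, as both sides change sign.\<close>

lemma prod_antidiff_at:
  assumes "i1 + i2 = int j1 + int j2"
  shows "prod_antidiff j1 i2 j2 (of_int (i1 - int j1)) = (-1) ^ j1 * fact j1 * fact j2 * (of_int i1 gchoose (j1 + j2 + 1))"
proof (cases "i1 \<ge> int j1")
  case True
  then obtain s where "i1 = int j1 + int s" by (metis zle_iff_zadd)
  moreover from this have "i2 = int j2 - int s" using assms by simp
  ultimately show ?thesis using prod_antidiff_at_nat[of i1 j1 s i2 j2] by simp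
next
  case False
  define s where "s = nat (int j1 - i1)"
  have s: "i2 = int j2 + int s" "i1 = int j1 - int s" using False assms by (auto simp: s_def)
  have "prod_antidiff j1 i2 j2 (of_int (i1 - int j1)) = - prod_antidiff j2 i1 j1 (of_nat s)"
    using prod_antidiff_swap[OF assms, of "of_nat s"] by (simp add: s(2) prod_antidiff_0)
  also have "\<dots> = - ((-1) ^ j2 * fact j2 * fact j1 * (of_int i2 gchoose (j1 + j2 + 1)))"
    using prod_antidiff_at_nat[OF s] by (simp add: add.commute)
  also have "(of_int i2 gchoose (j1 + j2 + 1)) = (-1) ^ (j1 + j2 + 1) * (of_int i1 gchoose (j1 + j2 + 1) :: complex)"
    using gbinomial_negated_upper[of "of_int i2 :: complex" "j1 + j2 + 1"]
    by (simp add: s(2) s(1) add_ac)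
  also have "- ((-1) ^ j2 * fact j2 * fact j1 * ((-1) ^ (j1 + j2 + 1) * (of_int i1 gchoose (j1 + j2 + 1))))
      = (-1) ^ j1 * fact j1 * fact j2 * (of_int i1 gchoose (j1 + j2 + 1) :: complex)"
    by (simp add: power_add)
  finally show ?thesis .
qed

text \<open>The symbol of \<open>\<partial>^r t^(r+l) \<partial>^l\<close> at \<open>x\<close> is \<open>(x + r) (x + r - 1) \<dots> (x - l + 1)\<close>.\<close>

lemma prod_antidiff_normal: "prod_antidiff r (int r + int l) l x = antidiff (x + of_nat r) (r + l)"
proof (rule polyfun_eqI[where x = x])
  fix x :: complex
  have "antidiff (x + 1 + of_nat r) (r + l) - antidiff (x + of_nat r) (r + l) = falling (x + of_nat r) (r + l)"
    using antidiff_diff[of "x + of_nat r" "r + l"] by (simp add: add_ac)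
  then show "prod_antidiff r (int r + int l) l (x + 1) - prod_antidiff r (int r + int l) l x
      = antidiff (x + 1 + of_nat r) (r + l) - antidiff (x + of_nat r) (r + l)"
    by (simp add: prod_antidiff_diff falling_add)
next
  have "falling (of_nat r :: complex) (Suc (r + l)) = 0"
    unfolding falling_def by (rule prod_zero) auto
  then show "prod_antidiff r (int r + int l) l 0 = antidiff (0 + of_nat r) (r + l)"
    by (simp add: prod_antidiff_0 antidiff_def)
qed (intro polyfun_prod_antidiff polyfun_antidiff polyfun_add polyfun_id polyfun_const)+

section \<open>Closed form of the constants in the central correction\<close>

lemma im_series_eq: "(fps_const fps_X - fps_X) * im_series \<iota> = im_rhs \<iota>"
  unfolding im_series_def by (rule theI'[OF im_series_ex1])

lemma im_coeff_0: "im_coeff \<iota> 0 l = - (of_rat \<iota> gchoose Suc l)"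
proof -
  have "fps_nth (fps_nth ((fps_const fps_X - fps_X) * im_series \<iota>) (Suc l)) 0 = of_rat \<iota> gchoose Suc l"
    unfolding im_series_eq im_rhs_nth by simp
  then show ?thesis by (simp add: left_diff_distrib im_coeff_def equation_minus_iff)
qed

text \<open>Comparison of coefficients in the equation that defines the series, after multiplication by
  \<open>x - y\<close>.\<close>

lemma im_coeff_Suc:
  "im_coeff \<iota> (Suc r) l = im_coeff \<iota> r (Suc l) - (of_rat (- \<iota>) gchoose Suc r) * (of_rat \<iota> gchoose Suc l)"
proof -
  have "fps_nth (fps_nth ((fps_const fps_X - fps_X) * im_series \<iota>) (Suc l)) (Suc r)
      = (of_rat (- \<iota>) gchoose Suc r) * (of_rat \<iota> gchoose Suc l)"
    unfolding im_series_eq im_rhs_nth by simp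
  then show ?thesis by (simp add: left_diff_distrib im_coeff_def algebra_simps)
qed

lemma fact_gbinomial_Suc: "fact l * (z gchoose Suc l) = antidiff z l"
proof -
  have "falling z (Suc l) = of_nat (Suc l) * (fact l * (z gchoose Suc l))"
    by (simp only: falling_gbinomial fact_Suc of_nat_mult mult.assoc)
  then show ?thesis unfolding antidiff_def by (simp del: of_nat_Suc)
qed

text \<open>Induction on \<open>r\<close>: after division by the common factor
  \<open>W = (\<iota> + r) (\<iota> + r - 1) \<dots> (\<iota> - l)\<close> the recursion is the identity
  \<open>(r + l + 2) \<iota> - (r + 1) (\<iota> - l - 1) = (\<iota> + r + 1) (l + 1)\<close>.\<close>

lemma im_coeff_closed:
  "fact r * fact l * im_coeff \<iota> r l = - ((-1) ^ r * antidiff (of_rat \<iota> + of_nat r) (r + l))"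
proof (induction r arbitrary: l)
  case 0
  show ?case by (simp add: im_coeff_0 fact_gbinomial_Suc)
next
  case (Suc r)
  define z :: complex where "z = of_rat \<iota>"
  define W where "W = falling (z + of_nat r) (r + Suc l)"
  have W: "W = falling (z + of_nat r) r * falling z (Suc l)"
    unfolding W_def falling_add by simp
  have p1: "antidiff (z + of_nat r) (r + Suc l) = W * (z - of_nat l - 1) / of_nat (r + l + 2)"
    unfolding antidiff_def falling_Suc W_def by (simp add: algebra_simps)
  have p2: "antidiff (z + of_nat (Suc r)) (Suc r + l) = (z + of_nat r + 1) * W / of_nat (r + l + 2)"
    using falling_Suc_shift[of "z + of_nat r" "r + Suc l"] unfolding antidiff_def W_def by (simp add: algebra_simps)
  have f: "falling (- z) (Suc r) = (-1) ^ Suc r * (falling (z + of_nat r) r * z)"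
  proof -
    have "falling (of_nat (Suc r) - 1 - (- z)) (Suc r) = (-1) ^ Suc r * falling (- z) (Suc r)"
      by (rule falling_reflect)
    then have "(-1) ^ Suc r * falling (z + of_nat r) (Suc r) = (-1) ^ Suc r * ((-1) ^ Suc r * falling (- z) (Suc r))"
      by (simp add: add.commute)
    also have "\<dots> = falling (- z) (Suc r)" by (simp add: power_mult_distrib[symmetric] mult.assoc[symmetric])
    finally show ?thesis by (simp add: falling_Suc)
  qed
  have g1: "fact (Suc r) * ((- z) gchoose Suc r) = falling (- z) (Suc r)"
    by (simp only: falling_gbinomial)
  have g2: "fact l * (z gchoose Suc l) = falling z (Suc l) / of_nat (Suc l)"
    unfolding fact_gbinomial_Suc antidiff_def ..
  have IH: "fact r * fact l * im_coeff \<iota> r (Suc l) = - ((-1) ^ r * antidiff (z + of_nat r) (r + Suc l)) / of_nat (Suc l)"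
  proof -
    have "of_nat (Suc l) * (fact r * fact l * im_coeff \<iota> r (Suc l)) = fact r * fact (Suc l) * im_coeff \<iota> r (Suc l)"
      by (simp add: mult_ac del: of_nat_Suc)
    also have "\<dots> = - ((-1) ^ r * antidiff (z + of_nat r) (r + Suc l))"
      unfolding z_def by (rule Suc)
    finally show ?thesis
      by (metis nonzero_mult_div_cancel_left of_nat_eq_0_iff nat.distinct(1))
  qed
  have "fact (Suc r) * fact l * im_coeff \<iota> (Suc r) l
      = of_nat (Suc r) * (fact r * fact l * im_coeff \<iota> r (Suc l))
        - (fact (Suc r) * ((- z) gchoose Suc r)) * (fact l * (z gchoose Suc l))"
    unfolding im_coeff_Suc z_def by (simp add: of_rat_minus algebra_simps)
  also have "\<dots> = (-1) ^ r * (of_nat (Suc r) * (- antidiff (z + of_nat r) (r + Suc l)) / of_nat (Suc l) + z * W / of_nat (Suc l))"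
    unfolding IH g1 g2 f W divide_inverse by (simp add: algebra_simps del: of_nat_Suc)
  also have "of_nat (Suc r) * (- antidiff (z + of_nat r) (r + Suc l)) / of_nat (Suc l) + z * W / of_nat (Suc l)
      = antidiff (z + of_nat (Suc r)) (Suc r + l)"
  proof -
    have nz: "(of_nat (Suc l) :: complex) \<noteq> 0" "(of_nat (r + l + 2) :: complex) \<noteq> 0"
      by (simp_all only: of_nat_eq_0_iff)
    have K: "(of_nat (r + l + 2) :: complex) = of_nat r + of_nat l + 2" by simp
    have "W * (of_nat (Suc r) * - (z - of_nat l - 1) + of_nat (r + l + 2) * z) = W * ((z + of_nat r + 1) * of_nat (Suc l))"
      unfolding K by (simp add: algebra_simps)
    then show ?thesis
      unfolding p1 p2 using nz by (simp add: divide_simps del: of_nat_Suc of_nat_add) (simp add: algebra_simps)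
  qed
  finally show ?case by (simp add: z_def)
qed



context twisted_bands
begin

section \<open>Differential operators as bands\<close>

text \<open>The matrix of \<open>a \<otimes> t^i \<partial>^j\<close>.\<close>

definition opmat :: "'a \<Rightarrow> int \<Rightarrow> nat \<Rightarrow> 'a band" where
  "opmat a i j = wshift (i - int j) (\<lambda>q. sA (falling (expo q) j) a)"

lemma opmat_add: "opmat (a + b) i j = opmat a i j + opmat b i j"
  unfolding opmat_def wshift_add scale_right_distrib ..

lemma opmat_0 [simp]: "opmat 0 i j = 0"
  by (simp add: opmat_def)

lemma opmat_scale: "opmat (sA c a) i j = scl c (opmat a i j)"
  by (rule band_eqI) (simp add: opmat_def entry_wshift mult.commute)

definition Phi :: "((int \<times> nat) \<Rightarrow>\<^sub>0 'a) \<Rightarrow> 'a band" where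
  "Phi X = (\<Sum>p\<in>Poly_Mapping.keys X. opmat (Poly_Mapping.lookup X p) (fst p) (snd p))"

lemma Phi_add: "Phi (X + Y) = Phi X + Phi Y"
  unfolding Phi_def by (rule sum_keys_add) (simp_all add: opmat_add)

lemma Phi_0 [simp]: "Phi 0 = 0"
  by (simp add: Phi_def)

lemma Phi_diff: "Phi (X - Y) = Phi X - Phi Y"
  using Phi_add[of "X - Y" Y] by simp

lemma Phi_sum: "Phi (\<Sum>x\<in>S. f x) = (\<Sum>x\<in>S. Phi (f x))"
  by (induction S rule: infinite_finite_induct) (simp_all add: Phi_add)

lemma Phi_single: "Phi (Poly_Mapping.single (i, j) a) = opmat a i j"
  by (cases "a = 0") (simp_all add: Phi_def)

lemma lookup_map_scale: "Poly_Mapping.lookup (Poly_Mapping.map (sA c) X) k = sA c (Poly_Mapping.lookup X k)"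
  by (simp add: Poly_Mapping.map.rep_eq when_def)

lemma Phi_scale: "Phi (Poly_Mapping.map (sA c) X) = scl c (Phi X)"
proof -
  have "Poly_Mapping.keys (Poly_Mapping.map (sA c) X) \<subseteq> Poly_Mapping.keys X"
    by (auto simp: in_keys_iff lookup_map_scale)
  then have "Phi (Poly_Mapping.map (sA c) X)
      = (\<Sum>p\<in>Poly_Mapping.keys X. opmat (Poly_Mapping.lookup (Poly_Mapping.map (sA c) X) p) (fst p) (snd p))"
    unfolding Phi_def by (intro sum_keys_superset[where g = "\<lambda>a p. opmat a (fst p) (snd p)"]) simp_all
  then show ?thesis by (simp add: lookup_map_scale opmat_scale Phi_def scl_def sum_distrib_left)
qed

text \<open>The element \<open>a \<otimes> t^i \<partial>^j\<close>.\<close>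

definition hmon :: "'a \<Rightarrow> int \<Rightarrow> nat \<Rightarrow> 'a hatA" where
  "hmon a i j = (Poly_Mapping.single (i, j) a, 0)"

lemma tens_dop_mon: "tens sA a (dop_mon i j) = hmon a i j"
  by (auto simp: tens_def hmon_def dop_mon_def Poly_Mapping.map.rep_eq lookup_single when_def
        intro!: poly_mapping_eqI)

lemma pair_sum: "(\<Sum>x\<in>S. (f x, 0)) = (\<Sum>x\<in>S. f x, 0 :: complex)"
  by (induction S rule: infinite_finite_induct) (simp_all add: zero_prod_def)

lemma tens_mult:
  assumes "c \<noteq> 0"
  shows "tens sA a (dop_mult (Poly_Mapping.single (i1, j1) c) (dop_mon i2 j2))
    = (\<Sum>s\<le>j1. hmon (sA (c * (of_nat (j1 choose s) * falling (of_int i2) s)) a) (i1 + i2 - int s) (j1 + j2 - s))"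
proof -
  let ?D = "dop_mon_mult (i1, j1) (i2, j2)"
  have "dop_mult (Poly_Mapping.single (i1, j1) c) (dop_mon i2 j2) = Poly_Mapping.map ((*) c) ?D"
    using assms by (simp add: dop_mult_def dop_mon_def)
  moreover have "Poly_Mapping.map (\<lambda>d. sA d a) (Poly_Mapping.map ((*) c) ?D)
      = (\<Sum>s\<le>j1. Poly_Mapping.single (i1 + i2 - int s, j1 + j2 - s) (sA (c * (of_nat (j1 choose s) * falling (of_int i2) s)) a))"
  proof (rule poly_mapping_eqI)
    fix k
    have "Poly_Mapping.lookup (Poly_Mapping.map (\<lambda>d. sA d a) (Poly_Mapping.map ((*) c) ?D)) k
        = sA (c * Poly_Mapping.lookup ?D k) a"
      by (simp add: Poly_Mapping.map.rep_eq when_def)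
    also have "\<dots> = (\<Sum>s\<le>j1. sA (c * Poly_Mapping.lookup (Poly_Mapping.single (i1 + i2 - int s, j1 + j2 - s)
        (of_nat (j1 choose s) * falling (of_int i2) s)) k) a)"
      unfolding dop_mon_mult_def by (simp only: prod.case lookup_sum sum_distrib_left scale_sum_left)
    also have "\<dots> = Poly_Mapping.lookup (\<Sum>s\<le>j1. Poly_Mapping.single (i1 + i2 - int s, j1 + j2 - s)
        (sA (c * (of_nat (j1 choose s) * falling (of_int i2) s)) a)) k"
      unfolding lookup_sum by (intro sum.cong refl) (simp add: lookup_single when_def)
    finally show "Poly_Mapping.lookup (Poly_Mapping.map (\<lambda>d. sA d a) (Poly_Mapping.map ((*) c) ?D)) k
      = Poly_Mapping.lookup (\<Sum>s\<le>j1. Poly_Mapping.single (i1 + i2 - int s, j1 + j2 - s)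
        (sA (c * (of_nat (j1 choose s) * falling (of_int i2) s)) a)) k" .
  qed
  ultimately show ?thesis unfolding tens_def hmon_def pair_sum by simp
qed

lemma opmat_sum_leibniz:
  "(\<Sum>s\<le>j1. opmat (sA (c * (of_nat (j1 choose s) * falling (of_int i2) s)) a) (i1 + i2 - int s) (j1 + j2 - s))
    = wshift (i1 + i2 - int (j1 + j2)) (\<lambda>q. sA (c * (falling (expo q) j2 * falling (expo q - of_nat j2 + of_int i2) j1)) a)"
proof -
  have "opmat (sA (c * (of_nat (j1 choose s) * falling (of_int i2) s)) a) (i1 + i2 - int s) (j1 + j2 - s)
     = wshift (i1 + i2 - int (j1 + j2)) (\<lambda>q. sA (c * (of_nat (j1 choose s) * falling (of_int i2) s * falling (expo q) (j1 + j2 - s))) a)"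
    if "s \<le> j1" for s
    unfolding opmat_def
  proof (intro arg_cong2[where f = wshift] ext)
    show "i1 + i2 - int s - int (j1 + j2 - s) = i1 + i2 - int (j1 + j2)" using that by simp
  qed (simp only: scale_scale mult_ac)
  then have "(\<Sum>s\<le>j1. opmat (sA (c * (of_nat (j1 choose s) * falling (of_int i2) s)) a) (i1 + i2 - int s) (j1 + j2 - s))
    = (\<Sum>s\<le>j1. wshift (i1 + i2 - int (j1 + j2)) (\<lambda>q. sA (c * (of_nat (j1 choose s) * falling (of_int i2) s * falling (expo q) (j1 + j2 - s))) a))"
    by (intro sum.cong) auto
  then show ?thesis
    unfolding wshift_sum falling_leibniz sum_distrib_left scale_sum_left .
qed

lemma opmat_times:
  "opmat a i1 j1 * opmat b i2 j2
    = wshift (i1 + i2 - int (j1 + j2)) (\<lambda>q. sA (falling (expo q) j2 * falling (expo q - of_nat j2 + of_int i2) j1) (a * b))"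
  unfolding opmat_def wshift_times
  by (intro arg_cong2[where f = wshift] ext) (simp_all add: scale_mult algebra_simps)

lemma Phi_tens_mult:
  "Phi (fst (tens sA (a * b) (dop_mult (dop_mon i1 j1) (dop_mon i2 j2)))) = opmat a i1 j1 * opmat b i2 j2"
  unfolding dop_mon_def[of i1] tens_mult[OF one_neq_zero] opmat_times
  using opmat_sum_leibniz[where c = 1 and ?j1.0 = j1 and ?i2.0 = i2 and a = "a * b" and ?i1.0 = i1 and ?j2.0 = j2]
  by (simp add: hmon_def pair_sum Phi_sum Phi_single)

text \<open>The scalar by which \<open>\<sigma>\<close> corrects the action of the matrix: the coefficient of \<open>\<kappa>\<close> plus a functional
  that takes \<open>a \<otimes> t^k \<partial>^k\<close> to minus the antidifference of its symbol at \<open>\<iota>\<close>.  The functional makes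
  the two cocycles cohomologous.\<close>

definition central_part :: "'a hatA \<Rightarrow> complex" where
  "central_part H = snd H + (\<Sum>p\<in>Poly_Mapping.keys (fst H).
     if fst p = int (snd p) then - antidiff (of_rat \<iota>) (snd p) * tr (Poly_Mapping.lookup (fst H) p) else 0)"

lemma central_part_add: "central_part (H + K) = central_part H + central_part K"
proof -
  let ?g = "\<lambda>a p. if fst p = int (snd p) then - antidiff (of_rat \<iota>) (snd p) * tr a else 0"
  have "(\<Sum>p\<in>Poly_Mapping.keys (fst H + fst K). ?g (Poly_Mapping.lookup (fst H + fst K) p) p)
     = (\<Sum>p\<in>Poly_Mapping.keys (fst H). ?g (Poly_Mapping.lookup (fst H) p) p) + (\<Sum>p\<in>Poly_Mapping.keys (fst K). ?g (Poly_Mapping.lookup (fst K) p) p)"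
    by (rule sum_keys_add) (auto simp: trl.zero trl.add distrib_left)
  then show ?thesis unfolding central_part_def fst_add snd_add by (simp only: add_ac)
qed

lemma central_part_0 [simp]: "central_part 0 = 0"
  by (simp add: central_part_def)

lemma central_part_diff: "central_part (H - K) = central_part H - central_part K"
  using central_part_add[of "H - K" K] by simp

lemma central_part_sum: "central_part (\<Sum>x\<in>S. f x) = (\<Sum>x\<in>S. central_part (f x))"
  by (induction S rule: infinite_finite_induct) (simp_all add: central_part_add)

lemma central_part_scale: "central_part (ext_scale sA c H) = c * central_part H"
proof -
  let ?g = "\<lambda>a p. if fst p = int (snd p) then - antidiff (of_rat \<iota>) (snd p) * tr a else 0"
  let ?X = "Poly_Mapping.map (sA c) (fst H)"
  have "Poly_Mapping.keys ?X \<subseteq> Poly_Mapping.keys (fst H)"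
    by (auto simp: in_keys_iff lookup_map_scale)
  then have "(\<Sum>p\<in>Poly_Mapping.keys ?X. ?g (Poly_Mapping.lookup ?X p) p)
      = (\<Sum>p\<in>Poly_Mapping.keys (fst H). ?g (Poly_Mapping.lookup ?X p) p)"
    by (intro sum_keys_superset) (simp_all add: trl.zero)
  also have "\<dots> = c * (\<Sum>p\<in>Poly_Mapping.keys (fst H). ?g (Poly_Mapping.lookup (fst H) p) p)"
    unfolding sum_distrib_left by (intro sum.cong refl) (simp add: lookup_map_scale trl.scale)
  finally show ?thesis unfolding central_part_def ext_scale_def fst_conv snd_conv by (simp only: distrib_left)
qed

lemma central_part_pair [simp]: "central_part (0, c) = c"
  by (simp add: central_part_def)

lemma central_part_hmon: "central_part (hmon a i j) = (if i = int j then - antidiff (of_rat \<iota>) j * tr a else 0)"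
  by (cases "a = 0") (simp_all add: central_part_def hmon_def trl.zero)

lemma central_part_tens_mult:
  assumes "c \<noteq> 0"
  shows "central_part (tens sA a (dop_mult (Poly_Mapping.single (i1, j1) c) (dop_mon i2 j2)))
    = (if i1 + i2 = int j1 + int j2 then - c * prod_antidiff j1 i2 j2 (of_rat \<iota>) * tr a else 0)"
proof -
  have "central_part (tens sA a (dop_mult (Poly_Mapping.single (i1, j1) c) (dop_mon i2 j2)))
    = (\<Sum>s\<le>j1. if i1 + i2 = int j1 + int j2 then - c * (of_nat (j1 choose s) * falling (of_int i2) s * antidiff (of_rat \<iota>) (j1 + j2 - s)) * tr a else 0)"
    unfolding tens_mult[OF assms] central_part_sum central_part_hmon
    by (intro sum.cong refl) (auto simp: trl.scale of_nat_diff)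
  then show ?thesis
    by (simp add: prod_antidiff_def sum_distrib_left sum_distrib_right sum_negf)
qed

text \<open>If the first operator shifts by \<open>s \<ge> 0\<close>, the entries that cross 0 are in the columns
  \<open>-s, \<dots>, -1\<close>, and the cocycle is the sum of the symbol of the product over the exponents
  \<open>\<iota>, \<dots>, \<iota> + s - 1\<close>, which telescopes; for \<open>s < 0\<close> the signs are reversed.\<close>

lemma psi_opmat:
  "psi (opmat a i1 j1) (opmat b i2 j2) = (if i1 + i2 = int j1 + int j2 then
     (prod_antidiff j1 i2 j2 (of_rat \<iota> + of_int (i1 - int j1)) - prod_antidiff j1 i2 j2 (of_rat \<iota>)) * tr (a * b) else 0)"
proof (cases "i1 + i2 = int j1 + int j2")
  case False
  then show ?thesis
    by (subst psi_eq[of "{}"]) (auto simp: opmat_def entry_wshift split: if_splits)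
next
  case True
  define s where "s = i1 - int j1"
  have s2: "i2 - int j2 = - s" using True by (simp add: s_def)
  define z :: complex where "z = of_rat \<iota>"
  define d where "d x = falling x j2 * falling (x - of_nat j2 + of_int i2) j1" for x
  have i2: "(of_int i2 :: complex) = of_nat j2 - of_int s"
  proof -
    have "i2 = int j2 - s" using s2 by simp
    then show ?thesis by (simp only: of_int_diff of_int_of_nat_eq)
  qed
  have entries: "jump (q + s) q * tr (entry (opmat a i1 j1) (q + s) q * entry (opmat b i2 j2) q (q + s))
      = jump (q + s) q * d (z + of_int (q + s)) * tr (a * b)" for q
  proof -
    have f1: "entry (opmat a i1 j1) (q + s) q = sA (falling (expo q) j1) a"
      by (simp add: opmat_def entry_wshift s_def)
    have f2: "entry (opmat b i2 j2) q (q + s) = sA (falling (expo (q + s)) j2) b"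
      by (simp add: opmat_def entry_wshift s2)
    have "z + of_int (q + s) = expo (q + s)" by (simp add: z_def)
    moreover have "expo (q + s) - of_nat j2 + of_int i2 = expo q" by (simp add: i2)
    ultimately have d: "d (z + of_int (q + s)) = falling (expo (q + s)) j2 * falling (expo q) j1"
      by (simp only: d_def)
    show ?thesis
      unfolding f1 f2 d scale_mult trl.scale by (simp only: mult_ac)
  qed
  have psi: "psi (opmat a i1 j1) (opmat b i2 j2) = (\<Sum>q\<in>T. jump (q + s) q * d (z + of_int (q + s)) * tr (a * b))"
    if T: "finite T" "\<And>q. jump (q + s) q \<noteq> 0 \<Longrightarrow> q \<in> T" for T
  proof -
    have "psi (opmat a i1 j1) (opmat b i2 j2)
      = (\<Sum>(p, q)\<in>(\<lambda>q. (q + s, q)) ` T. jump p q * tr (entry (opmat a i1 j1) p q * entry (opmat b i2 j2) q p))"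
    proof (rule psi_eq)
      fix p q assume j: "jump p q \<noteq> 0" and "entry (opmat a i1 j1) p q \<noteq> 0"
      then have "p = q + s" by (auto simp: opmat_def entry_wshift s_def split: if_splits)
      then show "(p, q) \<in> (\<lambda>q. (q + s, q)) ` T" using T(2) j by blast
    qed (simp add: T)
    also have "\<dots> = (\<Sum>q\<in>T. jump (q + s) q * tr (entry (opmat a i1 j1) (q + s) q * entry (opmat b i2 j2) q (q + s)))"
      by (subst sum.reindex) (auto simp: inj_on_def)
    finally show ?thesis unfolding entries .
  qed
  have tele: "prod_antidiff j1 i2 j2 (x + of_nat k) - prod_antidiff j1 i2 j2 x = (\<Sum>r<k. d (x + of_nat r))" for x k
    unfolding prod_antidiff_telescope d_def ..
  have "psi (opmat a i1 j1) (opmat b i2 j2) = (prod_antidiff j1 i2 j2 (z + of_int s) - prod_antidiff j1 i2 j2 z) * tr (a * b)"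
  proof (cases "s \<ge> 0")
    case True
    then obtain k where k: "s = int k" by (metis nonneg_int_cases)
    have "psi (opmat a i1 j1) (opmat b i2 j2) = (\<Sum>q\<in>(\<lambda>r. int r - s) ` {..<k}. jump (q + s) q * d (z + of_int (q + s)) * tr (a * b))"
    proof (rule psi)
      fix q assume "jump (q + s) q \<noteq> 0"
      then have "0 \<le> q + s" "q < 0" using k by (auto simp: jump_def split: if_splits)
      then show "q \<in> (\<lambda>r. int r - s) ` {..<k}" using k by (intro image_eqI[of _ _ "nat (q + s)"]) auto
    qed simp
    also have "\<dots> = (\<Sum>r<k. d (z + of_nat r) * tr (a * b))"
      by (subst sum.reindex) (auto simp: inj_on_def jump_def k intro!: sum.cong)
    finally show ?thesis unfolding k sum_distrib_right[symmetric] tele[symmetric] by simp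
  next
    case False
    then obtain k where k: "s = - int k" by (metis int_cases2 nonneg_int_cases neg_0_le_iff_le of_nat_0_le_iff)
    have "psi (opmat a i1 j1) (opmat b i2 j2) = (\<Sum>q\<in>int ` {..<k}. jump (q + s) q * d (z + of_int (q + s)) * tr (a * b))"
    proof (rule psi)
      fix q assume "jump (q + s) q \<noteq> 0"
      then have "q + s < 0" "0 \<le> q" using k by (auto simp: jump_def split: if_splits)
      then show "q \<in> int ` {..<k}" using k by (intro image_eqI[of _ _ "nat q"]) auto
    qed simp
    also have "\<dots> = (\<Sum>r<k. - (d (z + of_int s + of_nat r)) * tr (a * b))"
    proof (subst sum.reindex)
      have "z + of_int (int r + s) = z + of_int s + of_nat r" for r by simp
      then show "(\<Sum>r<k. ((\<lambda>q. jump (q + s) q * d (z + of_int (q + s)) * tr (a * b)) \<circ> int) r)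
          = (\<Sum>r<k. - (d (z + of_int s + of_nat r)) * tr (a * b))"
        by (intro sum.cong refl) (simp only: o_def, simp add: jump_def k)
    qed simp
    also have "\<dots> = - (prod_antidiff j1 i2 j2 (z + of_int s + of_nat k) - prod_antidiff j1 i2 j2 (z + of_int s)) * tr (a * b)"
      unfolding tele by (simp add: sum_negf sum_distrib_right)
    finally show ?thesis by (simp add: k)
  qed
  then show ?thesis using True unfolding z_def s_def by simp
qed

lemma bracket_mon_Phi:
  "Phi (fst (hat_bracket_mon sA tr a p b q))
    = opmat a (fst p) (snd p) * opmat b (fst q) (snd q) - opmat b (fst q) (snd q) * opmat a (fst p) (snd p)"
  by (cases p; cases q) (simp add: hat_bracket_mon_def Phi_add Phi_diff Phi_tens_mult)

text \<open>Comparison of the cocycles.  With \<open>S\<close> the antidifference of the symbol of the product and \<open>S'\<close> that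
  of the opposite product, the left side is \<open>- S \<iota> + S' \<iota> + S s\<close> and \<open>S' \<iota> = S (\<iota> + s) - S s\<close>.\<close>

lemma bracket_mon_central:
  "central_part (hat_bracket_mon sA tr a p b q) = psi (opmat a (fst p) (snd p)) (opmat b (fst q) (snd q))"
proof -
  obtain i1 j1 where p: "p = (i1, j1)" by (cases p)
  obtain i2 j2 where q: "q = (i2, j2)" by (cases q)
  have E: "central_part (tens sA x (dop_mult (dop_mon i1 j1) (dop_mon i2 j2)))
    = (if i1 + i2 = int j1 + int j2 then - prod_antidiff j1 i2 j2 (of_rat \<iota>) * tr x else 0)" for x i1 j1 i2 j2
    using central_part_tens_mult[OF one_neq_zero, of x i1 j1 i2 j2] by (simp add: dop_mon_def)
  let ?c = "(-1) ^ j1 * (if i1 + i2 = int j1 + int j2 then 1 else 0) * fact j1 * fact j2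
           * (of_int i1 gchoose (j1 + j2 + 1)) * tr (a * b)"
  have "central_part (hat_bracket_mon sA tr a p b q)
      = central_part (tens sA (a * b) (dop_mult (dop_mon i1 j1) (dop_mon i2 j2)))
        - central_part (tens sA (b * a) (dop_mult (dop_mon i2 j2) (dop_mon i1 j1))) + ?c"
    unfolding p q hat_bracket_mon_def prod.case central_part_add central_part_diff central_part_pair ..
  also have "\<dots> = psi (opmat a i1 j1) (opmat b i2 j2)"
  proof (cases "i1 + i2 = int j1 + int j2")
    case True
    then have T: "i2 + i1 = int j2 + int j1" by simp
    show ?thesis
      unfolding E if_P[OF True] if_P[OF T] psi_opmat prod_antidiff_swap[OF True] tr_comm[of b a] mult_1_right
        prod_antidiff_at[OF True, symmetric]
      by (simp only: left_diff_distrib mult_minus_left minus_diff_eq) simp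
  next
    case False
    then have F: "i2 + i1 \<noteq> int j2 + int j1" by simp
    show ?thesis unfolding E if_not_P[OF False] if_not_P[OF F] psi_opmat by simp
  qed
  finally show ?thesis by (simp add: p q)
qed

lemma hat_bracket_Phi:
  "Phi (fst (hat_bracket sA tr X Y)) = Phi (fst X) * Phi (fst Y) - Phi (fst Y) * Phi (fst X)"
proof -
  have fst_sum: "fst (\<Sum>x\<in>S. f x) = (\<Sum>x\<in>S. fst (f x))" for S and f :: "'k \<Rightarrow> 'a hatA"
    by (induction S rule: infinite_finite_induct) simp_all
  show ?thesis
    unfolding hat_bracket_def fst_sum Phi_sum bracket_mon_Phi
    unfolding sum_subtractf Phi_def sum_distrib_left sum_distrib_right
    by (intro arg_cong2[where f = "(-)"], rule sum.swap, rule refl)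
qed

text \<open>The central part of a bracket is the cocycle of the matrices; the term \<open>central_part\<close> of the
  noncentral components accounts for the difference of the two cocycles.\<close>

lemma hat_bracket_central: "central_part (hat_bracket sA tr X Y) = psi (Phi (fst X)) (Phi (fst Y))"
  unfolding hat_bracket_def central_part_sum bracket_mon_central Phi_def[of "fst X"] psi_sum_left
  unfolding Phi_def psi_sum_right ..

subsection \<open>Generators\<close>

lemma wshift_Lam:
  assumes i: "i \<in> {1..n}" and j: "j \<in> {1..n}" and a: "a \<in> B i j"
  shows "wshift d (\<lambda>q. sA (f q) a) * Lam = wshift (d - int (\<l> j)) (\<lambda>q. sA (f (q - int (\<l> j)) * falling (expo q) (\<l> j)) a)"
proof -
  have "wshift d (\<lambda>q. sA (f q) a) * Lam
      = (\<Sum>k\<in>{1..n}. wshift (d + - int (\<l> k)) (\<lambda>q. sA (f (q + - int (\<l> k))) a * sA (falling (expo q) (\<l> k)) (e k)))"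
    unfolding Lam_def sum_distrib_left wshift_times ..
  also have "\<dots> = (\<Sum>k\<in>{1..n}. if k = j then
      wshift (d - int (\<l> j)) (\<lambda>q. sA (f (q - int (\<l> j)) * falling (expo q) (\<l> j)) a) else 0)"
  proof (intro sum.cong refl)
    fix k assume k: "k \<in> {1..n}"
    show "wshift (d + - int (\<l> k)) (\<lambda>q. sA (f (q + - int (\<l> k))) a * sA (falling (expo q) (\<l> k)) (e k)) =
      (if k = j then wshift (d - int (\<l> j)) (\<lambda>q. sA (f (q - int (\<l> j)) * falling (expo q) (\<l> j)) a) else 0)"
      using L_times_e[OF j k B_L[OF i j a]] by (cases "k = j") (simp_all add: scale_mult)
  qed
  also have "\<dots> = wshift (d - int (\<l> j)) (\<lambda>q. sA (f (q - int (\<l> j)) * falling (expo q) (\<l> j)) a)"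
    using j by simp
  finally show ?thesis .
qed

lemma hat_gen_second:
  "tens sA b (dop_mult (neg_ddt_pow r) (dop_mon m l))
    = (\<Sum>s\<le>r. hmon (sA ((-1) ^ r * (of_nat (r choose s) * falling (of_int m) s)) b) (0 + m - int s) (r + l - s))"
  unfolding neg_ddt_pow_def by (rule tens_mult) simp

definition skewing :: "'a \<Rightarrow> int \<Rightarrow> nat \<Rightarrow> 'a band" where
  "skewing a m r = opmat a m r - (-1) ^ \<epsilon> * adj (opmat a m r)"

text \<open>The adjoint of the matrix of \<open>t^m \<partial>^r\<close> is that of \<open>(-\<partial>)^r t^m\<close>, and multiplication by \<open>\<Lambda>\<close> on the right
  adds \<open>\<partial>^(\<l> j)\<close> in the first term and \<open>\<partial>^(\<l> i)\<close> in the second.\<close>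

lemma Phi_hat_gen:
  assumes i: "i \<in> {1..n}" and j: "j \<in> {1..n}" and a: "a \<in> B i j"
  shows "Phi (fst (hat_gen sA \<tau> \<epsilon> \<l> i j a r m)) = skewing a m r * Lam"
proof -
  have ta: "\<tau> a \<in> B (\<pi> j) (\<pi> i)" using tau_pieces[OF i j] a by auto
  have expo_diff: "expo (q - int k) = expo q - of_nat k" for q k by simp
  have 1: "opmat a m r * Lam = opmat a m (r + \<l> j)"
    unfolding opmat_def wshift_Lam[OF i j a]
  proof (intro arg_cong2[where f = wshift] ext)
    show "m - int r - int (\<l> j) = m - int (r + \<l> j)" by simp
  qed (simp only: expo_diff falling_add add.commute[of r] mult.commute)
  have adj: "adj (opmat a m r) = wshift (m - int r) (\<lambda>q. sA ((-1) ^ r * falling (expo q + of_int m) r) (\<tau> a))"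
    unfolding opmat_def adj_wshift
  proof (intro arg_cong2[where f = wshift] ext refl)
    fix q
    have "expo (- 1 - \<nu> - q - (m - int r)) = of_nat r - 1 - (expo q + of_int m)"
      by (simp add: algebra_simps flip: of_rat_nu)
    then show "\<tau> (sA (falling (expo (- 1 - \<nu> - q - (m - int r))) r) a) = sA ((-1) ^ r * falling (expo q + of_int m) r) (\<tau> a)"
      by (simp only: falling_reflect taul.scale)
  qed
  have 2: "adj (opmat a m r) * Lam = Phi (fst (tens sA (\<tau> a) (dop_mult (neg_ddt_pow r) (dop_mon m (\<l> i)))))"
  proof -
    have "Phi (fst (tens sA (\<tau> a) (dop_mult (neg_ddt_pow r) (dop_mon m (\<l> i)))))
      = wshift (0 + m - int (r + \<l> i)) (\<lambda>q. sA ((-1) ^ r * (falling (expo q) (\<l> i) * falling (expo q - of_nat (\<l> i) + of_int m) r)) (\<tau> a))"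
      unfolding opmat_sum_leibniz[symmetric] hat_gen_second hmon_def pair_sum fst_conv Phi_sum Phi_single ..
    also have "\<dots> = adj (opmat a m r) * Lam"
      unfolding adj wshift_Lam[OF pi_in[OF j] pi_in[OF i] ta] l_perm[OF i]
    proof (intro arg_cong2[where f = wshift] ext)
      show "0 + m - int (r + \<l> i) = m - int r - int (\<l> i)" by simp
    qed (simp only: expo_diff mult_ac)
    finally show ?thesis ..
  qed
  have 3: "Phi (fst (ext_scale sA ((-1) ^ \<epsilon>) T)) = (-1) ^ \<epsilon> * Phi (fst T)" for T
    unfolding ext_scale_def fst_conv Phi_scale
    by (cases "even \<epsilon>") (auto intro!: band_eqI)
  show ?thesis
    unfolding hat_gen_def fst_diff Phi_diff 3 2[symmetric] skewing_def left_diff_distrib 1 mult.assoc tens_dop_mon hmon_def fst_conv Phi_single ..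
qed

lemma central_part_hat_gen:
  assumes "i \<in> {1..n}" "j \<in> {1..n}" "a \<in> B i j"
  shows "central_part (hat_gen sA \<tau> \<epsilon> \<l> i j a r m)
    = (if m = int r + int (\<l> j) then fact (r + \<l> j) * im_coeff \<iota> 0 (r + \<l> j) * tr a else 0)
     - (if m = int r + int (\<l> i) then (-1) ^ \<epsilon> * fact r * fact (\<l> i) * im_coeff \<iota> r (\<l> i) * tr a else 0)"
proof -
  have 1: "- antidiff (of_rat \<iota>) k = fact k * im_coeff \<iota> 0 k" for k
    using im_coeff_closed[of 0 k \<iota>] by simp
  have 2: "- ((-1) ^ r) * prod_antidiff r (int r + int l) l (of_rat \<iota>) = fact r * fact l * im_coeff \<iota> r l" for l
    unfolding prod_antidiff_normal im_coeff_closed by simp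
  have "central_part (tens sA (\<tau> a) (dop_mult (neg_ddt_pow r) (dop_mon m (\<l> i))))
     = (if m = int r + int (\<l> i) then fact r * fact (\<l> i) * im_coeff \<iota> r (\<l> i) * tr a else 0)"
    unfolding neg_ddt_pow_def 2[symmetric] by (subst central_part_tens_mult) (simp_all add: tr_tau)
  then have 3: "central_part (ext_scale sA ((-1) ^ \<epsilon>) (tens sA (\<tau> a) (dop_mult (neg_ddt_pow r) (dop_mon m (\<l> i)))))
     = (if m = int r + int (\<l> i) then (-1) ^ \<epsilon> * fact r * fact (\<l> i) * im_coeff \<iota> r (\<l> i) * tr a else 0)"
    unfolding central_part_scale by (simp only: mult.assoc if_distrib[of "(*) ((-1) ^ \<epsilon>)"] mult_zero_right)
  show ?thesis
    unfolding hat_gen_def central_part_diff 3 tens_dop_mon central_part_hmon 1 of_nat_add ..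
qed

lemma skew_skewing_of_opmat: "skew (skewing a m r)"
  unfolding skewing_def by (rule skew_skewing)

text \<open>On generators \<open>X\<close> is the skewing of the matrix of \<open>a \<otimes> t^m \<partial>^r\<close>, and the property is linear.\<close>

lemma hat_sub_skew:
  assumes "H \<in> hat_sub sA n B \<tau> \<epsilon> \<l>"
  shows "\<exists>X. skew X \<and> Phi (fst H) = X * Lam"
proof -
  let ?S = "{H :: 'a hatA. \<exists>X. skew X \<and> Phi (fst H) = X * Lam}"
  have "ext.subspace ?S"
    unfolding ext.subspace_def
  proof (intro conjI ballI allI)
    show "0 \<in> ?S" by (auto intro!: exI[of _ 0] simp: skew_0)
  next
    fix H K :: "'a hatA" assume "H \<in> ?S" "K \<in> ?S"
    then obtain X Y where "skew X" "Phi (fst H) = X * Lam" "skew Y" "Phi (fst K) = Y * Lam" by blast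
    then have "skew (X + Y) \<and> Phi (fst (H + K)) = (X + Y) * Lam" by (simp add: skew_add Phi_add distrib_right)
    then show "H + K \<in> ?S" by blast
  next
    fix c and H :: "'a hatA" assume "H \<in> ?S"
    then obtain X where "skew X" "Phi (fst H) = X * Lam" by blast
    then have "skew (scl c X) \<and> Phi (fst (ext_scale sA c H)) = scl c X * Lam"
      by (simp add: skew_scl ext_scale_def Phi_scale scl_times)
    then show "ext_scale sA c H \<in> ?S" by blast
  qed
  moreover have "skew 0 \<and> Phi (fst (central :: 'a hatA)) = 0 * Lam" by (simp add: skew_0)
  then have "central \<in> ?S" by blast
  then have "insert central {hat_gen sA \<tau> \<epsilon> \<l> i j a r m | i j a r m. i \<in> {1..n} \<and> j \<in> {1..n} \<and> a \<in> B i j} \<subseteq> ?S"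
    using Phi_hat_gen skew_skewing_of_opmat by blast
  ultimately have "hat_sub sA n B \<tau> \<epsilon> \<l> \<subseteq> ?S" unfolding hat_sub_def by (intro ext.span_minimal)
  then show ?thesis using assms by blast
qed

end



context twisted_module
begin

section \<open>The representation\<close>

definition sigmaM :: "'a hatA \<Rightarrow> 'm \<Rightarrow> 'm" where
  "sigmaM H v = act (Phi (fst H)) v + sM (central_part H) (\<rho> central v)"

abbreviation "hat_alg \<equiv> hat_sub sA n B \<tau> \<epsilon> \<l>"

lemma hat_alg_subspace: "ext.subspace hat_alg"
  unfolding hat_sub_def by (rule ext.subspace_span)

lemma central_commute:
  assumes "x \<in> check_alg" shows "\<rho> x (\<rho> central v) = \<rho> central (\<rho> x v)"
proof -
  have "\<rho> (check_bracket tr x central) v = 0" by (simp add: check_bracket_def rho_0)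
  then show ?thesis using rho_bracket[OF assms central_check_alg, of v] by simp
qed

lemma act_central:
  assumes X: "skew X"
  shows "act (X * Lam) (\<rho> central v) = \<rho> central (act (X * Lam) v)"
proof -
  obtain N0 where N0: "\<forall>N\<ge>N0. \<rho> (emb (trunc N X * Lam)) v = act (X * Lam) v"
    using act_eventually[OF X] by blast
  show ?thesis
  proof (rule act_eqI, intro allI impI)
    fix N assume "N0 \<le> N"
    then show "\<rho> (emb (trunc N X * Lam)) (\<rho> central v) = \<rho> central (act (X * Lam) v)"
      using N0 central_commute[OF emb_trunc_check_alg[OF X]] by simp
  qed
qed

lemma sigmaM_linear:
  assumes "H \<in> hat_alg" shows "Vector_Spaces.linear sM sM (sigmaM H)"
proof -
  obtain X where X: "skew X" "Phi (fst H) = X * Lam" using hat_sub_skew[OF assms] by blast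
  interpret R: Vector_Spaces.linear sM sM "act (X * Lam)" by (rule act_linear[OF X(1)])
  show ?thesis
  proof (unfold_locales)
    fix v w c
    show "sigmaM H (v + w) = sigmaM H v + sigmaM H w"
      unfolding sigmaM_def X(2) R.add rho_vadd[OF central_check_alg] modM.scale_right_distrib by (simp only: add_ac)
    show "sigmaM H (sM c v) = sM c (sigmaM H v)"
      unfolding sigmaM_def X(2) R.scale rho_vscale[OF central_check_alg] modM.scale_right_distrib modM.scale_scale
      by (simp only: mult.commute)
  qed
qed

lemma sigmaM_add:
  assumes "H \<in> hat_alg" "K \<in> hat_alg" shows "sigmaM (H + K) v = sigmaM H v + sigmaM K v"
proof -
  obtain X where X: "skew X" "Phi (fst H) = X * Lam" using hat_sub_skew[OF assms(1)] by blast
  obtain Y where Y: "skew Y" "Phi (fst K) = Y * Lam" using hat_sub_skew[OF assms(2)] by blast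
  show ?thesis
    unfolding sigmaM_def fst_add Phi_add X(2) Y(2) distrib_right[symmetric] act_add[OF X(1) Y(1)]
      central_part_add modM.scale_left_distrib by (simp only: add_ac)
qed

lemma sigmaM_scale:
  assumes "H \<in> hat_alg" shows "sigmaM (ext_scale sA c H) v = sM c (sigmaM H v)"
proof -
  obtain X where X: "skew X" "Phi (fst H) = X * Lam" using hat_sub_skew[OF assms] by blast
  have "Phi (fst (ext_scale sA c H)) = scl c X * Lam"
    by (simp add: ext_scale_def Phi_scale X(2) scl_times)
  then show ?thesis
    by (simp only: sigmaM_def act_scl[OF X(1)] X(2) central_part_scale modM.scale_right_distrib modM.scale_scale)
qed

text \<open>The corrections by central scalars drop out of the commutator, because the centre acts by
  operators that commute with everything.\<close>

lemma sigmaM_bracket: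
  assumes "H \<in> hat_alg" "K \<in> hat_alg"
  shows "sigmaM (hat_bracket sA tr H K) v = sigmaM H (sigmaM K v) - sigmaM K (sigmaM H v)"
proof -
  obtain X where X: "skew X" "Phi (fst H) = X * Lam" using hat_sub_skew[OF assms(1)] by blast
  obtain Y where Y: "skew Y" "Phi (fst K) = Y * Lam" using hat_sub_skew[OF assms(2)] by blast
  interpret R: Vector_Spaces.linear sM sM "act (X * Lam)" by (rule act_linear[OF X(1)])
  interpret S: Vector_Spaces.linear sM sM "act (Y * Lam)" by (rule act_linear[OF Y(1)])
  let ?z = "\<rho> central"
  let ?c = "central_part H" and ?d = "central_part K"
  have "Phi (fst (hat_bracket sA tr H K)) = (X * Lam * Y - Y * Lam * X) * Lam"
    unfolding hat_bracket_Phi X(2) Y(2) by (simp only: left_diff_distrib mult.assoc)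
  then have "sigmaM (hat_bracket sA tr H K) v
      = act ((X * Lam * Y - Y * Lam * X) * Lam) v + sM (psi (X * Lam) (Y * Lam)) (?z v)"
    by (simp only: sigmaM_def hat_bracket_central X(2) Y(2))
  also have "\<dots> = act (X * Lam) (act (Y * Lam) v) - act (Y * Lam) (act (X * Lam) v)"
    by (rule act_bracket[OF X(1) Y(1)])
  finally have L: "sigmaM (hat_bracket sA tr H K) v = act (X * Lam) (act (Y * Lam) v) - act (Y * Lam) (act (X * Lam) v)" .
  have 1: "sigmaM H (sigmaM K v) = act (X * Lam) (act (Y * Lam) v) + sM ?d (?z (act (X * Lam) v))
      + (sM ?c (?z (act (Y * Lam) v)) + sM (?c * ?d) (?z (?z v)))"
    unfolding sigmaM_def X(2) Y(2) R.add R.scale act_central[OF X(1)] rho_vadd[OF central_check_alg]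
      rho_vscale[OF central_check_alg] modM.scale_right_distrib modM.scale_scale ..
  have 2: "sigmaM K (sigmaM H v) = act (Y * Lam) (act (X * Lam) v) + sM ?c (?z (act (Y * Lam) v))
      + (sM ?d (?z (act (X * Lam) v)) + sM (?d * ?c) (?z (?z v)))"
    unfolding sigmaM_def X(2) Y(2) S.add S.scale act_central[OF Y(1)] rho_vadd[OF central_check_alg]
      rho_vscale[OF central_check_alg] modM.scale_right_distrib modM.scale_scale ..
  show ?thesis unfolding L 1 2 mult.commute[of ?d] by simp
qed

lemma sigmaM_representation: "lie_representation hat_alg (ext_scale sA) (hat_bracket sA tr) sM sigmaM"
  unfolding lie_representation_def
  using modM.vector_space_axioms sigmaM_linear sigmaM_add sigmaM_scale sigmaM_bracket by blast

lemma sigmaM_central: "sigmaM central v = \<rho> central v"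
proof -
  have "act (0 * Lam) v = 0"
    by (rule act_eqI[of 0]) (simp add: trunc_def rho_0)
  then show ?thesis by (simp add: sigmaM_def)
qed

subsection \<open>The defining series\<close>

lemma adj_scl: "adj (scl c F) = scl c (adj F)"
  by (rule band_eqI) (simp add: entry_adj taul.scale)

lemma scl_diff: "scl c F - scl c G = scl c (F - G)"
  by (simp only: scl_def right_diff_distrib)

lemma scl_sign: "(-1) ^ k * scl c F = scl c ((-1) ^ k * F)"
  by (cases "even k") (auto intro!: band_eqI)

lemma gen_at_scale:
  assumes ij: "i \<in> {1..n}" "j \<in> {1..n}" and a: "a \<in> B i j"
  shows "gen_at i j (sA c a) p q = ext_scale sA c (gen_at i j a p q)"
proof -
  have ca: "sA c a \<in> B i j" using B_subspace[OF ij] a by (rule subspace_scale)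
  let ?Y = "munit a p q"
  have "munit (sA c a) p q = scl c ?Y" by (rule band_eqI) (simp add: entry_munit)
  then have "(munit (sA c a) p q - (-1) ^ \<epsilon> * adj (munit (sA c a) p q)) * Lam
      = scl c ((?Y - (-1) ^ \<epsilon> * adj ?Y) * Lam)"
    by (simp only: adj_scl scl_sign scl_diff scl_times)
  then show ?thesis
    unfolding gen_at_eq[OF ij ca] gen_at_eq[OF ij a]
    by (simp add: emb_scl finite_band_times_right finite_band_diff finite_band_times_left finite_band_adj finite_band_munit)
qed

lemma emb_trunc_skewing:
  assumes ij: "i \<in> {1..n}" "j \<in> {1..n}" and a: "a \<in> B i j"
  shows "emb (trunc N (skewing a d r) * Lam) = (\<Sum>q | q \<in> window N \<and> q + d - int r \<in> window N.
     ext_scale sA (falling (expo q) r) (gen_at i j a (q + d - int r) q))"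
proof -
  let ?S = "{q. q \<in> window N \<and> q + d - int r \<in> window N}"
  let ?Y = "\<lambda>q. munit (sA (falling (expo q) r) a) (q + d - int r) q"
  have S: "finite ?S" by (rule finite_subset[of _ "window N"]) (auto simp: window_def)
  have "trunc N (opmat a d r) = (\<Sum>q\<in>?S. ?Y q)"
  proof (rule band_eqI)
    fix p q
    have "entry (\<Sum>q\<in>?S. ?Y q) p q = (\<Sum>q'\<in>?S. if q' = q then (if p = q + d - int r then sA (falling (expo q) r) a else 0) else 0)"
      unfolding entry_sum by (intro sum.cong refl) (auto simp: entry_munit)
    then show "entry (trunc N (opmat a d r)) p q = entry (\<Sum>q\<in>?S. ?Y q) p q"
      using S by (auto simp: entry_trunc opmat_def entry_wshift)
  qed
  moreover have "trunc N (skewing a d r) = trunc N (opmat a d r) - (-1) ^ \<epsilon> * adj (trunc N (opmat a d r))"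
  proof -
    have "adj (trunc N F) = trunc N (adj F)" for F
      unfolding trunc_def by (simp only: adj_times adj_cut mult.assoc)
    then show ?thesis
      unfolding skewing_def
      by (cases "even \<epsilon>") (simp_all add: trunc_def right_diff_distrib distrib_left left_diff_distrib distrib_right)
  qed
  ultimately have "trunc N (skewing a d r) * Lam = (\<Sum>q\<in>?S. (?Y q - (-1) ^ \<epsilon> * adj (?Y q)) * Lam)"
    by (simp only: adj_sum sum_distrib_left sum_distrib_right sum_subtractf left_diff_distrib)
  then have "emb (trunc N (skewing a d r) * Lam) = (\<Sum>q\<in>?S. emb ((?Y q - (-1) ^ \<epsilon> * adj (?Y q)) * Lam))"
    by (simp add: emb_sum finite_band_times_right finite_band_diff finite_band_times_left finite_band_adj finite_band_munit)
  also have "\<dots> = (\<Sum>q\<in>?S. ext_scale sA (falling (expo q) r) (gen_at i j a (q + d - int r) q))"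
    using gen_at_eq[OF ij subspace_scale[OF B_subspace[OF ij] a]] gen_at_scale[OF ij a] by simp
  finally show ?thesis .
qed

text \<open>The terms of the double sum with a fixed power of \<open>z\<close> lie on one diagonal, and \<open>q\<close> is the column
  on this diagonal.\<close>

definition diag_term :: "nat \<Rightarrow> nat \<Rightarrow> 'a \<Rightarrow> nat \<Rightarrow> int \<Rightarrow> 'm \<Rightarrow> int \<Rightarrow> 'm" where
  "diag_term i j a r d v q = sM (falling (expo q) r) (\<rho> (gen_at i j a (q + d - int r) q) v)"

lemma diag_term_bound:
  assumes ij: "i \<in> {1..n}" "j \<in> {1..n}" and a: "a \<in> B i j"
  shows "\<exists>R. \<forall>q. diag_term i j a r d v q \<noteq> 0 \<longrightarrow> q \<in> {- R..R}"
proof -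
  obtain K where K: "tame K v" using all_tame by blast
  have "q \<in> {- (\<bar>K\<bar> + \<bar>d\<bar> + int r + 1)..\<bar>K\<bar> + \<bar>d\<bar> + int r + 1}" if nz: "diag_term i j a r d v q \<noteq> 0" for q
  proof (rule ccontr)
    assume "q \<notin> {- (\<bar>K\<bar> + \<bar>d\<bar> + int r + 1)..\<bar>K\<bar> + \<bar>d\<bar> + int r + 1}"
    then have "corner K (q + d - int r) q" unfolding corner_def by auto
    then have "\<rho> (gen_at i j a (q + d - int r) q) v = 0" using K ij a unfolding tame_def by blast
    with nz show False by (simp add: diag_term_def)
  qed
  then show ?thesis by blast
qed

lemma act_skewing:
  assumes ij: "i \<in> {1..n}" "j \<in> {1..n}" and a: "a \<in> B i j"
    and R: "\<And>q. diag_term i j a r d v q \<noteq> 0 \<Longrightarrow> q \<in> {- R..R}"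
  shows "act (skewing a d r * Lam) v = (\<Sum>q\<in>{- R..R}. diag_term i j a r d v q)"
proof (rule act_eqI, intro allI impI)
  fix N assume N: "R + \<bar>d\<bar> + int r + \<bar>\<nu>\<bar> + 1 \<le> N"
  let ?S = "{q. q \<in> window N \<and> q + d - int r \<in> window N}"
  have "\<rho> (emb (trunc N (skewing a d r) * Lam)) v = (\<Sum>q\<in>?S. diag_term i j a r d v q)"
    unfolding emb_trunc_skewing[OF ij a] diag_term_def
    by (subst rho_sum) (auto simp: rho_scale gen_at_check_alg[OF ij a] intro: ext.subspace_scale[OF check_alg_subspace])
  also have "\<dots> = (\<Sum>q\<in>{- R..R}. diag_term i j a r d v q)"
  proof (rule sum.mono_neutral_right)
    show "finite ?S" by (rule finite_subset[of _ "window N"]) (auto simp: window_def)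
    \<comment> \<open>The window is chosen so large that rows and columns of the surviving terms fit in.\<close>
    show "{- R..R} \<subseteq> ?S" using N by (auto simp: window_def)
    show "\<forall>q\<in>?S - {- R..R}. diag_term i j a r d v q = 0" using R by blast
  qed
  finally show "\<rho> (emb (trunc N (skewing a d r) * Lam)) v = (\<Sum>q\<in>{- R..R}. diag_term i j a r d v q)" .
qed

text \<open>The pair \<open>(l\<^sub>1, l\<^sub>2)\<close> that belongs to column \<open>q\<close> of the diagonal.\<close>

definition place :: "nat \<Rightarrow> int \<Rightarrow> int \<Rightarrow> rat \<times> rat" where
  "place r d q = (of_int (q + d - int r) + 1/2, - of_int (q + \<nu>) - 1/2)"

lemma inj_place: "inj (place r d)"
  by (auto simp: inj_def place_def)

lemma sigma_term_place: "sigma_term sA \<tau> \<epsilon> \<l> \<iota> sM \<rho> i j a r k v (place r (- k - 1) q) = diag_term i j a r (- k - 1) v q"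
proof -
  have nu: "rat_of_int \<nu> = 2 * \<iota>" by (simp add: iota)
  have c: "- (of_int (q + (- k - 1) - int r) + 1/2) - (- of_int (q + \<nu>) - 1/2) - 2 * \<iota> - of_nat r - 1 = rat_of_int k"
    by (simp add: nu)
  have f: "of_rat (- (- of_int (q + \<nu>) - 1/2) - \<iota> - 1/2) = expo q"
  proof -
    have "- (- of_int (q + \<nu>) - 1/2) - \<iota> - 1/2 = of_int q + \<iota>" by (simp add: nu)
    then show ?thesis by (simp only: of_rat_add of_rat_of_int_eq)
  qed
  show ?thesis
    unfolding sigma_term_def place_def diag_term_def gen_at_def prod.case c f
    by (simp only: half_odd_row half_odd_col simp_thms if_True)
qed

lemma sigma_term_outside:
  assumes "x \<notin> range (place r (- k - 1))"
  shows "sigma_term sA \<tau> \<epsilon> \<l> \<iota> sM \<rho> i j a r k v x = 0"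
proof (rule ccontr)
  assume nz: "sigma_term sA \<tau> \<epsilon> \<l> \<iota> sM \<rho> i j a r k v x \<noteq> 0"
  obtain l1 l2 where x: "x = (l1, l2)" by (cases x)
  have l: "l1 \<in> half_odd" "l2 \<in> half_odd" and k: "- l1 - l2 - 2 * \<iota> - of_nat r - 1 = of_int k"
    using nz unfolding x sigma_term_def prod.case by (meson | force)+
  obtain p q where pq: "l1 = of_int p + 1/2" "l2 = - of_int (q + \<nu>) - 1/2"
    using l by (rule half_odd_gen_at)
  have "rat_of_int k = of_int (q - p - int r - 1)" using k unfolding pq by (simp add: iota)
  then have "k = q - p - int r - 1" by (simp only: of_int_eq_iff)
  then have "p = q + (- k - 1) - int r" by simp
  then have "x = place r (- k - 1) q" unfolding x pq place_def by simp
  with assms show False by blast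
qed

lemma sigma_term_support:
  assumes ij: "i \<in> {1..n}" "j \<in> {1..n}" and a: "a \<in> B i j"
    and R: "\<And>q. diag_term i j a r (- k - 1) v q \<noteq> 0 \<Longrightarrow> q \<in> {- R..R}"
  shows "{x. sigma_term sA \<tau> \<epsilon> \<l> \<iota> sM \<rho> i j a r k v x \<noteq> 0} \<subseteq> place r (- k - 1) ` {- R..R}"
proof
  fix x assume "x \<in> {x. sigma_term sA \<tau> \<epsilon> \<l> \<iota> sM \<rho> i j a r k v x \<noteq> 0}"
  then have nz: "sigma_term sA \<tau> \<epsilon> \<l> \<iota> sM \<rho> i j a r k v x \<noteq> 0" by simp
  then obtain q where q: "x = place r (- k - 1) q" using sigma_term_outside by blast
  then show "x \<in> place r (- k - 1) ` {- R..R}" using nz R sigma_term_place by auto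
qed

lemma sigma_term_finite:
  assumes "i \<in> {1..n}" "j \<in> {1..n}" "a \<in> B i j"
  shows "finite {x. sigma_term sA \<tau> \<epsilon> \<l> \<iota> sM \<rho> i j a r k v x \<noteq> 0}"
proof -
  obtain R where R: "\<And>q. diag_term i j a r (- k - 1) v q \<noteq> 0 \<Longrightarrow> q \<in> {- R..R}"
    using diag_term_bound[OF assms] by blast
  have "{x. sigma_term sA \<tau> \<epsilon> \<l> \<iota> sM \<rho> i j a r k v x \<noteq> 0} \<subseteq> place r (- k - 1) ` {- R..R}"
    by (rule sigma_term_support[OF assms]) (rule R)
  then show ?thesis by (rule finite_subset) simp
qed

text \<open>On the diagonal only finitely many generators act nontrivially on \<open>v\<close>, and a large window contains
  all of them.\<close>

lemma act_sigma:
  assumes ij: "i \<in> {1..n}" "j \<in> {1..n}" and a: "a \<in> B i j"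
  shows "act (skewing a (- k - 1) r * Lam) v = Sum_any (sigma_term sA \<tau> \<epsilon> \<l> \<iota> sM \<rho> i j a r k v)"
proof -
  obtain R where R: "\<And>q. diag_term i j a r (- k - 1) v q \<noteq> 0 \<Longrightarrow> q \<in> {- R..R}"
    using diag_term_bound[OF assms] by blast
  have "Sum_any (sigma_term sA \<tau> \<epsilon> \<l> \<iota> sM \<rho> i j a r k v)
      = sum (sigma_term sA \<tau> \<epsilon> \<l> \<iota> sM \<rho> i j a r k v) (place r (- k - 1) ` {- R..R})"
  proof (rule Sum_any.expand_superset)
    show "{x. sigma_term sA \<tau> \<epsilon> \<l> \<iota> sM \<rho> i j a r k v x \<noteq> 0} \<subseteq> place r (- k - 1) ` {- R..R}"
      by (rule sigma_term_support[OF assms]) (rule R)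
  qed simp
  also have "\<dots> = (\<Sum>q\<in>{- R..R}. diag_term i j a r (- k - 1) v q)"
    by (subst sum.reindex) (auto simp: sigma_term_place intro: inj_on_subset[OF inj_place])
  also have "\<dots> = act (skewing a (- k - 1) r * Lam) v"
    by (rule act_skewing[OF assms, symmetric]) (rule R)
  finally show ?thesis ..
qed

lemma sigmaM_hat_field:
  assumes ij: "i \<in> {1..n}" "j \<in> {1..n}" and a: "a \<in> B i j"
  shows "sigmaM (hat_field sA \<tau> \<epsilon> \<l> i j a r k) v = sigma_coeff sA tr \<tau> \<epsilon> \<l> \<iota> sM \<rho> i j a r k v"
proof -
  have m: "- k - 1 = int r + int l \<longleftrightarrow> k = - int r - int l - 1" for l by auto
  have if_scale: "sM (if P then c else 0) u = (if P then sM c u else 0)" for P c u by simp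
  show ?thesis
    unfolding sigmaM_def hat_field_def Phi_hat_gen[OF ij a] act_sigma[OF ij a] sigma_coeff_def
      central_part_hat_gen[OF ij a] m modM.scale_left_diff_distrib if_scale
    by (simp only: add_diff_eq)
qed

lemma sigmaM_formula: "sigma_formula sA tr n B \<tau> \<epsilon> \<l> \<iota> sM \<rho> sigmaM"
  unfolding sigma_formula_def using sigmaM_central sigmaM_hat_field by blast

lemma sigma_unique:
  assumes rep': "lie_representation hat_alg (ext_scale sA) (hat_bracket sA tr) sM \<sigma>'"
    and formula: "sigma_formula sA tr n B \<tau> \<epsilon> \<l> \<iota> sM \<rho> \<sigma>'" and x: "x \<in> hat_alg"
  shows "\<sigma>' x = sigmaM x"
proof -
  let ?G = "insert central {hat_gen sA \<tau> \<epsilon> \<l> i j a r m | i j a r m. i \<in> {1..n} \<and> j \<in> {1..n} \<and> a \<in> B i j}"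
  have add: "\<sigma>' (x + y) v = \<sigma>' x v + \<sigma>' y v" if "x \<in> hat_alg" "y \<in> hat_alg" for x y v
    using rep' that by (simp add: lie_representation_def)
  have scale: "\<sigma>' (ext_scale sA c x) v = sM c (\<sigma>' x v)" if "x \<in> hat_alg" for c x v
    using rep' that by (simp add: lie_representation_def)
  let ?E = "{x \<in> hat_alg. \<forall>v. \<sigma>' x v = sigmaM x v}"
  have "ext.subspace ?E"
    unfolding ext.subspace_def
  proof (intro conjI ballI allI)
    have "\<sigma>' 0 v = sigmaM 0 v" for v
      using add[of 0 0 v] sigmaM_add[of 0 0 v] ext.subspace_0[OF hat_alg_subspace] by simp
    then show "0 \<in> ?E" using ext.subspace_0[OF hat_alg_subspace] by simp
  next
    fix x y assume "x \<in> ?E" "y \<in> ?E"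
    then show "x + y \<in> ?E" using add sigmaM_add ext.subspace_add[OF hat_alg_subspace] by simp
  next
    fix c x assume "x \<in> ?E"
    then show "ext_scale sA c x \<in> ?E" using scale sigmaM_scale ext.subspace_scale[OF hat_alg_subspace] by simp
  qed
  moreover have "?G \<subseteq> ?E"
  proof
    fix x assume x: "x \<in> ?G"
    then have "x \<in> hat_alg" unfolding hat_sub_def by (rule ext.span_base)
    moreover have "\<sigma>' x v = sigmaM x v" for v
    proof (cases "x = central")
      case True
      then show ?thesis using formula sigmaM_central by (simp add: sigma_formula_def)
    next
      case False
      then obtain i j a r m where ij: "i \<in> {1..n}" "j \<in> {1..n}" "a \<in> B i j" and "x = hat_gen sA \<tau> \<epsilon> \<l> i j a r m"
        using x by blast
      then have "x = hat_field sA \<tau> \<epsilon> \<l> i j a r (- m - 1)" by (simp add: hat_field_def)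
      then show ?thesis using formula sigmaM_formula ij unfolding sigma_formula_def by simp
    qed
    ultimately show "x \<in> ?E" by simp
  qed
  ultimately have "hat_alg \<subseteq> ?E" unfolding hat_sub_def[of sA n B \<tau> \<epsilon> \<l>] by (intro ext.span_minimal)
  with x have "\<forall>v. \<sigma>' x v = sigmaM x v" by blast
  then show ?thesis by (intro ext) simp
qed

end

theorem theorem2p4:
  fixes sA :: "complex \<Rightarrow> 'a::ring_1 \<Rightarrow> 'a"
    and tr :: "'a \<Rightarrow> complex"
    and n :: nat
    and L :: "nat \<Rightarrow> 'a set"
    and B :: "nat \<Rightarrow> nat \<Rightarrow> 'a set"
    and \<tau> :: "'a \<Rightarrow> 'a"
    and \<pi> :: "nat \<Rightarrow> nat"
    and \<epsilon> :: nat
    and \<l> :: "nat \<Rightarrow> nat"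
    and \<iota> :: rat
    and sM :: "complex \<Rightarrow> 'm::ab_group_add \<Rightarrow> 'm"
    and \<rho> :: "'a checkA \<Rightarrow> 'm \<Rightarrow> 'm"
    and M0 :: "'m set"
    and m :: nat
  assumes alg: "twisted_trace_algebra sA tr n L B \<tau> \<pi> \<epsilon> \<l>"
    and iota: "\<iota> \<in> {of_int k / 2 | k. True}"
    and M: "lie_representation (check_sub sA n B \<tau> \<epsilon> \<l> \<iota>) (ext_scale sA) (check_bracket tr) sM \<rho>"
    and M0: "module.subspace sM M0"
    and gen: "generated_by (check_sub sA n B \<tau> \<epsilon> \<l> \<iota>) sM \<rho> M0"
    and m: "of_nat m > l_bound n \<l> \<iota>"
    and vanish: "\<forall>x\<in>check_sub_ge sA n B \<tau> \<epsilon> \<l> \<iota> m. \<forall>v\<in>M0. \<rho> x v = 0"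
  shows "(\<forall>i\<in>{1..n}. \<forall>j\<in>{1..n}. \<forall>a\<in>B i j. \<forall>r k v.
            finite {p. sigma_term sA \<tau> \<epsilon> \<l> \<iota> sM \<rho> i j a r k v p \<noteq> 0})
    \<and> (\<exists>\<sigma>. lie_representation (hat_sub sA n B \<tau> \<epsilon> \<l>) (ext_scale sA) (hat_bracket sA tr) sM \<sigma>
          \<and> sigma_formula sA tr n B \<tau> \<epsilon> \<l> \<iota> sM \<rho> \<sigma>
          \<and> (\<forall>\<sigma>'. lie_representation (hat_sub sA n B \<tau> \<epsilon> \<l>) (ext_scale sA) (hat_bracket sA tr) sM \<sigma>'
                   \<and> sigma_formula sA tr n B \<tau> \<epsilon> \<l> \<iota> sM \<rho> \<sigma>'
               \<longrightarrow> (\<forall>x\<in>hat_sub sA n B \<tau> \<epsilon> \<l>. \<sigma>' x = \<sigma> x)))"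
proof -
  obtain k where k: "\<iota> = of_int k / 2" using iota by blast
  interpret twisted_module sA tr n L B \<tau> \<pi> \<epsilon> \<l> \<iota> k sM \<rho> M0 m
  proof -
    interpret twisted_trace_algebra sA tr n L B \<tau> \<pi> \<epsilon> \<l> by (rule alg)
    show "twisted_module sA tr n L B \<tau> \<pi> \<epsilon> \<l> \<iota> k sM \<rho> M0 m"
      by unfold_locales (use k M gen vanish in auto)
  qed
  show ?thesis
    using sigma_term_finite sigmaM_representation sigmaM_formula sigma_unique by blast
qed

end
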